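(* Let $X=\ell_M$ be an Orlicz sequence space, where $M$ is an Orlicz function. Then $X$ contains a subspace $Y$ which admits an equivalent almost transitive norm if and only if $X$ contains a subspace isomorphic to $\ell_2$.
   Context: Banach spaces are infinite-dimensional, real or complex, and "subspace" means closed infinite-dimensional linear subspace. A norm on $Y$ is almost transitive if for every $y$ in the unit sphere of $Y$ the orbit of $y$ under the group of surjective linear isometries of $Y$ (for that norm) is norm dense in the unit sphere. An Orlicz function is a continuous, non-decreasing, convex function $M:[0,\infty)\to[0,\infty)$ with $M(0)=0$ and $\lim_{t\to\infty}M(t)=\infty$; $\ell_M$ is the space of scalar sequences $(a_n)$ with $\sum_nM(|a_n|/\rho)<\infty$ for some $\rho>0$, normed by $\|(a_n)\|=\inf\{\rho>0:\sum_nM(|a_n|/\rho)\le1\}$. *)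

theory Defs
  imports "HOL-Analysis.Analysis" "HOL-Library.Function_Algebras"
begin

text \<open>
  Spaces of scalar sequences are given by a carrier set of functions on the natural numbers,
  with the pointwise operations, and a norm that is meaningful only on the carrier.  The scalar type
  \<open>'k\<close> is to be instantiated with the real or with the complex numbers; linearity is
  linearity over \<open>'k\<close>.
\<close>

definition scale_seq :: "'k::real_normed_field \<Rightarrow> (nat \<Rightarrow> 'k) \<Rightarrow> (nat \<Rightarrow> 'k)" where
  "scale_seq c x = (\<lambda>n. c * x n)"

global_interpretation seq: vector_space "scale_seq :: 'k::real_normed_field \<Rightarrow> _"
  by unfold_locales (auto simp: scale_seq_def fun_eq_iff algebra_simps)

definition orlicz_function :: "(real \<Rightarrow> real) \<Rightarrow> bool" where
  "orlicz_function M \<longleftrightarrow>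
     M ` {0..} \<subseteq> {0..} \<and> continuous_on {0..} M \<and> mono_on {0..} M \<and> convex_on {0..} M \<and>
     M 0 = 0 \<and> filterlim M at_top at_top"

definition orlicz_space :: "(real \<Rightarrow> real) \<Rightarrow> (nat \<Rightarrow> 'k::real_normed_field) set" where
  "orlicz_space M = {a. \<exists>\<rho>>0. summable (\<lambda>n. M (norm (a n) / \<rho>))}"

text \<open>Summability has to be required explicitly: \<^const>\<open>suminf\<close> is unspecified on divergent series.\<close>

definition orlicz_norm :: "(real \<Rightarrow> real) \<Rightarrow> (nat \<Rightarrow> 'k::real_normed_field) \<Rightarrow> real" where
  "orlicz_norm M a =
     Inf {\<rho>. \<rho> > 0 \<and> summable (\<lambda>n. M (norm (a n) / \<rho>)) \<and> (\<Sum>n. M (norm (a n) / \<rho>)) \<le> 1}"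

definition ell2 :: "(nat \<Rightarrow> 'k::real_normed_field) set" where
  "ell2 = {a. summable (\<lambda>n. (norm (a n))\<^sup>2)}"

definition ell2_norm :: "(nat \<Rightarrow> 'k::real_normed_field) \<Rightarrow> real" where
  "ell2_norm a = sqrt (\<Sum>n. (norm (a n))\<^sup>2)"

definition norm_on ::
    "(nat \<Rightarrow> 'k::real_normed_field) set \<Rightarrow> ((nat \<Rightarrow> 'k) \<Rightarrow> real) \<Rightarrow> bool" where
  "norm_on Y N \<longleftrightarrow>
     (\<forall>x\<in>Y. N x \<ge> 0 \<and> (N x = 0 \<longleftrightarrow> x = 0)) \<and>
     (\<forall>c. \<forall>x\<in>Y. N (scale_seq c x) = norm c * N x) \<and>
     (\<forall>x\<in>Y. \<forall>y\<in>Y. N (x + y) \<le> N x + N y)"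

text \<open>
  The distance is set to 0 off the carrier because the locale \<^locale>\<open>Metric_space\<close> demands
  nonnegativity and symmetry everywhere; the topology depends only on the distance on \<open>X\<close>.
\<close>

definition norm_dist ::
    "(nat \<Rightarrow> 'k::real_normed_field) set \<Rightarrow> ((nat \<Rightarrow> 'k) \<Rightarrow> real) \<Rightarrow> (nat \<Rightarrow> 'k) \<Rightarrow> (nat \<Rightarrow> 'k) \<Rightarrow> real" where
  "norm_dist X N x y = (if x \<in> X \<and> y \<in> X then N (x - y) else 0)"

definition norm_topology ::
    "(nat \<Rightarrow> 'k::real_normed_field) set \<Rightarrow> ((nat \<Rightarrow> 'k) \<Rightarrow> real) \<Rightarrow> (nat \<Rightarrow> 'k) topology" where
  "norm_topology X N = Metric_space.mtopology X (norm_dist X N)"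

lemma Metric_space_norm_dist:
  assumes X: "seq.subspace X" and N: "norm_on X N"
  shows "Metric_space X (norm_dist X N)"
proof
  fix x y z
  have diff: "u - v \<in> X" if "u \<in> X" "v \<in> X" for u v
    using seq.subspace_diff[OF X that] .
  have nonneg: "0 \<le> N u" if "u \<in> X" for u
    using N that unfolding norm_on_def by blast
  have zero: "N u = 0 \<longleftrightarrow> u = 0" if "u \<in> X" for u
    using N that unfolding norm_on_def by blast
  have scale: "N (scale_seq c u) = norm c * N u" if "u \<in> X" for c u
    using N that unfolding norm_on_def by blast
  have triangle: "N (u + v) \<le> N u + N v" if "u \<in> X" "v \<in> X" for u v
    using N that unfolding norm_on_def by blast
  show "0 \<le> norm_dist X N x y"
    using nonneg diff by (simp add: norm_dist_def)
  show "norm_dist X N x y = norm_dist X N y x"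
  proof (cases "x \<in> X \<and> y \<in> X")
    case True
    have "scale_seq (- 1) (x - y) = y - x"
      by (simp add: scale_seq_def fun_eq_iff)
    then have "N (y - x) = N (x - y)"
      using scale[OF diff, of x y "- 1"] True by simp
    then show ?thesis
      using True by (simp add: norm_dist_def)
  qed (auto simp: norm_dist_def)
  show "norm_dist X N x y = 0 \<longleftrightarrow> x = y" if "x \<in> X" "y \<in> X"
    using zero[OF diff[OF that]] that by (simp add: norm_dist_def)
  show "norm_dist X N x z \<le> norm_dist X N x y + norm_dist X N y z" if "x \<in> X" "y \<in> X" "z \<in> X"
  proof -
    have "N ((x - y) + (y - z)) \<le> N (x - y) + N (y - z)"
      using triangle[OF diff diff] that by blast
    then show ?thesis using that by (simp add: norm_dist_def)
  qed
qed

definition infinite_dimensional :: "(nat \<Rightarrow> 'k::real_normed_field) set \<Rightarrow> bool" where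
  "infinite_dimensional Y \<longleftrightarrow> \<not> (\<exists>B. finite B \<and> B \<subseteq> Y \<and> seq.span B = Y)"

definition banach_subspace ::
    "(nat \<Rightarrow> 'k::real_normed_field) set \<Rightarrow> (nat \<Rightarrow> 'k) set \<Rightarrow> ((nat \<Rightarrow> 'k) \<Rightarrow> real) \<Rightarrow> bool" where
  "banach_subspace Y X N \<longleftrightarrow>
     Y \<subseteq> X \<and> seq.subspace Y \<and> closedin (norm_topology X N) Y \<and> infinite_dimensional Y"

definition lin_on ::
    "(nat \<Rightarrow> 'k::real_normed_field) set \<Rightarrow> ((nat \<Rightarrow> 'k) \<Rightarrow> (nat \<Rightarrow> 'k)) \<Rightarrow> bool" where
  "lin_on Y T \<longleftrightarrow>
     (\<forall>x\<in>Y. \<forall>y\<in>Y. T (x + y) = T x + T y) \<and>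
     (\<forall>c. \<forall>x\<in>Y. T (scale_seq c x) = scale_seq c (T x))"

definition equivalent_norms_on ::
    "(nat \<Rightarrow> 'k::real_normed_field) set \<Rightarrow> ((nat \<Rightarrow> 'k) \<Rightarrow> real) \<Rightarrow> ((nat \<Rightarrow> 'k) \<Rightarrow> real) \<Rightarrow> bool" where
  "equivalent_norms_on Y N N' \<longleftrightarrow>
     (\<exists>c>0. \<exists>C>0. \<forall>x\<in>Y. c * N x \<le> N' x \<and> N' x \<le> C * N x)"

definition surj_lin_isometries ::
    "(nat \<Rightarrow> 'k::real_normed_field) set \<Rightarrow> ((nat \<Rightarrow> 'k) \<Rightarrow> real) \<Rightarrow> ((nat \<Rightarrow> 'k) \<Rightarrow> (nat \<Rightarrow> 'k)) set" where
  "surj_lin_isometries Y N = {T. lin_on Y T \<and> T ` Y = Y \<and> (\<forall>x\<in>Y. N (T x) = N x)}"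

definition unit_sphere ::
    "(nat \<Rightarrow> 'k::real_normed_field) set \<Rightarrow> ((nat \<Rightarrow> 'k) \<Rightarrow> real) \<Rightarrow> (nat \<Rightarrow> 'k) set" where
  "unit_sphere Y N = {y \<in> Y. N y = 1}"

definition almost_transitive ::
    "(nat \<Rightarrow> 'k::real_normed_field) set \<Rightarrow> ((nat \<Rightarrow> 'k) \<Rightarrow> real) \<Rightarrow> bool" where
  "almost_transitive Y N \<longleftrightarrow>
     (\<forall>y \<in> unit_sphere Y N.
        unit_sphere Y N \<subseteq> norm_topology Y N closure_of {T y | T. T \<in> surj_lin_isometries Y N})"

definition isomorphic_spaces ::
    "(nat \<Rightarrow> 'k::real_normed_field) set \<Rightarrow> ((nat \<Rightarrow> 'k) \<Rightarrow> real) \<Rightarrow>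
     (nat \<Rightarrow> 'k) set \<Rightarrow> ((nat \<Rightarrow> 'k) \<Rightarrow> real) \<Rightarrow> bool" where
  "isomorphic_spaces Y N Z N' \<longleftrightarrow>
     (\<exists>T. lin_on Y T \<and> bij_betw T Y Z \<and> equivalent_norms_on Y N (N' \<circ> T))"

end

theory Submission
  imports Defs
begin

text \<open>
  If \<open>M\<close> fails the doubling condition at 0, then \<open>l\<^sub>M\<close> contains \<open>l\<^sub>\<infinity>\<close>, hence \<open>l\<^sub>2\<close>.  Otherwise every
  infinite-dimensional subspace \<open>Y\<close> of \<open>l\<^sub>M\<close> contains uniformly isomorphic copies of Euclidean spaces of
  all large dimensions: Rademacher combinations of almost disjoint vectors of equal modular.  Choose in
  such a copy a vector at which the ratio of the almost transitive norm \<open>N\<close> to the Euclidean norm is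
  nearly minimal (or nearly maximal) and move it next to a given \<open>u\<close> by an isometry.  The copy meets every
  subspace of small codimension, so there are unit vectors \<open>z\<close> supported arbitrarily far out with
  \<open>N (u + tz)\<^sup>2 \<ge> (N u)\<^sup>2 + \<kappa>t\<^sup>2\<close> (or \<open>\<le>\<close>, with another constant).  Iterating \<open>4\<^sup>r\<close> times with \<open>t = 2\<^sup>-\<^sup>r\<close> shows
  that neither \<open>4\<^sup>r M(2\<^sup>-\<^sup>r\<lambda>)/M(\<lambda>) \<rightarrow> 0\<close> nor \<open>\<rightarrow> \<infinity>\<close> uniformly in \<open>\<lambda>\<close>.  Hence the sequence \<open>4\<^sup>s M(2\<^sup>-\<^sup>s)\<close> has
  arbitrarily long windows over which its sum dominates, up to a constant, the sums over the two
  neighbouring windows, and suitable multiples of sums of the functions \<open>4\<^sup>s M(2\<^sup>-\<^sup>s t)\<close> over such windows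
  are modulars of blocks comparable to \<open>t\<^sup>2\<close>; these blocks span \<open>l\<^sub>2\<close>.
  Conversely \<open>l\<^sub>2\<close> itself is transitive.
\<close>

section \<open>Orlicz sequence spaces through partial sums\<close>

text \<open>Each cut-off in the iteration depends on the vectors already chosen, so the number of
  coordinates to be avoided is not known beforehand; hence Euclidean copies are needed in all large
  dimensions with constants independent of the dimension. Near minimality of the ratio passes a
  Euclidean inequality on to \<open>N\<close>: if \<open>N \<ge> \<mu> |.|\<close> on the copy and
  \<open>N e = 1\<close> with \<open>|e|\<close> close to \<open>1/\<mu>\<close>, then
  \<open>N (e + tz)^2 \<ge> \<mu>^2 |e + tz|^2\<close>, which is about
  \<open>1 + \<mu>^2 t^2 |z|^2\<close> or more once the sign of \<open>z\<close> makes the cross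
  term nonnegative. Near maximality gives the reverse estimate. No extremum has to be attained. The
  \<open>4^r\<close> steps of length \<open>2^-r\<close> have total squared length 1. Thus
  \<open>N\<close> of their sum is bounded below, or above, independently of \<open>r\<close>,
  whereas the modular of the sum is a sum of values of \<open>M\<close> at arguments shrunk by
  \<open>2^-r\<close>. This turns norm estimates into estimates on \<open>M\<close>. They exclude
  only uniform decay and uniform growth: for every \<open>r\<close> some good \<lambda> exists,
  possibly a different one each time. Since no single scale is controlled, the final blocks average
  over many dyadic levels.\<close>

definition modular_le :: "(real \<Rightarrow> real) \<Rightarrow> real \<Rightarrow> real \<Rightarrow> (nat \<Rightarrow> 'k::real_normed_field) \<Rightarrow> bool" where
  "modular_le M s r x \<longleftrightarrow> (\<forall>n. (\<Sum>j<n. M (norm (x j) / s)) \<le> r)"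

locale orlicz =
  fixes M :: "real \<Rightarrow> real"
  assumes orlicz: "orlicz_function M"
begin

lemma M_nonneg: "0 \<le> t \<Longrightarrow> 0 \<le> M t"
  using orlicz unfolding orlicz_function_def by auto

lemma M_zero [simp]: "M 0 = 0"
  using orlicz unfolding orlicz_function_def by auto

lemma M_mono: "0 \<le> s \<Longrightarrow> s \<le> t \<Longrightarrow> M s \<le> M t"
  using orlicz unfolding orlicz_function_def mono_on_def by auto

lemma M_convex:
  assumes "0 \<le> x" "0 \<le> y" "0 \<le> u" "0 \<le> v" "u + v = 1"
  shows "M (u * x + v * y) \<le> u * M x + v * M y"
  using orlicz assms unfolding orlicz_function_def convex_on_def by auto

lemma M_shrink: "0 \<le> u \<Longrightarrow> u \<le> 1 \<Longrightarrow> 0 \<le> t \<Longrightarrow> M (u * t) \<le> u * M t"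
  using M_convex[of t 0 u "1 - u"] by simp

lemma M_stretch:
  assumes "1 \<le> u" "0 \<le> t"
  shows "u * M t \<le> M (u * t)"
proof -
  have "M (inverse u * (u * t)) \<le> inverse u * M (u * t)"
    using assms by (intro M_shrink) (auto simp: field_simps)
  then show ?thesis
    using assms by (simp add: field_simps)
qed

lemma ex_M_ge_1: "\<exists>b>0. M b \<ge> 1"
proof -
  have "eventually (\<lambda>t. M t \<ge> 1) at_top"
    using orlicz unfolding orlicz_function_def filterlim_at_top by auto
  then obtain b where "\<And>t. t \<ge> b \<Longrightarrow> M t \<ge> 1"
    unfolding eventually_at_top_linorder by auto
  then show ?thesis
    by (intro exI[of _ "max b 1"]) auto
qed

text \<open>Any point where \<open>M\<close> has reached 1 serves. By \<open>le_b\<close> it bounds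
  every argument at which \<open>M\<close> is at most 1, so in vectors of modular at most 1 only the
  behaviour of \<open>M\<close> on \<open>[0, b]\<close> is seen.\<close>

definition b :: real where "b = (SOME b. b > 0 \<and> M b \<ge> 1)"

lemma b_pos: "0 < b" and M_b_ge_1: "1 \<le> M b"
  using someI_ex[OF ex_M_ge_1] unfolding b_def by auto

lemma M_gt_1:
  assumes "b < t" shows "1 < M t"
proof -
  have "1 < t / b * 1" using assms b_pos by simp
  also have "\<dots> \<le> t / b * M b"
    using M_b_ge_1 assms b_pos by (intro mult_left_mono) auto
  also have "\<dots> \<le> M (t / b * b)"
    using assms b_pos by (intro M_stretch) auto
  finally show ?thesis using b_pos by simp
qed

lemma le_b: "M t \<le> 1 \<Longrightarrow> t \<le> b"
  using M_gt_1[of t] by linarith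

lemma modular_le_finite:
  assumes "modular_le M s r x" "s > 0" "finite A"
  shows "(\<Sum>j\<in>A. M (norm (x j) / s)) \<le> r"
proof -
  obtain n where "A \<subseteq> {..<n}"
    using assms(3) finite_nat_iff_bounded by blast
  then have "(\<Sum>j\<in>A. M (norm (x j) / s)) \<le> (\<Sum>j<n. M (norm (x j) / s))"
    using assms(2) by (intro sum_mono2 M_nonneg) auto
  then show ?thesis using assms(1) unfolding modular_le_def by (meson order_trans)
qed

lemma modular_leI:
  assumes "\<And>A. finite A \<Longrightarrow> (\<Sum>j\<in>A. M (norm (x j) / s)) \<le> r"
  shows "modular_le M s r x"
  using assms unfolding modular_le_def by auto

text \<open>Partial sums replace the series throughout: a bound on them carries summability with it,
  restricts to finite index sets and survives coordinatewise limits. This equivalence ties them to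
  the norm as defined.\<close>

lemma modular_le_suminf:
  assumes "s > 0"
  shows "modular_le M s r x \<longleftrightarrow>
    summable (\<lambda>n. M (norm (x n) / s)) \<and> (\<Sum>n. M (norm (x n) / s)) \<le> r"
proof -
  have nn: "0 \<le> M (norm (x n) / s)" for n using assms by (intro M_nonneg) auto
  show ?thesis
  proof
    assume *: "modular_le M s r x"
    then have "summable (\<lambda>n. M (norm (x n) / s))"
      using nn by (intro summableI_nonneg_bounded[where x = r]) (auto simp: modular_le_def)
    with * show "summable (\<lambda>n. M (norm (x n) / s)) \<and> (\<Sum>n. M (norm (x n) / s)) \<le> r"
      by (auto intro!: suminf_le_const simp: modular_le_def)
  next
    assume *: "summable (\<lambda>n. M (norm (x n) / s)) \<and> (\<Sum>n. M (norm (x n) / s)) \<le> r"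
    show "modular_le M s r x"
      unfolding modular_le_def
    proof
      fix n
      have "(\<Sum>j<n. M (norm (x j) / s)) \<le> (\<Sum>n. M (norm (x n) / s))"
        using * nn by (intro sum_le_suminf) auto
      with * show "(\<Sum>j<n. M (norm (x j) / s)) \<le> r" by simp
    qed
  qed
qed

lemma modular_le_mono:
  assumes "modular_le M s r y" "s > 0" "\<And>j. norm (x j) \<le> norm (y j)"
  shows "modular_le M s r x"
  unfolding modular_le_def
proof
  fix n
  have "(\<Sum>j<n. M (norm (x j) / s)) \<le> (\<Sum>j<n. M (norm (y j) / s))"
    using assms by (intro sum_mono M_mono divide_right_mono) auto
  also have "\<dots> \<le> r" using assms unfolding modular_le_def by auto
  finally show "(\<Sum>j<n. M (norm (x j) / s)) \<le> r" .
qed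

text \<open>Convexity with \<open>M 0 = 0\<close>: dividing the argument by \<open>u\<close> divides
  the modular by at least \<open>u\<close>. With \<open>u = r\<close> a modular bound
  \<open>r \<ge> 1\<close> becomes a norm bound.\<close>

lemma modular_le_shrink:
  assumes "modular_le M s r x" "s > 0" "1 \<le> u"
  shows "modular_le M (u * s) (r / u) x"
  unfolding modular_le_def
proof
  fix n
  have "(\<Sum>j<n. M (norm (x j) / (u * s))) \<le> (\<Sum>j<n. inverse u * M (norm (x j) / s))"
  proof (intro sum_mono)
    fix j
    have "norm (x j) / (u * s) = inverse u * (norm (x j) / s)"
      by (simp add: field_simps)
    then show "M (norm (x j) / (u * s)) \<le> inverse u * M (norm (x j) / s)"
      using M_shrink[of "inverse u" "norm (x j) / s"] assms by (simp add: field_simps)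
  qed
  also have "\<dots> = inverse u * (\<Sum>j<n. M (norm (x j) / s))"
    by (simp add: sum_distrib_left)
  also have "\<dots> \<le> inverse u * r"
    using assms unfolding modular_le_def by (intro mult_left_mono) auto
  finally show "(\<Sum>j<n. M (norm (x j) / (u * s))) \<le> r / u"
    by (simp add: field_simps)
qed

lemma modular_le_weaken:
  assumes "modular_le M s r x" "s > 0" "s \<le> s'" "r \<le> r'"
  shows "modular_le M s' r' x"
  unfolding modular_le_def
proof
  fix n
  have "(\<Sum>j<n. M (norm (x j) / s')) \<le> (\<Sum>j<n. M (norm (x j) / s))"
    using assms by (intro sum_mono M_mono divide_left_mono) auto
  also have "\<dots> \<le> r" using assms unfolding modular_le_def by auto
  finally show "(\<Sum>j<n. M (norm (x j) / s')) \<le> r'" using assms by simp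
qed

lemma orlicz_space_iff: "x \<in> orlicz_space M \<longleftrightarrow> (\<exists>s>0. modular_le M s 1 x)"
proof
  assume "x \<in> orlicz_space M"
  then obtain s where s: "s > 0" "summable (\<lambda>n. M (norm (x n) / s))"
    unfolding orlicz_space_def by auto
  define r where "r = max 1 (\<Sum>n. M (norm (x n) / s))"
  have "modular_le M s r x"
    using s modular_le_suminf[of s r x] by (simp add: r_def)
  moreover have "r \<ge> 1" by (simp add: r_def)
  ultimately have "modular_le M (r * s) 1 x"
    using s modular_le_shrink[of s r x r] by simp
  then show "\<exists>s>0. modular_le M s 1 x"
    using s \<open>r \<ge> 1\<close> by (intro exI[of _ "r * s"]) auto
next
  assume "\<exists>s>0. modular_le M s 1 x"
  then show "x \<in> orlicz_space M"
    using modular_le_suminf unfolding orlicz_space_def by blast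
qed

lemma orlicz_norm_eq: "orlicz_norm M x = Inf {s. s > 0 \<and> modular_le M s 1 x}"
  unfolding orlicz_norm_def by (rule arg_cong[where f = Inf]) (auto simp: modular_le_suminf)

lemma orlicz_norm_le: "modular_le M s 1 x \<Longrightarrow> s > 0 \<Longrightarrow> orlicz_norm M x \<le> s"
  unfolding orlicz_norm_eq by (intro cInf_lower bdd_belowI[of _ 0]) auto

lemma orlicz_norm_nonneg: "x \<in> orlicz_space M \<Longrightarrow> 0 \<le> orlicz_norm M x"
  unfolding orlicz_norm_eq orlicz_space_iff by (intro cInf_greatest) auto

lemma orlicz_norm_less:
  assumes "x \<in> orlicz_space M" "orlicz_norm M x < s"
  shows "modular_le M s 1 x"
proof -
  have "{s. s > 0 \<and> modular_le M s 1 x} \<noteq> {}"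
    using assms(1) unfolding orlicz_space_iff by auto
  from cInf_lessD[OF this assms(2)[unfolded orlicz_norm_eq]]
  obtain s' where "s' > 0" "modular_le M s' 1 x" "s' < s" by auto
  then show ?thesis by (auto intro: modular_le_weaken[of s' 1 x s 1])
qed

text \<open>The infimum in the norm is attained when positive: by continuity of \<open>M\<close> the
  modular bound at the scales \<open>s + 1/(i+1)\<close> passes to \<open>s\<close> in every finite
  sum.\<close>

lemma modular_le_norm:
  assumes "x \<in> orlicz_space M" "orlicz_norm M x \<le> s" "s > 0"
  shows "modular_le M s 1 x"
  unfolding modular_le_def
proof
  fix n
  have cont: "continuous_on {0..} M"
    using orlicz unfolding orlicz_function_def by auto
  have lim: "(\<lambda>i. \<Sum>j<n. M (norm (x j) / (s + inverse (Suc i)))) \<longlonglongrightarrow> (\<Sum>j<n. M (norm (x j) / s))"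
  proof (rule tendsto_sum)
    fix j
    have "(\<lambda>i. norm (x j) / (s + inverse (Suc i))) \<longlonglongrightarrow> norm (x j) / (s + 0)"
      using assms(3) by (intro tendsto_intros LIMSEQ_inverse_real_of_nat) auto
    moreover have "norm (x j) / s \<in> {0..}" using assms(3) by auto
    moreover have "eventually (\<lambda>i. norm (x j) / (s + inverse (Suc i)) \<in> {0..}) sequentially"
      using assms(3) by (intro always_eventually) (auto intro!: divide_nonneg_nonneg add_nonneg_nonneg)
    ultimately show "(\<lambda>i. M (norm (x j) / (s + inverse (Suc i)))) \<longlonglongrightarrow> M (norm (x j) / s)"
      using continuous_on_tendsto_compose[OF cont] by auto
  qed
  have "modular_le M (s + inverse (Suc i)) 1 x" for i
    using assms by (intro orlicz_norm_less) (auto intro: le_less_trans)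
  then show "(\<Sum>j<n. M (norm (x j) / s)) \<le> 1"
    by (intro LIMSEQ_le_const2[OF lim]) (auto simp: modular_le_def)
qed

lemma orlicz_spaceI: "modular_le M s 1 x \<Longrightarrow> s > 0 \<Longrightarrow> x \<in> orlicz_space M"
  unfolding orlicz_space_iff by auto

lemma orlicz_mono:
  assumes "y \<in> orlicz_space M" "\<And>j. norm (x j) \<le> norm (y j)"
  shows orlicz_space_mono: "x \<in> orlicz_space M"
    and orlicz_norm_mono: "orlicz_norm M x \<le> orlicz_norm M y"
proof -
  show x: "x \<in> orlicz_space M"
    using assms modular_le_mono[where y = y and x = x and r = 1] unfolding orlicz_space_iff by metis
  show "orlicz_norm M x \<le> orlicz_norm M y"
  proof (rule field_le_epsilon)
    fix e :: real assume "e > 0"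
    have "modular_le M (orlicz_norm M y + e) 1 y"
      using \<open>e > 0\<close> assms(1) by (intro orlicz_norm_less) auto
    then have "modular_le M (orlicz_norm M y + e) 1 x"
      using assms orlicz_norm_nonneg[OF assms(1)] \<open>e > 0\<close> by (auto intro: modular_le_mono[of _ _ y x])
    then show "orlicz_norm M x \<le> orlicz_norm M y + e"
      using orlicz_norm_nonneg[OF assms(1)] \<open>e > 0\<close> by (intro orlicz_norm_le) auto
  qed
qed

lemma modular_le_coord:
  assumes "modular_le M s 1 x" "s > 0"
  shows "norm (x j) / s \<le> b"
proof -
  have "(\<Sum>j\<in>{j}. M (norm (x j) / s)) \<le> 1"
    using assms by (intro modular_le_finite) auto
  then show ?thesis by (intro le_b) simp
qed

lemma orlicz_coord:
  assumes "x \<in> orlicz_space M"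
  shows "norm (x j) \<le> b * orlicz_norm M x"
proof -
  have "norm (x j) / b \<le> orlicz_norm M x"
  proof (rule field_le_epsilon)
    fix e :: real assume "e > 0"
    have "modular_le M (orlicz_norm M x + e) 1 x"
      using \<open>e > 0\<close> assms(1) by (intro orlicz_norm_less) auto
    from modular_le_coord[OF this, of j] show "norm (x j) / b \<le> orlicz_norm M x + e"
      using orlicz_norm_nonneg[OF assms] \<open>e > 0\<close> b_pos by (simp add: field_simps)
  qed
  then show ?thesis using b_pos by (simp add: field_simps)
qed

lemma orlicz_scale:
  fixes x :: "nat \<Rightarrow> 'k::real_normed_field"
  assumes "x \<in> orlicz_space M"
  shows orlicz_space_scale: "scale_seq c x \<in> orlicz_space M"
    and orlicz_norm_scale: "orlicz_norm M (scale_seq c x) = norm c * orlicz_norm M x"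
proof -
  have eq: "modular_le M (norm d * s) 1 (scale_seq d y) \<longleftrightarrow> modular_le M s 1 y"
    if "d \<noteq> 0" for d :: 'k and s y
    using that by (simp add: modular_le_def scale_seq_def norm_mult)
  have 0: "modular_le M s 1 (scale_seq 0 x)" for s
    by (simp add: modular_le_def scale_seq_def)
  show cx: "scale_seq d x \<in> orlicz_space M" for d
  proof (cases "d = 0")
    case True then show ?thesis using 0[of 1] by (auto simp: orlicz_space_iff intro!: exI[of _ 1])
  next
    case False
    obtain s where "s > 0" "modular_le M s 1 x" using assms by (auto simp: orlicz_space_iff)
    then show ?thesis using False eq[OF False, of s x]
      by (intro orlicz_spaceI[of "norm d * s"]) auto
  qed
  have le: "orlicz_norm M (scale_seq d y) \<le> norm d * orlicz_norm M y"
    if "d \<noteq> 0" "y \<in> orlicz_space M" for d :: 'k and y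
  proof -
    have "orlicz_norm M (scale_seq d y) / norm d \<le> orlicz_norm M y"
    proof (rule field_le_epsilon)
      fix e :: real assume "e > 0"
      have "modular_le M (orlicz_norm M y + e) 1 y"
        using \<open>e > 0\<close> that by (intro orlicz_norm_less) auto
      then have "orlicz_norm M (scale_seq d y) \<le> norm d * (orlicz_norm M y + e)"
        using that eq[of d] orlicz_norm_nonneg[OF that(2)] \<open>e > 0\<close>
        by (intro orlicz_norm_le) (auto intro!: mult_pos_pos)
      then show "orlicz_norm M (scale_seq d y) / norm d \<le> orlicz_norm M y + e"
        using that by (simp add: field_simps)
    qed
    then show ?thesis using that by (simp add: field_simps)
  qed
  show "orlicz_norm M (scale_seq c x) = norm c * orlicz_norm M x"
  proof (cases "c = 0")
    case True
    have "orlicz_norm M (scale_seq 0 x) \<le> 0 + e" if "e > 0" for e :: real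
      using orlicz_norm_le[OF 0 that] by simp
    then have "orlicz_norm M (scale_seq 0 x) \<le> 0" by (rule field_le_epsilon)
    then show ?thesis using True orlicz_norm_nonneg[OF cx[of 0]] by simp
  next
    case False
    have "orlicz_norm M (scale_seq (inverse c) (scale_seq c x))
        \<le> norm (inverse c) * orlicz_norm M (scale_seq c x)"
      using False cx by (intro le) auto
    moreover have "scale_seq (inverse c) (scale_seq c x) = x"
      using False by (auto simp: scale_seq_def fun_eq_iff)
    ultimately have "norm c * orlicz_norm M x \<le> orlicz_norm M (scale_seq c x)"
      using False by (simp add: norm_inverse norm_divide divide_simps mult.commute)
    then show ?thesis using le[OF False assms] by simp
  qed
qed

lemma orlicz_add:
  assumes "x \<in> orlicz_space M" "y \<in> orlicz_space M"
  shows orlicz_space_add: "x + y \<in> orlicz_space M"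
    and orlicz_norm_triangle: "orlicz_norm M (x + y) \<le> orlicz_norm M x + orlicz_norm M y"
proof -
  have *: "modular_le M (s + r) 1 (x + y)"
    if "modular_le M s 1 x" "modular_le M r 1 y" "s > 0" "r > 0" for s r
    unfolding modular_le_def
  proof
    fix n
    have "(\<Sum>j<n. M (norm ((x + y) j) / (s + r)))
      \<le> (\<Sum>j<n. s / (s + r) * M (norm (x j) / s) + r / (s + r) * M (norm (y j) / r))"
    proof (rule sum_mono)
      fix j
      have "M (norm ((x + y) j) / (s + r)) \<le> M ((norm (x j) + norm (y j)) / (s + r))"
        using that by (intro M_mono divide_right_mono) (auto simp: norm_triangle_ineq)
      also have "(norm (x j) + norm (y j)) / (s + r)
          = s / (s + r) * (norm (x j) / s) + r / (s + r) * (norm (y j) / r)"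
        using that by (simp add: add_divide_distrib)
      also have "M \<dots> \<le> s / (s + r) * M (norm (x j) / s) + r / (s + r) * M (norm (y j) / r)"
        using that by (intro M_convex) (auto simp: add_divide_distrib[symmetric])
      finally show "M (norm ((x + y) j) / (s + r)) \<le> \<dots>" .
    qed
    also have "\<dots> = s / (s + r) * (\<Sum>j<n. M (norm (x j) / s)) + r / (s + r) * (\<Sum>j<n. M (norm (y j) / r))"
      by (simp add: sum.distrib sum_distrib_left)
    also have "\<dots> \<le> s / (s + r) * 1 + r / (s + r) * 1"
      using that unfolding modular_le_def by (intro add_mono mult_left_mono) auto
    also have "\<dots> = 1" using that by (simp add: add_divide_distrib[symmetric])
    finally show "(\<Sum>j<n. M (norm ((x + y) j) / (s + r))) \<le> 1" .
  qed
  obtain s r where "modular_le M s 1 x" "modular_le M r 1 y" "s > 0" "r > 0"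
    using assms unfolding orlicz_space_iff by auto
  from *[OF this] this show "x + y \<in> orlicz_space M" by (intro orlicz_spaceI[of "s + r"]) auto
  show "orlicz_norm M (x + y) \<le> orlicz_norm M x + orlicz_norm M y"
  proof (rule field_le_epsilon)
    fix e :: real assume "e > 0"
    have "modular_le M ((orlicz_norm M x + e / 2) + (orlicz_norm M y + e / 2)) 1 (x + y)"
      using assms \<open>e > 0\<close> orlicz_norm_nonneg[OF assms(1)] orlicz_norm_nonneg[OF assms(2)]
      by (intro * orlicz_norm_less) auto
    then have "orlicz_norm M (x + y) \<le> (orlicz_norm M x + e / 2) + (orlicz_norm M y + e / 2)"
      using \<open>e > 0\<close> orlicz_norm_nonneg[OF assms(1)] orlicz_norm_nonneg[OF assms(2)]
      by (intro orlicz_norm_le) auto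
    then show "orlicz_norm M (x + y) \<le> orlicz_norm M x + orlicz_norm M y + e" by simp
  qed
qed

lemma zero_in_orlicz: "0 \<in> orlicz_space M"
  by (intro orlicz_spaceI[of 1]) (auto simp: modular_le_def)

lemma subspace_orlicz: "seq.subspace (orlicz_space M)"
  unfolding seq.subspace_def
  using zero_in_orlicz orlicz_space_add orlicz_space_scale by blast

lemma norm_on_orlicz: "norm_on (orlicz_space M) (orlicz_norm M)"
proof -
  have "orlicz_norm M x = 0 \<longleftrightarrow> x = 0" if "x \<in> orlicz_space M" for x :: "nat \<Rightarrow> 'a"
  proof
    assume "orlicz_norm M x = 0"
    then show "x = 0" using orlicz_coord[OF that] by (auto simp: fun_eq_iff)
  next
    assume "x = 0"
    then have "x = scale_seq 0 x" by (auto simp: scale_seq_def fun_eq_iff)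
    then show "orlicz_norm M x = 0"
      by (metis norm_zero mult_zero_left orlicz_norm_scale that)
  qed
  then show ?thesis
    unfolding norm_on_def
    using orlicz_norm_nonneg orlicz_norm_scale orlicz_norm_triangle by blast
qed

end

section \<open>The space \<open>l\<^sub>2\<close> and its copies in Orlicz spaces\<close>

text \<open>Gaussian elimination, one equation at a time. The field is kept general because the
  lemma is applied both with scalars of the space and, for real combinations of possibly complex
  vectors, with real numbers.\<close>

lemma nontrivial_solution:
  fixes \<phi> :: "'e \<Rightarrow> 'i \<Rightarrow> 'f::field"
  assumes "finite E" "finite I" "card E < card I"
  shows "\<exists>c. (\<exists>i\<in>I. c i \<noteq> 0) \<and> (\<forall>e\<in>E. (\<Sum>i\<in>I. c i * \<phi> e i) = 0)"
  using assms
proof (induction E arbitrary: \<phi> I)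
  case empty
  then obtain i where "i \<in> I" by fastforce
  then show ?case by (intro exI[of _ "\<lambda>_. 1"]) auto
next
  case (insert e0 E)
  show ?case
  proof (cases "\<forall>i\<in>I. \<phi> e0 i = 0")
    case True
    have "card E < card I" using insert by simp
    from insert.IH[OF insert.prems(1) this, of \<phi>] True show ?thesis
      by (auto intro!: exI)
  next
    case False
    then obtain i0 where i0: "i0 \<in> I" "\<phi> e0 i0 \<noteq> 0" by auto
    define I' where "I' = I - {i0}"
    have I: "I = insert i0 I'" "i0 \<notin> I'" "finite I'" using i0 insert by (auto simp: I'_def)
    have "card E < card I'" using insert I by simp
    from insert.IH[OF I(3) this, of "\<lambda>e i. \<phi> e i - \<phi> e i0 * \<phi> e0 i / \<phi> e0 i0"]
    obtain c where c: "\<exists>i\<in>I'. c i \<noteq> 0"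
      "\<And>e. e \<in> E \<Longrightarrow> (\<Sum>i\<in>I'. c i * (\<phi> e i - \<phi> e i0 * \<phi> e0 i / \<phi> e0 i0)) = 0" by auto
    \<comment> \<open>The value at the pivot \<open>i0\<close> is forced by the equation
      \<open>e0\<close>; the other values solve the system from which \<open>i0\<close> has been
      eliminated.\<close>
    define c' where "c' = c(i0 := - (\<Sum>i\<in>I'. c i * \<phi> e0 i) / \<phi> e0 i0)"
    have eq: "(\<Sum>i\<in>I. c' i * \<phi> e i) =
        (\<Sum>i\<in>I'. c i * \<phi> e i) - (\<Sum>i\<in>I'. c i * \<phi> e0 i) / \<phi> e0 i0 * \<phi> e i0" for e
    proof -
      have "(\<Sum>i\<in>I. c' i * \<phi> e i) = c' i0 * \<phi> e i0 + (\<Sum>i\<in>I'. c' i * \<phi> e i)"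
        using I by simp
      also have "(\<Sum>i\<in>I'. c' i * \<phi> e i) = (\<Sum>i\<in>I'. c i * \<phi> e i)"
        using I by (intro sum.cong) (auto simp: c'_def)
      finally show ?thesis by (simp add: c'_def)
    qed
    have "(\<Sum>i\<in>I. c' i * \<phi> e i) = 0" if "e \<in> E" for e
    proof -
      have "(\<Sum>i\<in>I'. c i * (\<phi> e i - \<phi> e i0 * \<phi> e0 i / \<phi> e0 i0)) =
        (\<Sum>i\<in>I'. c i * \<phi> e i) - (\<Sum>i\<in>I'. c i * \<phi> e0 i * (\<phi> e i0 / \<phi> e0 i0))"
        by (simp add: algebra_simps sum_subtractf)
      also have "(\<Sum>i\<in>I'. c i * \<phi> e0 i * (\<phi> e i0 / \<phi> e0 i0)) =
          (\<Sum>i\<in>I'. c i * \<phi> e0 i) * (\<phi> e i0 / \<phi> e0 i0)"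
        by (rule sum_distrib_right[symmetric])
      finally show ?thesis using c(2)[OF that] eq[of e] by simp
    qed
    moreover have "(\<Sum>i\<in>I. c' i * \<phi> e0 i) = 0" using eq[of e0] i0 by simp
    moreover have "\<exists>i\<in>I. c' i \<noteq> 0" using c(1) I by (auto simp: c'_def)
    ultimately show ?thesis by (intro exI[of _ c']) auto
  qed
qed

lemma sum_fun_apply: "(\<Sum>i\<in>A. f i) x = (\<Sum>i\<in>A. f i x :: 'a::comm_monoid_add)"
  by (induction A rule: infinite_finite_induct) auto

lemma minus_eq_add_scale: "x - y = x + scale_seq (- 1) y"
  by (auto simp: scale_seq_def fun_eq_iff)

lemma lin_on_zero:
  assumes "seq.subspace Y" "lin_on Y T"
  shows "T 0 = 0"
proof -
  have "T (scale_seq 0 0) = scale_seq 0 (T 0)"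
    using assms seq.subspace_0[OF assms(1)] unfolding lin_on_def by blast
  then show ?thesis by simp
qed

lemma lin_on_sum:
  assumes "seq.subspace Y" "lin_on Y T" "\<And>i. i \<in> A \<Longrightarrow> x i \<in> Y"
  shows "T (\<Sum>i\<in>A. scale_seq (c i) (x i)) = (\<Sum>i\<in>A. scale_seq (c i) (T (x i)))"
  using assms(3)
proof (induction A rule: infinite_finite_induct)
  case (insert i A)
  have "scale_seq (c i) (x i) \<in> Y" "(\<Sum>i\<in>A. scale_seq (c i) (x i)) \<in> Y"
    using insert.prems by (auto intro: seq.subspace_scale[OF assms(1)] seq.subspace_sum[OF assms(1)])
  then have "T (scale_seq (c i) (x i) + (\<Sum>i\<in>A. scale_seq (c i) (x i))) =
      T (scale_seq (c i) (x i)) + T (\<Sum>i\<in>A. scale_seq (c i) (x i))"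
    and "T (scale_seq (c i) (x i)) = scale_seq (c i) (T (x i))"
    using insert.prems assms(2) unfolding lin_on_def by blast+
  moreover have "T (\<Sum>i\<in>A. scale_seq (c i) (x i)) = (\<Sum>i\<in>A. scale_seq (c i) (T (x i)))"
    using insert by blast
  ultimately show ?case
    unfolding sum.insert[OF insert.hyps] by (rule trans[OF _ arg_cong2[where f = plus]])
qed (use lin_on_zero[OF assms(1,2)] in auto)

lemma lin_on_diff:
  assumes "seq.subspace Y" "lin_on Y T" "x \<in> Y" "y \<in> Y"
  shows "T (x - y) = T x - T y"
proof -
  have "T (x + scale_seq (- 1) y) = T x + scale_seq (- 1) (T y)"
    using assms(2,3,4) seq.subspace_scale[OF assms(1,4)] unfolding lin_on_def by metis
  then show ?thesis unfolding minus_eq_add_scale .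
qed

section \<open>The Hilbert space of square-summable sequences\<close>

lemma ell2_iff: "a \<in> ell2 \<longleftrightarrow> (\<exists>r. \<forall>n. (\<Sum>j<n. (norm (a j))\<^sup>2) \<le> r)"
proof
  assume "a \<in> ell2"
  then have "(\<Sum>j<n. (norm (a j))\<^sup>2) \<le> (\<Sum>j. (norm (a j))\<^sup>2)" for n
    unfolding ell2_def by (intro sum_le_suminf) auto
  then show "\<exists>r. \<forall>n. (\<Sum>j<n. (norm (a j))\<^sup>2) \<le> r" by blast
next
  assume "\<exists>r. \<forall>n. (\<Sum>j<n. (norm (a j))\<^sup>2) \<le> r"
  then obtain r where "\<And>n. (\<Sum>j<n. (norm (a j))\<^sup>2) \<le> r" by auto
  then show "a \<in> ell2" unfolding ell2_def by (auto intro!: summableI_nonneg_bounded[where x = r])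
qed

lemma ell2_normI:
  assumes "\<And>n. (\<Sum>j<n. (norm (a j))\<^sup>2) \<le> r\<^sup>2" "r \<ge> 0"
  shows "a \<in> ell2" "ell2_norm a \<le> r"
proof -
  show a: "a \<in> ell2" using assms by (auto simp: ell2_iff)
  have "(\<Sum>j. (norm (a j))\<^sup>2) \<le> r\<^sup>2"
    using a assms by (intro suminf_le_const) (auto simp: ell2_def)
  then show "ell2_norm a \<le> r" unfolding ell2_norm_def
    using assms(2) by (metis abs_of_nonneg real_sqrt_abs real_sqrt_le_mono)
qed

lemma ell2_norm_nonneg: "a \<in> ell2 \<Longrightarrow> 0 \<le> ell2_norm a"
  unfolding ell2_norm_def ell2_def by (auto intro!: suminf_nonneg)

lemma ell2_norm_power2: "a \<in> ell2 \<Longrightarrow> (ell2_norm a)\<^sup>2 = (\<Sum>j. (norm (a j))\<^sup>2)"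
  unfolding ell2_norm_def ell2_def by (auto intro!: suminf_nonneg)

lemma ell2_sum_le: "a \<in> ell2 \<Longrightarrow> finite A \<Longrightarrow> (\<Sum>j\<in>A. (norm (a j))\<^sup>2) \<le> (ell2_norm a)\<^sup>2"
  unfolding ell2_norm_power2 unfolding ell2_def by (intro sum_le_suminf) auto

lemma ell2_coord: "a \<in> ell2 \<Longrightarrow> norm (a j) \<le> ell2_norm a"
  using ell2_sum_le[of a "{j}"] ell2_norm_nonneg[of a] by (auto intro: power2_le_imp_le)

lemma ell2_scale:
  assumes "a \<in> ell2"
  shows "scale_seq c a \<in> ell2" "ell2_norm (scale_seq c a) = norm c * ell2_norm a"
proof -
  have s: "summable (\<lambda>j. (norm (a j))\<^sup>2)" using assms by (simp add: ell2_def)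
  have eq: "(norm (scale_seq c a j))\<^sup>2 = (norm c)\<^sup>2 * (norm (a j))\<^sup>2" for j
    by (simp add: scale_seq_def norm_mult power_mult_distrib)
  show "scale_seq c a \<in> ell2" using s unfolding ell2_def mem_Collect_eq eq by (rule summable_mult)
  show "ell2_norm (scale_seq c a) = norm c * ell2_norm a"
    unfolding ell2_norm_def eq suminf_mult[OF s] by (simp add: real_sqrt_mult)
qed

lemma ell2_add:
  assumes "a \<in> ell2" "b \<in> ell2"
  shows "a + b \<in> ell2" "ell2_norm (a + b) \<le> ell2_norm a + ell2_norm b"
proof -
  have "(\<Sum>j<n. (norm ((a + b) j))\<^sup>2) \<le> (ell2_norm a + ell2_norm b)\<^sup>2" for n
  proof -
    have L: "L2_set (\<lambda>j. norm (x j)) {..<n} \<le> ell2_norm x" if "x \<in> ell2" for x :: "nat \<Rightarrow> 'a"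
      unfolding L2_set_def using ell2_sum_le[OF that, of "{..<n}"] ell2_norm_nonneg[OF that]
      by (metis finite_lessThan real_sqrt_le_mono real_sqrt_unique)
    have "L2_set (\<lambda>j. norm ((a + b) j)) {..<n} \<le> L2_set (\<lambda>j. norm (a j) + norm (b j)) {..<n}"
      by (intro L2_set_mono) (auto simp: norm_triangle_ineq)
    also have "\<dots> \<le> L2_set (\<lambda>j. norm (a j)) {..<n} + L2_set (\<lambda>j. norm (b j)) {..<n}"
      by (rule L2_set_triangle_ineq)
    also have "\<dots> \<le> ell2_norm a + ell2_norm b" by (intro add_mono L assms)
    finally have "(L2_set (\<lambda>j. norm ((a + b) j)) {..<n})\<^sup>2 \<le> (ell2_norm a + ell2_norm b)\<^sup>2"
      by (intro power_mono) auto
    then show ?thesis by (simp add: L2_set_def sum_nonneg)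
  qed
  from ell2_normI[of "a + b", OF this] show "a + b \<in> ell2" "ell2_norm (a + b) \<le> ell2_norm a + ell2_norm b"
    using assms by (auto simp: ell2_norm_nonneg)
qed

lemma zero_in_ell2: "0 \<in> ell2" by (auto simp: ell2_def)

lemma subspace_ell2: "seq.subspace ell2"
  unfolding seq.subspace_def using zero_in_ell2 ell2_add(1) ell2_scale(1) by blast

lemma norm_on_ell2: "norm_on ell2 ell2_norm"
proof -
  have "ell2_norm a = 0 \<longleftrightarrow> a = 0" if "a \<in> ell2" for a :: "nat \<Rightarrow> 'a"
  proof
    assume "ell2_norm a = 0"
    then show "a = 0" using ell2_coord[OF that] by (auto simp: fun_eq_iff)
  qed (simp add: ell2_norm_def)
  then show ?thesis
    unfolding norm_on_def using ell2_norm_nonneg ell2_scale(2) ell2_add(2) by blast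
qed

text \<open>Coordinates are dominated by the norm, so coordinatewise limits exist. A bound on the
  finite sums for \<open>a m - a n\<close> survives letting \<open>n\<close> tend to infinity, which
  yields membership and convergence together.\<close>

lemma ell2_complete:
  fixes a :: "nat \<Rightarrow> nat \<Rightarrow> 'k::{real_normed_field,banach}"
  assumes a: "\<And>n. a n \<in> ell2"
    and Cauchy: "\<And>e. e > 0 \<Longrightarrow> \<exists>N. \<forall>m\<ge>N. \<forall>n\<ge>N. ell2_norm (a m - a n) \<le> e"
  shows "\<exists>x\<in>ell2. \<forall>e>0. \<exists>N. \<forall>n\<ge>N. ell2_norm (a n - x) \<le> e"
proof -
  have diff: "a m - a n \<in> ell2" for m n
    using a seq.subspace_diff[OF subspace_ell2] by blast
  have "Cauchy (\<lambda>n. a n j)" for j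
  proof (rule metric_CauchyI)
    fix e :: real assume "e > 0"
    then obtain N where N: "\<And>m n. m \<ge> N \<Longrightarrow> n \<ge> N \<Longrightarrow> ell2_norm (a m - a n) \<le> e / 2"
      using Cauchy[of "e / 2"] by auto
    show "\<exists>M. \<forall>m\<ge>M. \<forall>n\<ge>M. dist (a m j) (a n j) < e"
    proof (intro exI allI impI)
      fix m n assume "N \<le> m" "N \<le> n"
      then have "norm ((a m - a n) j) \<le> e / 2"
        using ell2_coord[OF diff] N by (meson order_trans)
      then show "dist (a m j) (a n j) < e" using \<open>e > 0\<close> by (simp add: dist_norm)
    qed
  qed
  then have "\<forall>j. \<exists>l. (\<lambda>n. a n j) \<longlonglongrightarrow> l"
    using Cauchy_convergent convergent_def by blast
  then obtain x where x: "\<And>j. (\<lambda>n. a n j) \<longlonglongrightarrow> x j" by metis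
  have lim: "a m - x \<in> ell2 \<and> ell2_norm (a m - x) \<le> e"
    if N: "\<And>m n. m \<ge> N \<Longrightarrow> n \<ge> N \<Longrightarrow> ell2_norm (a m - a n) \<le> e" and "m \<ge> N" for N e m
  proof -
    have e: "e \<ge> 0" using N[of m m] that ell2_norm_nonneg[OF diff] by (meson order_trans)
    have "(\<Sum>j<k. (norm ((a m - x) j))\<^sup>2) \<le> e\<^sup>2" for k
    proof (rule LIMSEQ_le_const2)
      show "(\<lambda>n. \<Sum>j<k. (norm ((a m - a n) j))\<^sup>2) \<longlonglongrightarrow> (\<Sum>j<k. (norm ((a m - x) j))\<^sup>2)"
        unfolding fun_diff_def by (intro tendsto_intros x)
      show "\<exists>N. \<forall>n\<ge>N. (\<Sum>j<k. (norm ((a m - a n) j))\<^sup>2) \<le> e\<^sup>2"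
      proof (intro exI allI impI)
        fix n assume "n \<ge> N"
        have "(\<Sum>j<k. (norm ((a m - a n) j))\<^sup>2) \<le> (ell2_norm (a m - a n))\<^sup>2"
          by (intro ell2_sum_le diff) auto
        also have "\<dots> \<le> e\<^sup>2" using N[OF that(2) \<open>n \<ge> N\<close>] ell2_norm_nonneg[OF diff]
          by (intro power_mono) auto
        finally show "(\<Sum>j<k. (norm ((a m - a n) j))\<^sup>2) \<le> e\<^sup>2" .
      qed
    qed
    with ell2_normI[of "a m - x", OF this e] show ?thesis by auto
  qed
  from Cauchy[of 1] obtain N1 where N1: "\<And>m n. m \<ge> N1 \<Longrightarrow> n \<ge> N1 \<Longrightarrow> ell2_norm (a m - a n) \<le> 1"
    by auto
  have "a N1 - x \<in> ell2" using lim[OF N1, of N1] by simp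
  then have "a N1 - (a N1 - x) \<in> ell2" using a seq.subspace_diff[OF subspace_ell2] by blast
  then have "x \<in> ell2" by simp
  moreover have "\<exists>N. \<forall>n\<ge>N. ell2_norm (a n - x) \<le> e" if "e > 0" for e
  proof -
    from Cauchy[OF that] obtain N
      where "\<And>m n. m \<ge> N \<Longrightarrow> n \<ge> N \<Longrightarrow> ell2_norm (a m - a n) \<le> e" by auto
    from lim[OF this] show ?thesis by blast
  qed
  ultimately show ?thesis by blast
qed

section \<open>Criteria for a copy of \<open>ell2\<close>\<close>

abbreviation contains_ell2 :: "'k::real_normed_field itself \<Rightarrow> (real \<Rightarrow> real) \<Rightarrow> bool" where
  "contains_ell2 _ M \<equiv> \<exists>Y. banach_subspace Y (orlicz_space M :: (nat \<Rightarrow> 'k) set) (orlicz_norm M) \<and>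
     isomorphic_spaces Y (orlicz_norm M) ell2 ell2_norm"

context orlicz
begin

text \<open>The two estimates make \<open>S\<close> an isomorphism onto its image. Closedness comes
  from completeness of \<open>ell2\<close>: preimages of a convergent sequence are Cauchy. If the
  image had a finite spanning set, more unit vectors than its size would have dependent images, and
  injectivity would make the unit vectors themselves dependent.\<close>

lemma contains_ell2I:
  fixes S :: "(nat \<Rightarrow> 'k::{real_normed_field,banach}) \<Rightarrow> nat \<Rightarrow> 'k"
  assumes lin: "lin_on ell2 S" and S: "\<And>a. a \<in> ell2 \<Longrightarrow> S a \<in> orlicz_space M"
    and c: "c > 0" "\<And>a. a \<in> ell2 \<Longrightarrow> c * ell2_norm a \<le> orlicz_norm M (S a)"
    and C: "C > 0" "\<And>a. a \<in> ell2 \<Longrightarrow> orlicz_norm M (S a) \<le> C * ell2_norm a"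
  shows "contains_ell2 TYPE('k) M"
proof -
  define Y where "Y = S ` ell2"
  have zero: "a = 0" if "a \<in> ell2" "S a = 0" for a
  proof -
    have "orlicz_norm M (S a) = 0" using that norm_on_orlicz S unfolding norm_on_def by blast
    then have "ell2_norm a = 0"
      using c(1) c(2)[OF that(1)] ell2_norm_nonneg[OF that(1)]
      by (simp add: mult_le_0_iff)
    then show ?thesis using norm_on_ell2 that(1) unfolding norm_on_def by blast
  qed
  have diff: "S (u - v) = S u - S v" "u - v \<in> ell2" if "u \<in> ell2" "v \<in> ell2" for u v
    using lin_on_diff[OF subspace_ell2 lin that] seq.subspace_diff[OF subspace_ell2 that] by auto
  have inj: "inj_on S ell2"
    using zero diff by (intro inj_onI) (metis eq_iff_diff_eq_0)
  have YX: "Y \<subseteq> orlicz_space M" using S by (auto simp: Y_def)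
  have sub: "seq.subspace Y"
    unfolding seq.subspace_def
  proof (intro conjI ballI allI)
    show "0 \<in> Y" using lin_on_zero[OF subspace_ell2 lin] zero_in_ell2 by (force simp: Y_def)
    show "u + v \<in> Y" if "u \<in> Y" "v \<in> Y" for u v
    proof -
      from that obtain x y where "x \<in> ell2" "y \<in> ell2" "u = S x" "v = S y" by (auto simp: Y_def)
      then have "u + v = S (x + y)" "x + y \<in> ell2" using lin ell2_add unfolding lin_on_def by auto
      then show ?thesis by (auto simp: Y_def)
    qed
    show "scale_seq d u \<in> Y" if "u \<in> Y" for u d
    proof -
      from that obtain x where "x \<in> ell2" "u = S x" by (auto simp: Y_def)
      then have "scale_seq d u = S (scale_seq d x)" "scale_seq d x \<in> ell2"
        using lin ell2_scale unfolding lin_on_def by auto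
      then show ?thesis by (auto simp: Y_def)
    qed
  qed
  interpret X: Metric_space "orlicz_space M :: (nat \<Rightarrow> 'k) set" "norm_dist (orlicz_space M) (orlicz_norm M)"
    by (rule Metric_space_norm_dist[OF subspace_orlicz norm_on_orlicz])
  have dist: "norm_dist (orlicz_space M) (orlicz_norm M) u v = orlicz_norm M (u - v)"
    if "u \<in> orlicz_space M" "v \<in> orlicz_space M" for u v :: "nat \<Rightarrow> 'k"
    using that by (simp add: norm_dist_def)
  have closed: "closedin (norm_topology (orlicz_space M) (orlicz_norm M)) Y"
    unfolding norm_topology_def X.metric_closedin_iff_sequentially_closed
  proof (intro conjI allI impI)
    show "Y \<subseteq> orlicz_space M" by (rule YX)
    fix \<sigma> l
    assume *: "range \<sigma> \<subseteq> Y \<and> limitin X.mtopology \<sigma> l sequentially"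
    then have "\<forall>n. \<exists>u\<in>ell2. \<sigma> n = S u" by (auto simp: Y_def)
    then obtain a where a: "\<And>n. a n \<in> ell2" "\<And>n. \<sigma> n = S (a n)" by metis
    have l: "l \<in> orlicz_space M" and conv: "\<And>e. e > 0 \<Longrightarrow> \<exists>N. \<forall>n\<ge>N. orlicz_norm M (S (a n) - l) < e"
    proof -
      show l: "l \<in> orlicz_space M" using * unfolding X.limitin_metric by blast
      fix e :: real assume "e > 0"
      then have "\<forall>\<^sub>F n in sequentially. S (a n) \<in> orlicz_space M \<and>
          norm_dist (orlicz_space M) (orlicz_norm M) (S (a n)) l < e"
        using * unfolding X.limitin_metric a(2) by blast
      then show "\<exists>N. \<forall>n\<ge>N. orlicz_norm M (S (a n) - l) < e"
        using dist[OF _ l] unfolding eventually_sequentially by metis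
    qed
    have Sd: "S (a n) - l \<in> orlicz_space M" for n
      using S a l seq.subspace_diff[OF subspace_orlicz] by blast
    have minus: "orlicz_norm M (- u) = orlicz_norm M u" if "u \<in> orlicz_space M" for u :: "nat \<Rightarrow> 'k"
      using orlicz_norm_scale[OF that, of "-1"] by (simp add: scale_seq_def fun_Compl_def)
    have tri: "orlicz_norm M (u - v) \<le> orlicz_norm M (u - w) + orlicz_norm M (v - w)"
      if "u - w \<in> orlicz_space M" "v - w \<in> orlicz_space M" for u v w :: "nat \<Rightarrow> 'k"
    proof -
      have m: "- (v - w) \<in> orlicz_space M"
        using seq.subspace_neg[OF subspace_orlicz that(2)] .
      have "orlicz_norm M ((u - w) + - (v - w)) \<le> orlicz_norm M (u - w) + orlicz_norm M (- (v - w))"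
        by (rule orlicz_norm_triangle[OF that(1) m])
      then show ?thesis using minus[OF that(2)] by simp
    qed
    have "\<exists>N. \<forall>m\<ge>N. \<forall>n\<ge>N. ell2_norm (a m - a n) \<le> e" if e: "e > 0" for e
    proof -
      obtain N where N: "\<And>n. n \<ge> N \<Longrightarrow> orlicz_norm M (S (a n) - l) < c * e / 2"
        using conv[of "c * e / 2"] e c(1) by auto
      have "ell2_norm (a m - a n) \<le> e" if "m \<ge> N" "n \<ge> N" for m n
      proof -
        have "c * ell2_norm (a m - a n) \<le> orlicz_norm M (S (a m - a n))"
          using a by (intro c diff)
        also have "\<dots> = orlicz_norm M (S (a m) - S (a n))" using diff a by simp
        also have "\<dots> \<le> orlicz_norm M (S (a m) - l) + orlicz_norm M (S (a n) - l)"
          by (intro tri Sd)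
        also have "\<dots> \<le> c * e" using N[OF that(1)] N[OF that(2)] by simp
        finally show ?thesis using c(1) by simp
      qed
      then show ?thesis by blast
    qed
    from ell2_complete[OF a(1) this] obtain x where x: "x \<in> ell2"
      "\<And>e. e > 0 \<Longrightarrow> \<exists>N. \<forall>n\<ge>N. ell2_norm (a n - x) \<le> e" by blast
    have "orlicz_norm M (l - S x) \<le> 0 + e" if e: "e > 0" for e
    proof -
      obtain N1 where N1: "\<And>n. n \<ge> N1 \<Longrightarrow> orlicz_norm M (S (a n) - l) < e / 2"
        using conv[of "e / 2"] e by auto
      obtain N2 where N2: "\<And>n. n \<ge> N2 \<Longrightarrow> ell2_norm (a n - x) \<le> e / (2 * C)"
        using x(2)[of "e / (2 * C)"] e C(1) by auto
      define n where "n = max N1 N2"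
      have xx: "S x - S (a n) \<in> orlicz_space M" "l - S (a n) \<in> orlicz_space M"
        using S a x l seq.subspace_diff[OF subspace_orlicz] by blast+
      have "orlicz_norm M (l - S x) \<le> orlicz_norm M (l - S (a n)) + orlicz_norm M (S x - S (a n))"
        using xx by (intro tri)
      also have "\<dots> = orlicz_norm M (S (a n) - l) + orlicz_norm M (S (a n - x))"
        using minus[OF xx(1)] minus[OF xx(2)] diff(1)[OF a(1) x(1)] by simp
      also have "\<dots> \<le> e / 2 + C * (e / (2 * C))"
        using N1[of n] N2[of n] C(1) by (intro add_mono order_trans[OF C(2)] mult_left_mono)
          (auto simp: n_def intro!: diff a x)
      also have "\<dots> = e" using C(1) by simp
      finally show ?thesis by simp
    qed
    then have "orlicz_norm M (l - S x) \<le> 0" by (rule field_le_epsilon)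
    moreover have lx: "l - S x \<in> orlicz_space M"
      using S x l seq.subspace_diff[OF subspace_orlicz] by blast
    ultimately have "orlicz_norm M (l - S x) = 0" using orlicz_norm_nonneg[OF lx] by simp
    then have "l - S x = 0" using norm_on_orlicz lx unfolding norm_on_def by blast
    then show "l \<in> Y" using x by (auto simp: Y_def)
  qed
  have inf: "infinite_dimensional Y"
    unfolding infinite_dimensional_def
  proof
    assume "\<exists>B. finite B \<and> B \<subseteq> Y \<and> seq.span B = Y"
    then obtain B where B: "finite B" "B \<subseteq> Y" "seq.span B = Y" by auto
    define e :: "nat \<Rightarrow> nat \<Rightarrow> 'k" where "e i = (\<lambda>j. if j = i then 1 else 0)" for i
    have e: "e i \<in> ell2" for i
    proof -
      have "(\<Sum>j<n. (norm (e i j))\<^sup>2) \<le> 1" for n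
      proof -
        have "(\<Sum>j<n. (norm (e i j))\<^sup>2) = (\<Sum>j<n. if j = i then 1 else 0)"
          by (intro sum.cong) (auto simp: e_def)
        then show ?thesis by simp
      qed
      then show ?thesis by (auto simp: ell2_iff)
    qed
    have "\<forall>i. \<exists>g. S (e i) = (\<Sum>v\<in>B. scale_seq (g v) v)"
      using e B seq.span_finite[OF B(1)] by (auto simp: Y_def)
    then obtain g where g: "\<And>i. S (e i) = (\<Sum>v\<in>B. scale_seq (g i v) v)" by metis
    obtain d where d: "\<exists>i\<in>{..card B}. d i \<noteq> 0" "\<And>v. v \<in> B \<Longrightarrow> (\<Sum>i\<le>card B. d i * g i v) = 0"
      using nontrivial_solution[OF B(1), of "{..card B}" "\<lambda>v i. g i v"] by auto
    have "S (\<Sum>i\<le>card B. scale_seq (d i) (e i)) = (\<Sum>i\<le>card B. scale_seq (d i) (S (e i)))"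
      by (intro lin_on_sum[OF subspace_ell2 lin] e)
    also have "\<dots> = (\<Sum>v\<in>B. scale_seq (\<Sum>i\<le>card B. d i * g i v) v)"
      unfolding g seq.scale_sum_right seq.scale_scale seq.scale_sum_left by (rule sum.swap)
    also have "\<dots> = 0" using d(2) by simp
    finally have "(\<Sum>i\<le>card B. scale_seq (d i) (e i)) = 0"
      by (rule zero[rotated])
        (auto intro!: seq.subspace_sum[OF subspace_ell2] seq.subspace_scale[OF subspace_ell2] e)
    then have "(\<Sum>i\<le>card B. scale_seq (d i) (e i)) j = 0" for j by simp
    moreover have "(\<Sum>i\<le>card B. scale_seq (d i) (e i)) j = d j" if "j \<le> card B" for j
      using that unfolding sum_fun_apply by (simp add: scale_seq_def e_def if_distrib[of "\<lambda>x. _ * x"] cong: if_cong)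
    ultimately show False using d(1) by auto
  qed
  define T where "T = inv_into ell2 S"
  have bij: "bij_betw T Y ell2"
    unfolding T_def Y_def using inj by (simp add: bij_betw_inv_into inj_on_imp_bij_betw)
  have TS: "T (S a) = a" if "a \<in> ell2" for a using inj that by (simp add: T_def)
  have "lin_on Y T"
    unfolding lin_on_def Y_def
  proof (intro conjI ballI allI; clarsimp)
    fix x y :: "nat \<Rightarrow> 'k" assume "x \<in> ell2" "y \<in> ell2"
    then show "T (S x + S y) = T (S x) + T (S y)"
      using lin TS[OF ell2_add(1), of x y] TS unfolding lin_on_def by simp
  next
    fix c :: 'k and x :: "nat \<Rightarrow> 'k" assume "x \<in> ell2"
    then show "T (scale_seq c (S x)) = scale_seq c (T (S x))"
      using lin TS[OF ell2_scale(1), of x c] TS unfolding lin_on_def by simp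
  qed
  moreover have "equivalent_norms_on Y (orlicz_norm M) (ell2_norm \<circ> T)"
    unfolding equivalent_norms_on_def Y_def
  proof (intro exI conjI ballI)
    show "1 / C > 0" "1 / c > 0" using c(1) C(1) by auto
    fix y assume "y \<in> S ` ell2"
    then obtain a where a: "a \<in> ell2" "y = S a" by auto
    show "1 / C * orlicz_norm M y \<le> (ell2_norm \<circ> T) y"
      using C(1) C(2)[OF a(1)] a TS[OF a(1)] by (simp add: field_simps)
    show "(ell2_norm \<circ> T) y \<le> 1 / c * orlicz_norm M y"
      using c(1) c(2)[OF a(1)] a TS[OF a(1)] by (simp add: field_simps)
  qed
  ultimately have "isomorphic_spaces Y (orlicz_norm M) ell2 ell2_norm"
    unfolding isomorphic_spaces_def using bij by blast
  moreover have "banach_subspace Y (orlicz_space M) (orlicz_norm M)"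
    unfolding banach_subspace_def using YX sub closed inf by blast
  ultimately show ?thesis by blast
qed

text \<open>Block computations yield modular estimates at positive scales. Letting the scale
  decrease to the norm turns them into norm estimates, including the case of norm 0.\<close>

lemma contains_ell2_modularI:
  fixes S :: "(nat \<Rightarrow> 'k::{real_normed_field,banach}) \<Rightarrow> nat \<Rightarrow> 'k"
  assumes lin: "lin_on ell2 S" and C: "C > 0" and K: "K > 0"
    and upper: "\<And>a s. a \<in> ell2 \<Longrightarrow> ell2_norm a \<le> s \<Longrightarrow> s > 0 \<Longrightarrow> modular_le M (C * s) 1 (S a)"
    and lower: "\<And>a s. a \<in> ell2 \<Longrightarrow> s > 0 \<Longrightarrow> modular_le M s 1 (S a) \<Longrightarrow> ell2_norm a \<le> K * s"
  shows "contains_ell2 TYPE('k) M"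
proof -
  have space: "S a \<in> orlicz_space M" if "a \<in> ell2" for a
    using upper[OF that, of "ell2_norm a + 1"] ell2_norm_nonneg[OF that] C
    by (intro orlicz_spaceI[of "C * (ell2_norm a + 1)"]) auto
  show ?thesis
  proof (rule contains_ell2I[OF lin space, where c = "1 / K" and C = C])
    fix a :: "nat \<Rightarrow> 'k" assume a: "a \<in> ell2"
    show "orlicz_norm M (S a) \<le> C * ell2_norm a"
    proof (rule field_le_epsilon)
      fix e :: real assume e: "e > 0"
      then have "0 < ell2_norm a + e / C" using ell2_norm_nonneg[OF a] C by (intro add_nonneg_pos) auto
      then have "orlicz_norm M (S a) \<le> C * (ell2_norm a + e / C)"
        using upper[OF a, of "ell2_norm a + e / C"] e C by (intro orlicz_norm_le) auto
      then show "orlicz_norm M (S a) \<le> C * ell2_norm a + e" using C by (simp add: distrib_left)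
    qed
    show "1 / K * ell2_norm a \<le> orlicz_norm M (S a)"
    proof (rule field_le_epsilon)
      fix e :: real assume e: "e > 0"
      have "ell2_norm a \<le> K * (orlicz_norm M (S a) + e)"
        using e orlicz_norm_nonneg[OF space[OF a]] space[OF a]
        by (intro lower[OF a] orlicz_norm_less) auto
      then show "1 / K * ell2_norm a \<le> orlicz_norm M (S a) + e" using K by (simp add: field_simps)
    qed
  qed (use C K in auto)
qed

end

definition block_op :: "(nat \<Rightarrow> real list) \<Rightarrow> (nat \<Rightarrow> 'k::real_normed_field) \<Rightarrow> nat \<Rightarrow> 'k" where
  "block_op w a j = (case prod_decode j of (n, c) \<Rightarrow>
     if c < length (w n) then of_real (w n ! c) * a n else 0)"

lemma block_op_add: "block_op w (a + b) = block_op w a + block_op w b"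
  by (auto simp: block_op_def fun_eq_iff algebra_simps split: prod.split)

lemma block_op_scale: "block_op w (scale_seq c a) = scale_seq c (block_op w a)"
  by (auto simp: block_op_def fun_eq_iff scale_seq_def split: prod.split)

text \<open>A choice of weights thus realises a sequence space in which the \<open>n\<close>-th
  coordinate is measured by a convex function of its own. Both constructions of \<open>ell2\<close>,
  with and without the doubling condition, rest on this.\<close>

lemma (in orlicz) modular_block_op:
  assumes w: "\<And>n v. v \<in> set (w n) \<Longrightarrow> 0 \<le> v" and "s > 0"
  shows "modular_le M s r (block_op w a) \<longleftrightarrow>
    (\<forall>N. (\<Sum>n<N. \<Sum>v\<leftarrow>w n. M (v * (norm (a n) / s))) \<le> r)"
proof -
  define G where "G j = M (norm (block_op w a j) / s)" for j
  have Gnn: "0 \<le> G j" for j using \<open>s > 0\<close> by (auto simp: G_def intro!: M_nonneg)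
  define A where "A N = (SIGMA n:{..<N}. {..<length (w n)})" for N
  have A: "finite (A N)" for N by (auto simp: A_def)
  have sum: "(\<Sum>j\<in>prod_encode ` A N. G j) = (\<Sum>n<N. \<Sum>v\<leftarrow>w n. M (v * (norm (a n) / s)))" for N
  proof -
    have "(\<Sum>j\<in>prod_encode ` A N. G j) = (\<Sum>(n, c)\<in>A N. G (prod_encode (n, c)))"
      by (subst sum.reindex) (auto intro: inj_on_subset[OF inj_prod_encode] simp: o_def split_def)
    also have "\<dots> = (\<Sum>n<N. \<Sum>c<length (w n). G (prod_encode (n, c)))"
      unfolding A_def by (subst sum.Sigma) auto
    also have "\<dots> = (\<Sum>n<N. \<Sum>c<length (w n). M (w n ! c * (norm (a n) / s)))"
      using w by (intro sum.cong) (auto simp: G_def block_op_def norm_mult abs_of_nonneg[OF w[OF nth_mem]])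
    also have "\<dots> = (\<Sum>n<N. \<Sum>v\<leftarrow>w n. M (v * (norm (a n) / s)))"
      by (simp add: sum_list_sum_nth atLeast0LessThan)
    finally show ?thesis .
  qed
  show ?thesis
  proof (intro iffI allI)
    fix N assume "modular_le M s r (block_op w a)"
    from modular_le_finite[OF this \<open>s > 0\<close>, of "prod_encode ` A N"] A sum[of N]
    show "(\<Sum>n<N. \<Sum>v\<leftarrow>w n. M (v * (norm (a n) / s))) \<le> r" by (simp add: G_def)
  next
    assume *: "\<forall>N. (\<Sum>n<N. \<Sum>v\<leftarrow>w n. M (v * (norm (a n) / s))) \<le> r"
    show "modular_le M s r (block_op w a)"
    proof (rule modular_leI)
      fix B :: "nat set" assume "finite B"
      then obtain N where N: "B \<subseteq> {..<N}" using finite_nat_iff_bounded by blast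
      have "j \<in> prod_encode ` A N" if j: "j \<in> B" "G j \<noteq> 0" for j
      proof -
        obtain n c where nc: "prod_decode j = (n, c)" by force
        then have j': "j = prod_encode (n, c)" by (metis prod_decode_inverse)
        \<comment> \<open>The pairing function dominates its first argument, so coordinates below
          \<open>N\<close> belong to blocks below \<open>N\<close>.\<close>
        have "n \<le> j" using le_prod_encode_1[of n c] j' by simp
        then have "n < N" using N j by auto
        moreover have "c < length (w n)"
          using j(2) nc by (auto simp: G_def block_op_def split: if_splits)
        ultimately show ?thesis using j' by (auto simp: A_def)
      qed
      then have "(\<Sum>j\<in>B. G j) = (\<Sum>j\<in>B \<inter> prod_encode ` A N. G j)"
        using \<open>finite B\<close> by (intro sum.mono_neutral_right) auto
      also have "\<dots> \<le> (\<Sum>j\<in>prod_encode ` A N. G j)"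
        using A Gnn by (intro sum_mono2) auto
      also have "\<dots> \<le> r" using * sum by simp
      finally show "(\<Sum>j\<in>B. M (norm (block_op w a j) / s)) \<le> r" by (simp add: G_def)
    qed
  qed
qed

section \<open>Balanced windows and norming functionals\<close>

lemma unbounded_power2: "\<exists>i::nat. 2 ^ i > (K::real)"
  using real_arch_pow[of 2 K] by auto

text \<open>Otherwise every middle window beyond \<open>J\<close> is less than half of one of its
  neighbours. A growth, once it occurs, rules out decay at the next window and so persists for ever;
  if growth never occurs, every window decays. In both cases the window sums are geometric, and the
  bounds by \<open>L\<close> transfer this to \<open>\<phi>\<close> from every starting index,
  against \<open>K\<close> or against \<epsilon>.\<close>

lemma balanced_window:
  fixes \<phi> :: "nat \<Rightarrow> real" and L :: real
  assumes pos: "\<And>s. \<phi> s > 0" and L: "L \<ge> 1" "\<And>s. \<phi> (Suc s) \<le> L * \<phi> s" "\<And>s. \<phi> s \<le> L * \<phi> (Suc s)"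
    and \<epsilon>: "\<epsilon> > 0" "\<And>r. \<exists>s. \<epsilon> * \<phi> s \<le> \<phi> (s + r)"
    and K: "\<And>r. \<exists>s. \<phi> (s + r) \<le> K * \<phi> s"
    and n: "n \<ge> 1"
  shows "\<exists>a\<ge>J. (\<Sum>r<n. \<phi> (a + r)) \<le> 2 * (\<Sum>r<n. \<phi> (a + n + r)) \<and>
    (\<Sum>r<n. \<phi> (a + 2 * n + r)) \<le> 2 * (\<Sum>r<n. \<phi> (a + n + r))"
proof (rule ccontr)
  define S where "S a = (\<Sum>r<n. \<phi> (a + r))" for a
  assume "\<not> ?thesis"
  then have no: "2 * S (a + n) < S a \<or> 2 * S (a + n) < S (a + 2 * n)" if "a \<ge> J" for a
    using that unfolding S_def by (metis linorder_not_le)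
  have S_pos: "S a > 0" for a
    unfolding S_def using n pos by (intro sum_pos) (auto simp: lessThan_empty_iff)
  have up: "\<phi> (s + i) \<le> L ^ i * \<phi> s" and down: "\<phi> s \<le> L ^ i * \<phi> (s + i)" for s i
  proof (induction i)
    case (Suc i)
    { case 1
      have "\<phi> (s + Suc i) \<le> L * \<phi> (s + i)" using L(2) by simp
      also have "\<dots> \<le> L * (L ^ i * \<phi> s)" using Suc(1) L(1) by (intro mult_left_mono) auto
      finally show ?case by simp }
    { case 2
      have "\<phi> s \<le> L ^ i * \<phi> (s + i)" by (rule Suc(2))
      also have "\<dots> \<le> L ^ i * (L * \<phi> (s + Suc i))"
        using L(1,3) by (intro mult_left_mono) auto
      finally show ?case by (simp add: mult_ac) }
  qed auto
  have mono: "L ^ i * \<phi> s \<le> L ^ j * \<phi> s" if "i \<le> j" for i j s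
    using that L(1) pos[of s] by (intro mult_right_mono power_increasing) auto
  have S_ge: "\<phi> (a + r) \<le> S a" if "r < n" for a r
    unfolding S_def using that pos by (intro member_le_sum) (auto intro: less_imp_le)
  have S_le: "S a \<le> n * (L ^ n * \<phi> (a + r))" if "r < n" for a r
  proof -
    have "\<phi> (a + r') \<le> L ^ n * \<phi> (a + r)" if "r' < n" for r'
    proof (cases "r \<le> r'")
      case True
      then show ?thesis using up[of "a + r" "r' - r"] mono[of "r' - r" n "a + r"] that by (simp add: order_trans)
    next
      case False
      then show ?thesis
        using down[of "a + r'" "r - r'"] mono[of "r - r'" n "a + r"] \<open>r < n\<close> by (simp add: order_trans)
    qed
    then have "S a \<le> (\<Sum>r'<n. L ^ n * \<phi> (a + r))" unfolding S_def by (intro sum_mono) auto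
    then show ?thesis by simp
  qed
  show False
  proof (cases "\<exists>a\<ge>J. 2 * S a < S (a + n)")
    case True
    then obtain a0 where a0: "a0 \<ge> J" "2 * S a0 < S (a0 + n)" by auto
    have step: "2 * S (a0 + j * n) < S (a0 + j * n + n)" for j
    proof (induction j)
      case (Suc j)
      then have "\<not> 2 * S (a0 + j * n + n) < S (a0 + j * n)"
        using S_pos[of "a0 + j * n"] by linarith
      then have "2 * S (a0 + j * n + n) < S (a0 + j * n + 2 * n)"
        using no[of "a0 + j * n"] a0(1) by auto
      moreover have "a0 + Suc j * n = a0 + j * n + n" "a0 + j * n + n + n = a0 + j * n + 2 * n"
        by simp_all
      ultimately show ?case by (simp only:)
    qed (use a0 in simp)
    have grow: "2 ^ i * S (a0 + j * n) \<le> S (a0 + (j + i) * n)" for i j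
    proof (induction i)
      case (Suc i)
      have "2 ^ Suc i * S (a0 + j * n) \<le> 2 * S (a0 + (j + i) * n)" using Suc by simp
      also have "\<dots> \<le> S (a0 + (j + Suc i) * n)"
        using step[of "j + i"] by (simp add: algebra_simps)
      finally show ?case .
    qed auto
    \<comment> \<open>Growth is known only along windows starting at \<open>a0 + j * n\<close>. An
      arbitrary index is brought into one of them by a shift of \<open>a0\<close>, at the cost of
      \<open>L ^ a0\<close> at either end; \<open>n * L ^ n\<close> compares a window sum with one
      of its terms.\<close>
    define \<kappa> where "\<kappa> = L ^ a0 * (n * (L ^ n * L ^ a0))"
    have \<kappa>: "2 ^ i * \<phi> s \<le> \<kappa> * \<phi> (s + i * n)" for i s
    proof -
      define j where "j = s div n"
      define r where "r = s mod n"
      have s: "s = j * n + r" "r < n" using n by (auto simp: j_def r_def)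
      have "2 ^ i * \<phi> s \<le> 2 ^ i * (L ^ a0 * \<phi> (s + a0))"
        using down by (intro mult_left_mono) auto
      also have "\<dots> \<le> 2 ^ i * (L ^ a0 * S (a0 + j * n))"
        using S_ge[OF s(2), of "a0 + j * n"] s L(1) by (intro mult_left_mono) (auto simp: ac_simps)
      also have "\<dots> = L ^ a0 * (2 ^ i * S (a0 + j * n))" by simp
      also have "\<dots> \<le> L ^ a0 * S (a0 + (j + i) * n)"
        using L(1) by (intro mult_left_mono grow) auto
      also have "\<dots> \<le> L ^ a0 * (n * (L ^ n * \<phi> (a0 + (j + i) * n + r)))"
        using L(1) by (intro mult_left_mono S_le[OF s(2)]) auto
      also have "a0 + (j + i) * n + r = s + i * n + a0" using s by (simp add: algebra_simps)
      also have "L ^ a0 * (n * (L ^ n * \<phi> (s + i * n + a0))) \<le>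
          L ^ a0 * (n * (L ^ n * (L ^ a0 * \<phi> (s + i * n))))"
        using L(1) by (intro mult_left_mono up) auto
      finally show ?thesis by (simp add: \<kappa>_def mult_ac)
    qed
    obtain i where i: "2 ^ i > \<kappa> * K" using unbounded_power2 by blast
    obtain s where s: "\<phi> (s + i * n) \<le> K * \<phi> s" using K by blast
    have "\<kappa> \<ge> 0" using L(1) by (simp add: \<kappa>_def)
    have "2 ^ i * \<phi> s \<le> \<kappa> * \<phi> (s + i * n)" by (rule \<kappa>)
    also have "\<dots> \<le> \<kappa> * (K * \<phi> s)" using s \<open>\<kappa> \<ge> 0\<close> by (rule mult_left_mono)
    finally have "2 ^ i * \<phi> s \<le> (\<kappa> * K) * \<phi> s" by simp
    with i pos[of s] show False by simp
  next
    case False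
    then have step: "2 * S (a + n) < S a" if "a \<ge> J" for a
    proof -
      have "a + n \<ge> J" using that by simp
      with False have "S (a + n + n) \<le> 2 * S (a + n)" using linorder_not_le by blast
      moreover have "a + n + n = a + 2 * n" by simp
      ultimately show ?thesis using no[OF that] by (smt (verit))
    qed
    have decay: "2 ^ i * S (a + i * n) \<le> S a" if "a \<ge> J" for a i
    proof (induction i)
      case (Suc i)
      have "2 ^ Suc i * S (a + Suc i * n) = 2 ^ i * (2 * S (a + i * n + n))"
        by (simp add: algebra_simps)
      also have "\<dots> \<le> 2 ^ i * S (a + i * n)"
        using step[of "a + i * n"] that by (intro mult_left_mono) auto
      also have "\<dots> \<le> S a" by (rule Suc)
      finally show ?case .
    qed auto
    define \<kappa> where "\<kappa> = L ^ J * (n * (L ^ n * L ^ J))"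
    have \<kappa>: "2 ^ i * \<phi> (s + i * n) \<le> \<kappa> * \<phi> s" for i s
    proof -
      have "2 ^ i * \<phi> (s + i * n) \<le> 2 ^ i * (L ^ J * \<phi> (s + i * n + J))"
        using down by (intro mult_left_mono) auto
      also have "\<dots> \<le> 2 ^ i * (L ^ J * S (s + J + i * n))"
        using S_ge[of 0 "s + J + i * n"] n L(1) by (intro mult_left_mono) (auto simp: ac_simps)
      also have "\<dots> = L ^ J * (2 ^ i * S (s + J + i * n))" by simp
      also have "\<dots> \<le> L ^ J * S (s + J)" using L(1) by (intro mult_left_mono decay) auto
      also have "\<dots> \<le> L ^ J * (n * (L ^ n * \<phi> (s + J)))"
        using S_le[of 0 "s + J"] n L(1) by (intro mult_left_mono) auto
      also have "\<dots> \<le> L ^ J * (n * (L ^ n * (L ^ J * \<phi> s)))"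
        using L(1) by (intro mult_left_mono up) auto
      finally show ?thesis by (simp add: \<kappa>_def mult_ac)
    qed
    obtain i where i: "2 ^ i > \<kappa> / \<epsilon>" using unbounded_power2 by blast
    obtain s where s: "\<epsilon> * \<phi> s \<le> \<phi> (s + i * n)" using \<epsilon>(2) by blast
    have "2 ^ i * (\<epsilon> * \<phi> s) \<le> 2 ^ i * \<phi> (s + i * n)" using s by (intro mult_left_mono) auto
    also have "\<dots> \<le> \<kappa> * \<phi> s" by (rule \<kappa>)
    finally have "(2 ^ i * \<epsilon>) * \<phi> s \<le> \<kappa> * \<phi> s" by (simp add: mult_ac)
    then have "2 ^ i * \<epsilon> \<le> \<kappa>" using pos[of s] by simp
    then show False using i \<epsilon>(1) by (simp add: field_simps)
  qed
qed

text \<open>The classical embedding of a separable space into the bounded sequences: functionals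
  with finitely many coefficients from a countable dense set, divided by their Euclidean
  norms.\<close>

lemma norming_functionals:
  obtains R :: "(nat \<Rightarrow> 'k::{real_normed_field,second_countable_topology}) \<Rightarrow> nat \<Rightarrow> 'k"
  where "lin_on ell2 R" "\<And>a n. a \<in> ell2 \<Longrightarrow> norm (R a n) \<le> ell2_norm a"
    "\<And>a. a \<in> ell2 \<Longrightarrow> \<exists>n. ell2_norm a \<le> 4 * norm (R a n)"
proof -
  obtain D :: "'k set" where D: "countable D" "\<And>X. open X \<Longrightarrow> X \<noteq> {} \<Longrightarrow> \<exists>d\<in>D. d \<in> X"
    using countable_dense_setE by blast
  define l where "l = from_nat_into (lists D)"
  have range: "range l = lists D"
    unfolding l_def using D(1) by (intro range_from_nat_into) auto
  define \<rho> where "\<rho> n = L2_set (\<lambda>j. norm (l n ! j)) {..<length (l n)}" for n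
  \<comment> \<open>If all coefficients in \<open>l n\<close> vanish, then
    \<open>\<rho> n = 0\<close> and division by zero gives \<open>R a n = 0\<close>; such indices
    are harmless for the upper bound.\<close>
  define R where "R a n = (\<Sum>j<length (l n). l n ! j * a j) / of_real (\<rho> n)" for a :: "nat \<Rightarrow> 'k" and n
  have "lin_on ell2 R"
    unfolding lin_on_def R_def
    by (auto simp: fun_eq_iff scale_seq_def sum.distrib distrib_left add_divide_distrib sum_distrib_left mult_ac)
  moreover have "norm (R a n) \<le> ell2_norm a" if a: "a \<in> ell2" for a n
  proof (cases "\<rho> n = 0")
    case False
    then have \<rho>: "\<rho> n > 0" using L2_set_nonneg by (metis \<rho>_def less_eq_real_def)
    have "norm (\<Sum>j<length (l n). l n ! j * a j) \<le> (\<Sum>j<length (l n). \<bar>norm (l n ! j)\<bar> * \<bar>norm (a j)\<bar>)"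
      by (intro sum_norm_le) (auto simp: norm_mult)
    also have "\<dots> \<le> \<rho> n * L2_set (\<lambda>j. norm (a j)) {..<length (l n)}"
      unfolding \<rho>_def by (rule L2_set_mult_ineq)
    also have "L2_set (\<lambda>j. norm (a j)) {..<length (l n)} \<le> ell2_norm a"
      unfolding L2_set_def using ell2_sum_le[OF a, of "{..<length (l n)}"] ell2_norm_nonneg[OF a]
      by (metis finite_lessThan real_sqrt_le_mono real_sqrt_unique)
    finally show ?thesis using \<rho> by (simp add: R_def norm_divide field_simps)
  qed (use ell2_norm_nonneg[OF a] in \<open>simp add: R_def\<close>)
  moreover have "\<exists>n. ell2_norm a \<le> 4 * norm (R a n)" if a: "a \<in> ell2" for a
  proof (cases "ell2_norm a = 0")
    case False
    define s where "s = ell2_norm a"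
    have s: "s > 0" using False ell2_norm_nonneg[OF a] by (simp add: s_def)
    have "\<exists>N. (\<Sum>j<N. (norm (a j))\<^sup>2) > (s / 2)\<^sup>2"
    proof (rule ccontr)
      assume "\<not> ?thesis"
      then have "\<And>N. (\<Sum>j<N. (norm (a j))\<^sup>2) \<le> (s / 2)\<^sup>2" by (simp add: not_less)
      from ell2_normI(2)[OF this] s show False by (simp add: s_def)
    qed
    then obtain N where N: "(\<Sum>j<N. (norm (a j))\<^sup>2) > (s / 2)\<^sup>2" by blast
    define A where "A = L2_set (\<lambda>j. norm (a j)) {..<N}"
    have A2: "A\<^sup>2 = (\<Sum>j<N. (norm (a j))\<^sup>2)" by (simp add: A_def L2_set_def sum_nonneg)
    have "A \<ge> 0" by (simp add: A_def L2_set_nonneg)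
    then have A: "A > s / 2" using N A2 by (intro power2_less_imp_less[of "s / 2" A]) auto
    have N0: "N > 0" using N by (cases N) auto
    \<comment> \<open>In a field with multiplicative norm this quotient acts as the conjugate of
      \<open>a j\<close>; at \<open>a j = 0\<close> the convention for division makes it 0.\<close>
    define c where "c j = of_real ((norm (a j))\<^sup>2) / a j" for j
    have ca: "c j * a j = of_real ((norm (a j))\<^sup>2)" for j by (cases "a j = 0") (auto simp: c_def)
    have nc: "norm (c j) = norm (a j)" for j
      by (cases "a j = 0") (auto simp: c_def norm_divide power2_eq_square norm_mult)
    \<comment> \<open>The errors of the \<open>N\<close> coefficients add up to at most
      \<open>A / 3\<close>. Then \<open>\<rho> n\<close> is at most \<open>4/3 A\<close> and the
      pairing at least \<open>2/3 A^2\<close>, with quotient at least \<open>A / 2\<close>; since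
      \<open>A > s / 2\<close>, this is the factor 4.\<close>
    define \<delta> where "\<delta> = A / (3 * N)"
    have \<delta>: "\<delta> > 0" "\<delta> * N = A / 3" using A s N0 by (auto simp: \<delta>_def)
    have "\<forall>j. \<exists>d\<in>D. d \<in> ball (c j) \<delta>" using D(2)[of "ball _ \<delta>"] \<delta> by auto
    then obtain d where d: "\<And>j. d j \<in> D" "\<And>j. norm (d j - c j) < \<delta>"
      by (metis dist_norm dist_commute mem_ball)
    have "map d [0..<N] \<in> lists D" using d(1) by auto
    then obtain n where n: "l n = map d [0..<N]" using range by (metis rangeE)
    have aA: "norm (a j) \<le> A" if "j < N" for j
      unfolding A_def using that by (intro member_le_L2_set) auto
    have \<rho>A: "\<rho> n \<le> 4 / 3 * A"
    proof -
      have "\<rho> n = L2_set (\<lambda>j. norm (d j)) {..<N}"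
        unfolding \<rho>_def n by (rule L2_set_cong) auto
      also have "\<dots> \<le> L2_set (\<lambda>j. norm (c j) + norm (d j - c j)) {..<N}"
        by (intro L2_set_mono) (auto simp: norm_triangle_sub)
      also have "\<dots> \<le> L2_set (\<lambda>j. norm (c j)) {..<N} + L2_set (\<lambda>j. norm (d j - c j)) {..<N}"
        by (rule L2_set_triangle_ineq)
      also have "L2_set (\<lambda>j. norm (d j - c j)) {..<N} \<le> (\<Sum>j<N. norm (d j - c j))"
        by (intro L2_set_le_sum) auto
      also have "\<dots> \<le> (\<Sum>j<N. \<delta>)" using d by (intro sum_mono less_imp_le) auto
      finally show ?thesis using \<delta> by (simp add: nc A_def[symmetric] mult.commute)
    qed
    have "norm (\<Sum>j<N. d j * a j) \<ge> 2 / 3 * A\<^sup>2"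
    proof -
      have "(\<Sum>j<N. c j * a j) - (\<Sum>j<N. d j * a j) = (\<Sum>j<N. (c j - d j) * a j)"
        by (simp add: sum_subtractf algebra_simps)
      moreover have "norm (\<Sum>j<N. (c j - d j) * a j) \<le> (\<Sum>j<N. \<delta> * A)"
      proof (intro sum_norm_le)
        fix j assume "j \<in> {..<N}"
        then show "norm ((c j - d j) * a j) \<le> \<delta> * A"
          unfolding norm_mult using d(2)[of j] aA[of j] \<delta>
          by (intro mult_mono) (auto simp: norm_minus_commute)
      qed
      moreover have "(\<Sum>j<N. \<delta> * A) = A\<^sup>2 / 3"
        using \<delta>(2) by (simp add: power2_eq_square mult_ac)
      moreover have "(\<Sum>j<N. c j * a j) = of_real (A\<^sup>2)" unfolding ca A2 by simp
      moreover have "norm (of_real (A\<^sup>2) :: 'k) = A\<^sup>2"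
        by (simp only: norm_of_real abs_power2)
      ultimately show ?thesis
        using norm_triangle_ineq2[of "\<Sum>j<N. c j * a j" "\<Sum>j<N. d j * a j"] by simp
    qed
    moreover have "(\<Sum>j<length (l n). l n ! j * a j) = (\<Sum>j<N. d j * a j)"
      unfolding n by (intro sum.cong) auto
    ultimately have num: "norm (\<Sum>j<length (l n). l n ! j * a j) \<ge> 2 / 3 * A\<^sup>2" by simp
    have "\<rho> n \<noteq> 0"
    proof
      assume "\<rho> n = 0"
      then have "l n ! j = 0" if "j < length (l n)" for j
        using that by (auto simp: \<rho>_def L2_set_eq_0_iff)
      then have "(\<Sum>j<length (l n). l n ! j * a j) = 0" by simp
      then show False using num A s by (simp add: not_le)
    qed
    then have \<rho>: "\<rho> n > 0" using L2_set_nonneg by (metis \<rho>_def less_eq_real_def)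
    have "A / 2 * \<rho> n \<le> A / 2 * (4 / 3 * A)" using \<rho>A A s by (intro mult_left_mono) auto
    also have "\<dots> \<le> norm (\<Sum>j<length (l n). l n ! j * a j)" using num by (simp add: power2_eq_square)
    finally have "A / 2 \<le> norm (R a n)" using \<rho> by (simp add: R_def norm_divide field_simps)
    then show ?thesis using A by (intro exI[of _ n]) (simp add: s_def)
  qed auto
  ultimately show thesis by (rule that)
qed

section \<open>Orlicz functions failing the doubling condition\<close>

context orlicz
begin

text \<open>The doubling condition at 0, asked on the bounded interval that coordinates can reach.
  It fails for an \<open>M\<close> that vanishes near 0, because \<open>M\<close> is positive at
  \<open>b\<close>; such \<open>M\<close> belong to the case of a copy of
  \<open>l_\<infinity>\<close>.\<close>

definition delta2 :: bool where
  "delta2 \<longleftrightarrow> (\<exists>D. \<forall>t. 0 < t \<longrightarrow> t \<le> b \<longrightarrow> M (2 * t) \<le> D * M t)"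

text \<open>Where doubling fails with a large constant, about \<open>1 / M (2 * t)\<close> copies of
  \<open>t\<close> have tiny modular while the doubled vector has modular at least 1. Such blocks
  play the role of the unit vectors of \<open>l_\<infinity>\<close>.\<close>

lemma not_delta2_blocks:
  assumes "\<not> delta2"
  obtains w where "\<And>n v. v \<in> set (w n) \<Longrightarrow> 0 \<le> v"
    "\<And>n. (\<Sum>v\<leftarrow>w n. M v) \<le> (1 / 2) ^ Suc n" "\<And>n. 1 \<le> (\<Sum>v\<leftarrow>w n. M (2 * v))"
proof -
  have "\<exists>w. (\<forall>v\<in>set w. 0 \<le> v) \<and> (\<Sum>v\<leftarrow>w. M v) \<le> (1 / 2) ^ Suc n \<and> 1 \<le> (\<Sum>v\<leftarrow>w. M (2 * v))" for n
  proof -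
    define H where "H = M (2 * b)"
    have H: "H \<ge> 0" using b_pos by (auto simp: H_def intro: M_nonneg)
    \<comment> \<open>Rounding the number of copies up adds at most one term
      \<open>M (2 * t) \<le> H\<close>, so \<open>2 + H\<close> bounds the modular of the doubled
      block; the power of 2 makes the modulars of the blocks summable.\<close>
    define D where "D = (2 + H) * 2 ^ Suc n"
    have D: "D > 0" using H by (simp add: D_def)
    obtain t where t: "0 < t" "t \<le> b" "M (2 * t) > D * M t"
      using assms unfolding delta2_def by (meson not_le)
    have t0: "M t \<ge> 0" "M (2 * t) > 0"
    proof -
      show "M t \<ge> 0" using t by (intro M_nonneg) auto
      then have "0 \<le> D * M t" using D by simp
      then show "M (2 * t) > 0" using t(3) by linarith
    qed
    define m where "m = nat \<lceil>1 / M (2 * t)\<rceil>"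
    have "1 / M (2 * t) \<le> m" unfolding m_def using t0 by linarith
    then have m1: "1 \<le> m * M (2 * t)" using t0 by (simp add: field_simps)
    have "real m \<le> 1 / M (2 * t) + 1" unfolding m_def using t0 by (simp add: ceiling_correct)
    then have "m * M (2 * t) \<le> (1 / M (2 * t) + 1) * M (2 * t)"
      using t0 by (intro mult_right_mono) auto
    also have "\<dots> = 1 + M (2 * t)" using t0 by (simp add: field_simps)
    also have "M (2 * t) \<le> H" unfolding H_def using t by (intro M_mono) auto
    finally have m2: "m * M (2 * t) \<le> 2 + H" by simp
    have "D * (m * M t) = m * (D * M t)" by simp
    also have "\<dots> \<le> m * M (2 * t)" using t(3) by (intro mult_left_mono) auto
    also have "\<dots> \<le> 2 + H" by (rule m2)
    finally have "2 ^ Suc n * (m * M t) * (2 + H) \<le> 1 * (2 + H)" by (simp add: D_def mult_ac)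
    then have "2 ^ Suc n * (m * M t) \<le> 1" using H by (subst (asm) mult_le_cancel_right) auto
    then have "m * M t \<le> (1 / 2) ^ Suc n" by (simp add: power_one_over field_simps)
    then show ?thesis
      using t m1 by (intro exI[of _ "replicate m t"]) (auto simp: sum_list_replicate)
  qed
  then obtain w where "\<forall>n. (\<forall>v\<in>set (w n). 0 \<le> v) \<and> (\<Sum>v\<leftarrow>w n. M v) \<le> (1 / 2) ^ Suc n \<and> 1 \<le> (\<Sum>v\<leftarrow>w n. M (2 * v))"
    by metis
  then show thesis using that[of w] by blast
qed

text \<open>\<open>ell2\<close> goes into the bounded sequences by \<open>R\<close>, and these go
  into the Orlicz space by the blocks. The lower constant 8 is the 4 of the norming functionals
  times the 2 of the doubled blocks.\<close>

lemma not_delta2_contains_ell2: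
  assumes "\<not> delta2"
  shows "contains_ell2 TYPE('k::{real_normed_field,euclidean_space}) M"
proof -
  obtain w where w: "\<And>n v. v \<in> set (w n) \<Longrightarrow> 0 \<le> v"
    "\<And>n. (\<Sum>v\<leftarrow>w n. M v) \<le> (1 / 2) ^ Suc n" "\<And>n. 1 \<le> (\<Sum>v\<leftarrow>w n. M (2 * v))"
    using not_delta2_blocks[OF assms] by blast
  obtain R :: "(nat \<Rightarrow> 'k) \<Rightarrow> nat \<Rightarrow> 'k" where R: "lin_on ell2 R"
    "\<And>a n. a \<in> ell2 \<Longrightarrow> norm (R a n) \<le> ell2_norm a"
    "\<And>a. a \<in> ell2 \<Longrightarrow> \<exists>n. ell2_norm a \<le> 4 * norm (R a n)"
    using norming_functionals by blast
  show ?thesis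
  proof (rule contains_ell2_modularI[where S = "\<lambda>a. block_op w (R a)" and C = 1 and K = 8])
    show "lin_on ell2 (\<lambda>a. block_op w (R a))"
      using R(1) unfolding lin_on_def by (simp add: block_op_add block_op_scale)
    fix a :: "nat \<Rightarrow> 'k" and s :: real assume a: "a \<in> ell2"
    { assume s: "ell2_norm a \<le> s" "s > 0"
      show "modular_le M (1 * s) 1 (block_op w (R a))"
      proof -
        have "(\<Sum>n<N. \<Sum>v\<leftarrow>w n. M (v * (norm (R a n) / s))) \<le> 1" for N
        proof -
          have "(\<Sum>n<N. \<Sum>v\<leftarrow>w n. M (v * (norm (R a n) / s))) \<le> (\<Sum>n<N. (1 / 2) ^ Suc n)"
          proof (rule sum_mono)
            fix n
            have "norm (R a n) / s \<le> 1" using R(2)[OF a, of n] s by simp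
            then have "(\<Sum>v\<leftarrow>w n. M (v * (norm (R a n) / s))) \<le> (\<Sum>v\<leftarrow>w n. M v)"
              using w(1) s by (intro sum_list_mono M_mono mult_left_le) auto
            also have "\<dots> \<le> (1 / 2) ^ Suc n" by (rule w)
            finally show "(\<Sum>v\<leftarrow>w n. M (v * (norm (R a n) / s))) \<le> (1 / 2) ^ Suc n" .
          qed
          also have "\<dots> = 1 - (1 / 2) ^ N" by (induction N) auto
          finally show ?thesis by (smt (verit) zero_le_power divide_nonneg_nonneg)
        qed
        then show ?thesis using modular_block_op[of w s 1 "R a"] w(1) s by simp
      qed
    }
    { assume s: "s > 0" and "modular_le M s 1 (block_op w (R a))"
      then have *: "(\<Sum>n<N. \<Sum>v\<leftarrow>w n. M (v * (norm (R a n) / s))) \<le> 1" for N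
        using modular_block_op[of w s 1 "R a"] w(1) by blast
      obtain n where n: "ell2_norm a \<le> 4 * norm (R a n)" using R(3)[OF a] by blast
      have "norm (R a n) \<le> 2 * s"
      proof (rule ccontr)
        assume not: "\<not> norm (R a n) \<le> 2 * s"
        define u where "u = norm (R a n) / s / 2"
        have u: "u > 1" using not s by (simp add: u_def field_simps)
        have "1 < u * 1" using u by simp
        also have "\<dots> \<le> u * (\<Sum>v\<leftarrow>w n. M (2 * v))" using u w(3) by (intro mult_left_mono) auto
        also have "\<dots> = (\<Sum>v\<leftarrow>w n. u * M (2 * v))" by (simp add: sum_list_const_mult)
        also have "\<dots> \<le> (\<Sum>v\<leftarrow>w n. M (v * (norm (R a n) / s)))"
        proof (rule sum_list_mono)
          fix v assume "v \<in> set (w n)"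
          then have "u * M (2 * v) \<le> M (u * (2 * v))" using u w(1) by (intro M_stretch) auto
          then show "u * M (2 * v) \<le> M (v * (norm (R a n) / s))" by (simp add: u_def mult_ac)
        qed
        also have "\<dots> \<le> (\<Sum>n<Suc n. \<Sum>v\<leftarrow>w n. M (v * (norm (R a n) / s)))"
          using w(1) s by (intro member_le_sum sum_list_nonneg) (auto intro!: M_nonneg)
        also have "\<dots> \<le> 1" by (rule *)
        finally show False by simp
      qed
      then show "ell2_norm a \<le> 8 * s" using n by simp }
  qed auto
qed

end

section \<open>Blocks with a quadratic modular\<close>

lemma dyadic_scale:
  assumes "0 < t" "t \<le> (1::real)"
  shows "\<exists>u. 1 / 2 ^ Suc u < t \<and> t \<le> 1 / 2 ^ u"
proof -
  obtain m where "1 / 2 ^ m < t"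
    using real_arch_pow_inv[OF assms(1), of "1/2"] by (auto simp: power_one_over)
  then have m: "(LEAST m. 1 / 2 ^ m < t) \<noteq> 0" and *: "1 / 2 ^ (LEAST m. 1 / 2 ^ m < t) < t"
    using assms LeastI[of "\<lambda>m. 1 / 2 ^ m < t" m] by (auto intro: ccontr)
  then obtain u where u: "(LEAST m. 1 / 2 ^ m < t) = Suc u" using not0_implies_Suc by blast
  then have "\<not> 1 / 2 ^ u < t" using not_less_Least[of u "\<lambda>m. 1 / 2 ^ m < t"] by simp
  then show ?thesis using * u by (intro exI[of _ u]) auto
qed

lemma quarter_power_nonneg: "0 \<le> (1 / 4 :: real) ^ n"
  by simp

lemma sum_lessThan_add:
  fixes f :: "nat \<Rightarrow> 'a::comm_monoid_add"
  shows "(\<Sum>i<m + k. f i) = (\<Sum>i<m. f i) + (\<Sum>i<k. f (m + i))"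
  by (induction k) (auto simp: add.assoc)

lemma sum_power_quarter: "(\<Sum>n<N. (1 / 4 :: real) ^ n) \<le> 2"
proof -
  define q where "q = (1 / 4 :: real) ^ N"
  have "(\<Sum>n<N. (1 / 4 :: real) ^ n) = 4 / 3 * (1 - q)"
    unfolding q_def by (induction N) (simp_all add: algebra_simps)
  moreover have "0 \<le> q" by (simp add: q_def)
  then have "4 / 3 * (1 - q) \<le> 2" by (simp add: field_simps)
  ultimately show ?thesis by metis
qed

lemma sum_list_concat: "sum_list (concat xss) = (\<Sum>xs\<leftarrow>xss. sum_list xs :: 'a::monoid_add)"
  by (induction xss) auto

lemma dyadic_Suc_le: "1 / 2 ^ Suc n \<le> (1 / 2 ^ n :: real)"
  by (simp add: field_simps)

lemma dyadic_square: "(1 / 2 ^ n)\<^sup>2 = (1 / 4 :: real) ^ n"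
proof -
  have "(2::real) ^ n * 2 ^ n = 4 ^ n" by (simp flip: power_mult_distrib)
  then show ?thesis by (simp add: power2_eq_square power_one_over)
qed

locale orlicz_delta2 = orlicz +
  fixes D :: real
  assumes D_ge_1: "1 \<le> D" and doubling: "0 \<le> t \<Longrightarrow> t \<le> b \<Longrightarrow> M (2 * t) \<le> D * M t"
begin

text \<open>Doubling would carry a zero of \<open>M\<close> on for ever, but zeros of
  \<open>M\<close> cannot exceed \<open>b\<close>.\<close>

lemma M_pos:
  assumes "0 < t" shows "0 < M t"
proof (rule ccontr)
  assume "\<not> 0 < M t"
  then have 0: "M t = 0" using M_nonneg[of t] assms by simp
  have "M (2 ^ i * t) = 0" for i
  proof (induction i)
    case (Suc i)
    then have "2 ^ i * t \<le> b" by (intro le_b) simp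
    then have "M (2 * (2 ^ i * t)) \<le> D * M (2 ^ i * t)" using assms by (intro doubling) auto
    then show ?case using Suc M_nonneg[of "2 ^ Suc i * t"] assms by (simp add: mult.assoc)
  qed (use 0 in simp)
  then have "2 ^ i * t \<le> b" for i by (intro le_b) simp
  moreover obtain i where "2 ^ i > b / t" using unbounded_power2 by blast
  ultimately show False using assms by (simp add: field_simps not_less[symmetric])
qed

text \<open>Up to the factor \<open>b^2\<close>, the quotient of \<open>M\<close> by the square
  function at the point \<open>b / 2^s\<close>. If it stayed between positive constants,
  \<open>M\<close> would be quadratic near 0; in general it may oscillate.\<close>

definition \<phi> :: "nat \<Rightarrow> real" where "\<phi> s = 4 ^ s * M (b / 2 ^ s)"

lemma \<phi>_pos: "0 < \<phi> s" unfolding \<phi>_def using b_pos by (auto intro!: mult_pos_pos M_pos)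

text \<open>The block uses the \<open>2 * n\<close> levels from \<open>a\<close> on with
  multiplicities proportional to \<open>4^i\<close>. Dividing the argument by \<open>2^u\<close>
  slides this range of levels by \<open>u\<close>. For \<open>u \<le> n\<close> the slid range still
  contains the middle third of the \<open>3 * n\<close> levels from \<open>a\<close> on and stays
  among them, and balance compares the whole with the middle third; so the block function is
  quadratic at dyadic points.\<close>

lemma ex_balanced_block:
  fixes n a
  defines "S \<equiv> \<lambda>a. \<Sum>r<n. \<phi> (a + r)"
  assumes n: "n \<ge> 1" and small: "S (a + n) \<le> 4 ^ a"
    and bal: "S a \<le> 2 * S (a + n)" "S (a + 2 * n) \<le> 2 * S (a + n)"
  shows "\<exists>w. (\<forall>v\<in>set w. 0 \<le> v) \<and>
    (\<forall>t. 1 / 2 ^ n < t \<longrightarrow> t \<le> 1 \<longrightarrow>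
      t\<^sup>2 / 8 \<le> (\<Sum>v\<leftarrow>w. M (v * t)) \<and> (\<Sum>v\<leftarrow>w. M (v * t)) \<le> 20 * t\<^sup>2)"
proof -
  have S_pos: "S a > 0" for a
    unfolding S_def using n \<phi>_pos by (intro sum_pos) (auto simp: lessThan_empty_iff)
  \<comment> \<open>By \<open>small\<close> the quotient is at least 1, so rounding it down loses at
    most a factor 2.\<close>
  define q where "q = nat \<lfloor>4 ^ a / S (a + n)\<rfloor>"
  have X: "4 ^ a / S (a + n) \<ge> 1" using small S_pos by simp
  then have "\<lfloor>4 ^ a / S (a + n)\<rfloor> \<ge> 1" by simp
  then have q: "real q \<le> 4 ^ a / S (a + n)" "4 ^ a / S (a + n) \<le> 2 * real q"
    unfolding q_def by linarith+
  have q1: "q * S (a + n) / 4 ^ a \<le> 1" "1 / 2 \<le> q * S (a + n) / 4 ^ a"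
    using q S_pos[of "a + n"] by (simp_all add: field_simps)
  define w where "w = concat (map (\<lambda>i. replicate (q * 4 ^ i) (b / 2 ^ (a + i))) [0..<2 * n])"
  define F where "F t = (\<Sum>v\<leftarrow>w. M (v * t))" for t
  have F: "F t = (\<Sum>i<2 * n. q * 4 ^ i * M (b / 2 ^ (a + i) * t))" for t
    by (simp add: F_def w_def map_concat sum_list_concat o_def sum_list_replicate
        interv_sum_list_conv_sum_set_nat atLeast0LessThan)
  have w0: "0 \<le> v" if "v \<in> set w" for v using that b_pos by (auto simp: w_def)
  have F_mono: "F s \<le> F t" if "0 \<le> s" "s \<le> t" for s t
    unfolding F_def using that w0 by (intro sum_list_mono M_mono mult_left_mono) auto
  have F_dyadic: "F (1 / 2 ^ u) = q / 4 ^ a * (1 / 4 ^ u) * (\<Sum>i<2 * n. \<phi> (a + u + i))" for u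
    unfolding F sum_distrib_left by (intro sum.cong) (auto simp: \<phi>_def power_add field_simps)
  have low: "S (a + n) \<le> (\<Sum>i<2 * n. \<phi> (a + u + i))" if "u \<le> n" for u
  proof -
    have "S (a + n) = (\<Sum>i\<in>(\<lambda>r. r + (n - u)) ` {..<n}. \<phi> (a + u + i))"
      unfolding S_def using that by (subst sum.reindex) (auto simp: add_ac inj_on_def)
    also have "\<dots> \<le> (\<Sum>i<2 * n. \<phi> (a + u + i))"
      using \<phi>_pos by (intro sum_mono2) (auto intro: less_imp_le)
    finally show ?thesis .
  qed
  have high: "(\<Sum>i<2 * n. \<phi> (a + u + i)) \<le> 5 * S (a + n)" if "u \<le> n" for u
  proof -
    have "(\<Sum>i<2 * n. \<phi> (a + u + i)) = (\<Sum>i\<in>(\<lambda>r. r + u) ` {..<2 * n}. \<phi> (a + i))"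
      by (subst sum.reindex) (auto simp: add_ac)
    also have "\<dots> \<le> (\<Sum>i<n + (n + n). \<phi> (a + i))"
      using \<phi>_pos that by (intro sum_mono2) (auto intro: less_imp_le)
    also have "\<dots> = S a + S (a + n) + S (a + 2 * n)"
      unfolding S_def sum_lessThan_add by (simp add: ac_simps mult_2 mult_2_right)
    also have "\<dots> \<le> 5 * S (a + n)" using bal by simp
    finally show ?thesis .
  qed
  have est: "1 / 4 ^ u / 2 \<le> F (1 / 2 ^ u) \<and> F (1 / 2 ^ u) \<le> 5 * (1 / 4 ^ u)" if "u \<le> n" for u
  proof
    have "1 / 4 ^ u / 2 \<le> (1 / 4 ^ u) * (q * S (a + n) / 4 ^ a)"
      using q1 by (simp add: field_simps)
    also have "\<dots> = q / 4 ^ a * (1 / 4 ^ u) * S (a + n)" by simp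
    also have "\<dots> \<le> F (1 / 2 ^ u)"
      unfolding F_dyadic using low[OF that] by (intro mult_left_mono) auto
    finally show "1 / 4 ^ u / 2 \<le> F (1 / 2 ^ u)" .
    have "F (1 / 2 ^ u) \<le> q / 4 ^ a * (1 / 4 ^ u) * (5 * S (a + n))"
      unfolding F_dyadic using high[OF that] by (intro mult_left_mono) auto
    also have "\<dots> = 5 * (1 / 4 ^ u) * (q * S (a + n) / 4 ^ a)" by (simp add: mult_ac)
    also have "\<dots> \<le> 5 * (1 / 4 ^ u) * 1" using q1 by (intro mult_left_mono) auto
    finally show "F (1 / 2 ^ u) \<le> 5 * (1 / 4 ^ u)" by simp
  qed
  have "t\<^sup>2 / 8 \<le> F t \<and> F t \<le> 20 * t\<^sup>2" if t: "1 / 2 ^ n < t" "t \<le> 1" for t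
  proof -
    have t0: "0 < t" using t(1) by (smt (verit) divide_nonneg_nonneg zero_le_power)
    then obtain u where u: "1 / 2 ^ Suc u < t" "t \<le> 1 / 2 ^ u" using dyadic_scale t by blast
    have "1 / 2 ^ n < (1 / 2 ^ u :: real)" using u t by linarith
    then have "(2::real) ^ u < 2 ^ n" by (simp add: field_simps)
    then have un: "u < n" by simp
    have sq: "(1 / 2 ^ u)\<^sup>2 = (1 / 4 ^ u :: real)" for u
      unfolding dyadic_square by (simp add: power_one_over)
    have "t\<^sup>2 \<le> 1 / 4 ^ u" using power_mono[OF u(2), of 2] t0 sq[of u] by simp
    moreover have "(1 / 2 ^ Suc u)\<^sup>2 \<le> t\<^sup>2" using u(1) by (intro power_mono) auto
    then have "1 / 4 ^ u \<le> 4 * t\<^sup>2" using sq[of "Suc u"] by simp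
    \<comment> \<open>Passing from \<open>t\<close> to the neighbouring dyadic points costs a factor
      4, which turns the constants 1/2 and 5 into 1/8 and 20.\<close>
    moreover have "F (1 / 2 ^ Suc u) \<le> F t" "F t \<le> F (1 / 2 ^ u)"
      using u t0 by (auto intro!: F_mono)
    ultimately show ?thesis using est[of u] est[of "Suc u"] un by auto
  qed
  then show ?thesis using w0 by (intro exI[of _ w]) (auto simp: F_def)
qed

text \<open>Block \<open>n\<close> is quadratic for arguments above \<open>1 / 2 ^ Suc n\<close> up
  to 1; for smaller ones its error is of order \<open>1 / 4^n\<close>, hence summable over
  \<open>n\<close>. The modular of a block vector is then comparable to a sum of squares up to
  bounded errors.\<close>

lemma contains_ell2_if_balanced:
  assumes bal: "\<And>n J. n \<ge> 1 \<Longrightarrow> \<exists>a\<ge>J. (\<Sum>r<n. \<phi> (a + r)) \<le> 2 * (\<Sum>r<n. \<phi> (a + n + r)) \<and>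
    (\<Sum>r<n. \<phi> (a + 2 * n + r)) \<le> 2 * (\<Sum>r<n. \<phi> (a + n + r))"
  shows "contains_ell2 TYPE('k::{real_normed_field,banach}) M"
proof -
  have "\<exists>w. (\<forall>v\<in>set w. 0 \<le> v) \<and>
    (\<forall>t. 1 / 2 ^ Suc n < t \<longrightarrow> t \<le> 1 \<longrightarrow>
      t\<^sup>2 / 8 \<le> (\<Sum>v\<leftarrow>w. M (v * t)) \<and> (\<Sum>v\<leftarrow>w. M (v * t)) \<le> 20 * t\<^sup>2)" for n
  proof -
    \<comment> \<open>One level more than the index: the window is nonempty even for
      \<open>n = 0\<close>, and the point \<open>1 / 2^n\<close> lies strictly inside the quadratic
      range, so that the error bound can be read off there.\<close>
    define N where "N = Suc n"
    \<comment> \<open>By convexity \<open>M\<close> at a level beyond \<open>J\<close> is at most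
      \<open>M b / 2^J\<close>. This beats the factors \<open>N\<close> and
      \<open>4 ^ (2 * N)\<close>, which do not depend on \<open>a\<close>, and makes the middle sum
      at most \<open>4^a\<close>.\<close>
    obtain J where J: "2 ^ J > N * (4 ^ (2 * N) * M b)" using unbounded_power2 by blast
    obtain a where a: "a \<ge> J" "(\<Sum>r<N. \<phi> (a + r)) \<le> 2 * (\<Sum>r<N. \<phi> (a + N + r))"
      "(\<Sum>r<N. \<phi> (a + 2 * N + r)) \<le> 2 * (\<Sum>r<N. \<phi> (a + N + r))"
      using bal[of N J] by (auto simp: N_def)
    have "\<phi> (a + N + r) \<le> 4 ^ a * (4 ^ (2 * N) * M b) / 2 ^ J" if "r < N" for r
    proof -
      have "M (b / 2 ^ (a + N + r)) \<le> M (1 / 2 ^ J * b)"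
        using b_pos a(1) by (intro M_mono) (auto intro!: divide_left_mono power_increasing)
      also have "\<dots> \<le> 1 / 2 ^ J * M b" using b_pos by (intro M_shrink) auto
      finally have m: "M (b / 2 ^ (a + N + r)) \<le> M b / 2 ^ J" by simp
      have "(4::real) ^ (a + N + r) \<le> 4 ^ (a + 2 * N)" using that by (intro power_increasing) auto
      then have "\<phi> (a + N + r) \<le> 4 ^ (a + 2 * N) * (M b / 2 ^ J)"
        unfolding \<phi>_def using m b_pos by (intro mult_mono) (auto intro!: M_nonneg)
      then show ?thesis by (simp add: power_add)
    qed
    then have "(\<Sum>r<N. \<phi> (a + N + r)) \<le> (\<Sum>r<N. 4 ^ a * (4 ^ (2 * N) * M b) / 2 ^ J)"
      by (intro sum_mono) auto
    also have "\<dots> = 4 ^ a * (N * (4 ^ (2 * N) * M b)) / 2 ^ J" by simp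
    also have "\<dots> \<le> 4 ^ a * 2 ^ J / 2 ^ J"
      using J by (intro divide_right_mono mult_left_mono) auto
    finally have "(\<Sum>r<N. \<phi> (a + N + r)) \<le> 4 ^ a" by simp
    from ex_balanced_block[OF _ this a(2,3)] show ?thesis unfolding N_def by simp
  qed
  then obtain w where w0: "\<And>n v. v \<in> set (w n) \<Longrightarrow> 0 \<le> v" and
    w: "\<And>n t. 1 / 2 ^ Suc n < t \<Longrightarrow> t \<le> 1 \<Longrightarrow>
      t\<^sup>2 / 8 \<le> (\<Sum>v\<leftarrow>w n. M (v * t)) \<and> (\<Sum>v\<leftarrow>w n. M (v * t)) \<le> 20 * t\<^sup>2"
    by metis
  define F where "F n t = (\<Sum>v\<leftarrow>w n. M (v * t))" for n t
  have F_mono: "F n s \<le> F n t" if "0 \<le> s" "s \<le> t" for n s t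
    unfolding F_def using that w0 by (intro sum_list_mono M_mono mult_left_mono) auto
  have F0: "0 \<le> F n t" if "0 \<le> t" for n t
    unfolding F_def using w0 that by (intro sum_list_nonneg) (auto intro!: M_nonneg)
  have up: "F n t \<le> 20 * t\<^sup>2 + 20 * (1 / 4) ^ n" if "0 \<le> t" "t \<le> 1" for n t
  proof (cases "1 / 2 ^ n < t")
    case True
    have "1 / 2 ^ Suc n < t" using True dyadic_Suc_le[of n] by linarith
    then have "F n t \<le> 20 * t\<^sup>2" using w that unfolding F_def by blast
    then show ?thesis using quarter_power_nonneg[of n] by linarith
  next
    case False
    then have "F n t \<le> F n (1 / 2 ^ n)" using that by (intro F_mono) auto
    also have "\<dots> \<le> 20 * (1 / 2 ^ n)\<^sup>2"
      using w[of n "1 / 2 ^ n"] unfolding F_def by (simp add: field_simps)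
    finally show ?thesis unfolding dyadic_square using zero_le_power2[of t] by linarith
  qed
  show ?thesis
  \<comment> \<open>\<open>60 = 20 + 20 * 2\<close> collects the quadratic part and the summed
    errors. For the lower estimate the coordinates are at most \<open>8 * s\<close>; after division
    by \<open>8 * s\<close> their squares sum to at most \<open>8 + 2 \<le> 16\<close>, whence
    \<open>32 = 8 * 4\<close>.\<close>
  proof (rule contains_ell2_modularI[where S = "block_op w" and C = 60 and K = 32])
    show "lin_on ell2 (block_op w :: (nat \<Rightarrow> 'k) \<Rightarrow> nat \<Rightarrow> 'k)"
      unfolding lin_on_def by (simp add: block_op_add block_op_scale)
    fix a :: "nat \<Rightarrow> 'k" and s :: real assume a: "a \<in> ell2"
    { assume s: "ell2_norm a \<le> s" "s > 0"
      show "modular_le M (60 * s) 1 (block_op w a)"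
      proof -
        have "(\<Sum>n<N. F n (norm (a n) / s)) \<le> 60" for N
        proof -
          have "(\<Sum>n<N. F n (norm (a n) / s)) \<le> (\<Sum>n<N. 20 * (norm (a n) / s)\<^sup>2 + 20 * (1 / 4) ^ n)"
          proof (intro sum_mono up)
            fix n show "norm (a n) / s \<le> 1" using ell2_coord[OF a, of n] s by simp
          qed (use s in auto)
          also have "\<dots> = 20 * ((\<Sum>n<N. (norm (a n))\<^sup>2) / s\<^sup>2) + 20 * (\<Sum>n<N. (1 / 4) ^ n)"
            by (simp add: sum.distrib sum_distrib_left sum_divide_distrib power_divide)
          also have "(\<Sum>n<N. (norm (a n))\<^sup>2) \<le> s\<^sup>2"
            using ell2_sum_le[OF a, of "{..<N}"] power_mono[OF s(1) ell2_norm_nonneg[OF a], of 2] by simp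
          then have "20 * ((\<Sum>n<N. (norm (a n))\<^sup>2) / s\<^sup>2) \<le> 20" using s by (simp add: divide_le_eq)
          moreover note sum_power_quarter[of N]
          ultimately show ?thesis by simp
        qed
        then have "modular_le M s 60 (block_op w a)"
          using modular_block_op[of w s 60 a] w0 s unfolding F_def by blast
        from modular_le_shrink[OF this s(2), of 60] show ?thesis by simp
      qed
    }
    { assume s: "s > 0" and "modular_le M s 1 (block_op w a)"
      then have *: "(\<Sum>n<N. F n (norm (a n) / s)) \<le> 1" for N
        using modular_block_op[of w s 1 a] w0 unfolding F_def by blast
      have F1: "F n (norm (a n) / s) \<le> 1" for n
      proof -
        have "F n (norm (a n) / s) \<le> (\<Sum>n<Suc n. F n (norm (a n) / s))"
          using s by (intro member_le_sum F0) auto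
        then show ?thesis using *[of "Suc n"] by linarith
      qed
      \<comment> \<open>A block function has value at least 1/8 at 1 and is convex with value 0 at
        0, so it exceeds 1 beyond 8.\<close>
      have t8: "norm (a n) / s \<le> 8" for n
      proof (rule ccontr)
        define t where "t = norm (a n) / s"
        assume "\<not> norm (a n) / s \<le> 8"
        then have t: "t > 8" by (simp add: t_def)
        have "1 / 2 ^ Suc n < (1::real)" using one_less_power[of "2::real" "Suc n"] by simp
        then have "1 / 8 \<le> F n 1" using w[of n 1] unfolding F_def by simp
        then have "t * (1 / 8) \<le> t * F n 1" using t by (intro mult_left_mono) auto
        also have "\<dots> = (\<Sum>v\<leftarrow>w n. t * M v)" by (simp add: F_def sum_list_const_mult)
        also have "\<dots> \<le> F n t" unfolding F_def
          using M_stretch[of t] w0 t by (intro sum_list_mono) (auto simp: mult.commute)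
        also have "\<dots> \<le> 1" using F1 by (simp add: t_def)
        finally show False using t by simp
      qed
      have y: "(norm (a n) / s / 8)\<^sup>2 \<le> 8 * F n (norm (a n) / s) + (1 / 4) ^ n" for n
      proof (cases "norm (a n) / s / 8 \<le> 1 / 2 ^ n")
        case True
        then have "(norm (a n) / s / 8)\<^sup>2 \<le> (1 / 2 ^ n)\<^sup>2" using s by (intro power_mono) auto
        then show ?thesis using F0[of "norm (a n) / s" n] s unfolding dyadic_square by simp
      next
        case False
        then have "1 / 2 ^ Suc n < norm (a n) / s / 8"
          using dyadic_Suc_le[of n] by linarith
        moreover have "norm (a n) / s / 8 \<le> 1" using t8[of n] by simp
        ultimately have "(norm (a n) / s / 8)\<^sup>2 / 8 \<le> F n (norm (a n) / s / 8)"
          using w unfolding F_def by blast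
        also have "\<dots> \<le> F n (norm (a n) / s)" using s by (intro F_mono) (auto simp: field_simps)
        finally show ?thesis using quarter_power_nonneg[of n] by linarith
      qed
      have "(\<Sum>n<N. (norm (a n))\<^sup>2) \<le> (32 * s)\<^sup>2" for N
      proof -
        have "(\<Sum>n<N. (norm (a n))\<^sup>2) = (8 * s)\<^sup>2 * (\<Sum>n<N. (norm (a n) / s / 8)\<^sup>2)"
          using s by (simp add: sum_distrib_left power_divide power_mult_distrib)
        also have "\<dots> \<le> (8 * s)\<^sup>2 * 16"
        proof (rule mult_left_mono)
          have "(\<Sum>n<N. (norm (a n) / s / 8)\<^sup>2) \<le> (\<Sum>n<N. 8 * F n (norm (a n) / s) + (1 / 4) ^ n)"
            by (intro sum_mono y)
          also have "\<dots> = 8 * (\<Sum>n<N. F n (norm (a n) / s)) + (\<Sum>n<N. (1 / 4) ^ n)"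
            by (simp add: sum.distrib sum_distrib_left)
          also have "\<dots> \<le> 16" using *[of N] sum_power_quarter[of N] by simp
          finally show "(\<Sum>n<N. (norm (a n) / s / 8)\<^sup>2) \<le> 16" .
        qed simp
        finally show ?thesis by (simp add: power_mult_distrib)
      qed
      from ell2_normI(2)[OF this] s show "ell2_norm a \<le> 32 * s" by simp }
  qed auto
qed

text \<open>The hypotheses say that \<open>4^r M (t / 2^r) / M t\<close> neither decays nor grows
  uniformly in \<open>t\<close>. Rounding \<open>t\<close> to a dyadic fraction of \<open>b\<close>
  costs a factor \<open>D\<close>, and the sequence \<open>\<phi>\<close> inherits both
  properties.\<close>

lemma contains_ell2_criterion:
  assumes \<epsilon>: "\<epsilon> > 0" "\<And>r. \<exists>t>0. t \<le> b \<and> \<epsilon> * M t \<le> 4 ^ r * M (t / 2 ^ r)"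
    and K: "\<And>r. \<exists>t>0. t \<le> b \<and> 4 ^ r * M (t / 2 ^ r) \<le> K * M t"
  shows "contains_ell2 TYPE('k::{real_normed_field,banach}) M"
proof (rule contains_ell2_if_balanced)
  have K0: "K > 0"
  proof -
    obtain t where "t > 0" "4 ^ 0 * M (t / 2 ^ 0) \<le> K * M t" using K by blast
    then show ?thesis using M_pos[of t] by (smt (verit) mult_le_0_iff power_0 div_by_1 mult_1)
  qed
  have dyad: "\<exists>s. b / 2 ^ Suc s < t \<and> t \<le> b / 2 ^ s" if t: "0 < t" "t \<le> b" for t
    using dyadic_scale[of "t / b"] t b_pos by (simp add: field_simps)
  have half: "M (b / 2 ^ s) \<le> D * M (b / 2 ^ Suc s)" for s
  proof -
    have "b / 2 ^ Suc s \<le> b / 1" using b_pos by (intro divide_left_mono) (auto intro: one_le_power order_trans[OF _ one_le_power[of 2 "Suc s"]] simp del: power_Suc)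
    then have "M (2 * (b / 2 ^ Suc s)) \<le> D * M (b / 2 ^ Suc s)"
      using b_pos by (intro doubling) auto
    then show ?thesis by simp
  qed
  have quad: "\<phi> (s + r) = 4 ^ s * (4 ^ r * M (b / 2 ^ s / 2 ^ r))" for s r
    by (simp add: \<phi>_def power_add)
  fix n J :: nat assume n: "n \<ge> 1"
  show "\<exists>a\<ge>J. (\<Sum>r<n. \<phi> (a + r)) \<le> 2 * (\<Sum>r<n. \<phi> (a + n + r)) \<and>
    (\<Sum>r<n. \<phi> (a + 2 * n + r)) \<le> 2 * (\<Sum>r<n. \<phi> (a + n + r))"
  proof (rule balanced_window[where L = "4 * D" and \<epsilon> = "\<epsilon> / D" and K = "D * K", OF \<phi>_pos _ _ _ _ _ _ n])
    show "1 \<le> 4 * D" "0 < \<epsilon> / D" using D_ge_1 \<epsilon> by auto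
    fix s
    have "M (b / 2 ^ Suc s) \<le> M (b / 2 ^ s)"
      using b_pos by (intro M_mono divide_left_mono) auto
    also have "\<dots> \<le> D * M (b / 2 ^ s)"
      using D_ge_1 M_nonneg[of "b / 2 ^ s"] b_pos mult_right_mono[of 1 D "M (b / 2 ^ s)"] by simp
    finally show "\<phi> (Suc s) \<le> 4 * D * \<phi> s" by (simp add: \<phi>_def)
    have "\<phi> s \<le> 4 ^ s * (D * M (b / 2 ^ Suc s))"
      unfolding \<phi>_def using half by (intro mult_left_mono) auto
    also have "\<dots> \<le> 16 * (4 ^ s * (D * M (b / 2 ^ Suc s)))"
    proof -
      have "0 \<le> 4 ^ s * (D * M (b / 2 ^ Suc s))"
        using D_ge_1 b_pos by (intro mult_nonneg_nonneg M_nonneg) auto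
      then show ?thesis by linarith
    qed
    finally show "\<phi> s \<le> 4 * D * \<phi> (Suc s)" by (simp add: \<phi>_def)
  next
    fix r
    obtain t where t: "t > 0" "t \<le> b" "\<epsilon> * M t \<le> 4 ^ r * M (t / 2 ^ r)" using \<epsilon>(2) by blast
    obtain s where s: "b / 2 ^ Suc s < t" "t \<le> b / 2 ^ s" using dyad[OF t(1,2)] by blast
    have "\<epsilon> / D * M (b / 2 ^ s) \<le> \<epsilon> / D * (D * M (b / 2 ^ Suc s))"
      using half \<epsilon> D_ge_1 by (intro mult_left_mono) auto
    also have "\<dots> = \<epsilon> * M (b / 2 ^ Suc s)" using D_ge_1 by simp
    also have "\<dots> \<le> \<epsilon> * M t" using s \<epsilon> b_pos by (intro mult_left_mono M_mono) auto
    also have "\<dots> \<le> 4 ^ r * M (t / 2 ^ r)" by (rule t)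
    also have "\<dots> \<le> 4 ^ r * M (b / 2 ^ s / 2 ^ r)"
      using s t by (intro mult_left_mono M_mono divide_right_mono) auto
    finally have "4 ^ s * (\<epsilon> / D * M (b / 2 ^ s)) \<le> \<phi> (s + r)"
      unfolding quad by (intro mult_left_mono) auto
    then show "\<exists>s. \<epsilon> / D * \<phi> s \<le> \<phi> (s + r)" by (intro exI[of _ s]) (simp add: \<phi>_def mult_ac)
  next
    fix r
    obtain t where t: "t > 0" "t \<le> b" "4 ^ r * M (t / 2 ^ r) \<le> K * M t" using K by blast
    obtain s where s: "b / 2 ^ Suc s < t" "t \<le> b / 2 ^ s" using dyad[OF t(1,2)] by blast
    have "4 ^ r * M (b / 2 ^ Suc s / 2 ^ r) \<le> 4 ^ r * M (t / 2 ^ r)"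
      using s b_pos by (intro mult_left_mono M_mono divide_right_mono) auto
    also have "\<dots> \<le> K * M t" by (rule t)
    also have "\<dots> \<le> K * M (b / 2 ^ s)" using K0 s t by (intro mult_left_mono M_mono) auto
    also have "\<dots> \<le> K * (D * M (b / 2 ^ Suc s))" using K0 half by (intro mult_left_mono) auto
    finally have "\<phi> (Suc s + r) \<le> 4 ^ Suc s * (K * (D * M (b / 2 ^ Suc s)))"
      unfolding quad by (intro mult_left_mono) auto
    \<comment> \<open>For this upper bound \<open>t\<close> was rounded down, to level
      \<open>Suc s\<close>; the preceding lower bound rounds it up, to level
      \<open>s\<close>.\<close>
    then show "\<exists>s. \<phi> (s + r) \<le> D * K * \<phi> s"
      by (intro exI[of _ "Suc s"]) (simp add: \<phi>_def mult_ac)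
  qed
qed

end

section \<open>Rademacher sums and almost disjoint vectors\<close>

definition restr :: "nat set \<Rightarrow> (nat \<Rightarrow> 'k::zero) \<Rightarrow> nat \<Rightarrow> 'k" where
  "restr A x = (\<lambda>j. if j \<in> A then x j else 0)"

lemma restr_scale: "restr A (scale_seq c x) = scale_seq c (restr A x)"
  by (auto simp: restr_def scale_seq_def)

text \<open>Among any \<open>m + 1\<close> independent vectors, \<open>m\<close> homogeneous
  conditions leave a nonzero combination. So every infinite-dimensional subspace has vectors
  starting arbitrarily far out.\<close>

lemma nth_subset_vanishing:
  fixes Y :: "(nat \<Rightarrow> 'k::real_normed_field) set"
  assumes Y: "seq.subspace Y" and inf: "infinite_dimensional Y"
  shows "\<exists>y\<in>Y. y \<noteq> 0 \<and> (\<forall>j<m. y j = 0)"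
proof -
  obtain B where B: "B \<subseteq> Y" "\<not> seq.dependent B" "Y \<subseteq> seq.span B"
    using seq.maximal_independent_subset by blast
  have "infinite B"
  proof
    assume "finite B"
    moreover have "seq.span B = Y" using B Y seq.span_minimal by blast
    ultimately show False using inf B(1) unfolding infinite_dimensional_def by blast
  qed
  then obtain I where I: "I \<subseteq> B" "finite I" "card I = Suc m"
    using infinite_arbitrarily_large by blast
  obtain c where c: "\<exists>v\<in>I. c v \<noteq> 0" "\<forall>j\<in>{..<m}. (\<Sum>v\<in>I. c v * v j) = 0"
    using nontrivial_solution[of "{..<m}" I "\<lambda>j v. v j"] I by auto
  define y where "y = (\<Sum>v\<in>I. scale_seq (c v) v)"
  have "y \<in> Y" unfolding y_def using I B(1)
    by (intro seq.subspace_sum[OF Y] seq.subspace_scale[OF Y]) auto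
  moreover have "y \<noteq> 0"
    using c(1) seq.independentD[OF B(2) I(2,1)] unfolding y_def by blast
  moreover have "y j = 0" if "j < m" for j
    using c(2) that unfolding y_def sum_fun_apply by (simp add: scale_seq_def)
  ultimately show ?thesis by blast
qed

section \<open>Moments of Rademacher sums\<close>

definition rademacher :: "nat \<Rightarrow> nat \<Rightarrow> real" where
  "rademacher i w = (if odd (w div 2 ^ i) then - 1 else 1)"

definition rad_sum :: "nat \<Rightarrow> (nat \<Rightarrow> real) \<Rightarrow> nat \<Rightarrow> real" where
  "rad_sum k a w = (\<Sum>i<k. a i * rademacher i w)"

text \<open>The signs are the binary digits of \<open>w\<close>, so the \<open>2^k\<close> values of
  \<open>w\<close> run through all sign patterns. The parity of \<open>w\<close> belongs to
  \<open>a 0\<close>; summing over even and odd \<open>w\<close> separately gives an induction on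
  \<open>k\<close> for all the moments.\<close>

lemma rad_sum_Suc:
  "rad_sum (Suc k) a (2 * w) = rad_sum k (\<lambda>i. a (Suc i)) w + a 0"
  "rad_sum (Suc k) a (Suc (2 * w)) = rad_sum k (\<lambda>i. a (Suc i)) w - a 0"
  by (simp_all add: rad_sum_def sum.lessThan_Suc_shift rademacher_def div_mult2_eq del: sum.lessThan_Suc)

lemma sum_even_odd:
  fixes h :: "nat \<Rightarrow> 'a::comm_monoid_add"
  shows "(\<Sum>w<2 * n. h w) = (\<Sum>w<n. h (2 * w) + h (Suc (2 * w)))"
  by (induction n) (auto simp: add.assoc)

lemma rad_sum_moment2: "(\<Sum>w<2 ^ k. (rad_sum k a w)\<^sup>2) = 2 ^ k * (\<Sum>i<k. (a i)\<^sup>2)"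
proof (induction k arbitrary: a)
  case (Suc k)
  have "(\<Sum>w<2 ^ Suc k. (rad_sum (Suc k) a w)\<^sup>2)
      = (\<Sum>w<2 ^ k. 2 * (rad_sum k (\<lambda>i. a (Suc i)) w)\<^sup>2 + 2 * (a 0)\<^sup>2)"
    unfolding power_Suc sum_even_odd rad_sum_Suc
    by (intro sum.cong) (auto simp: power2_eq_square algebra_simps)
  also have "\<dots> = 2 ^ Suc k * (\<Sum>i<Suc k. (a i)\<^sup>2)"
    unfolding sum.distrib sum_distrib_left[symmetric] Suc sum.lessThan_Suc_shift
    by (simp add: algebra_simps)
  finally show ?case .
qed (simp add: rad_sum_def)

text \<open>The constant 3 comes from \<open>(x + y)^4 + (x - y)^4 \<le> 6 (x^2 + y^2)^2\<close>,
  where the mixed terms agree.\<close>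

lemma rad_sum_moment4: "(\<Sum>w<2 ^ k. (rad_sum k a w) ^ 4) \<le> 3 * 2 ^ k * (\<Sum>i<k. (a i)\<^sup>2)\<^sup>2"
proof (induction k arbitrary: a)
  case (Suc k)
  define s where "s = (\<Sum>i<k. (a (Suc i))\<^sup>2)"
  have "(\<Sum>w<2 ^ Suc k. (rad_sum (Suc k) a w) ^ 4)
      = (\<Sum>w<2 ^ k. 2 * (rad_sum k (\<lambda>i. a (Suc i)) w) ^ 4 +
          12 * (a 0)\<^sup>2 * (rad_sum k (\<lambda>i. a (Suc i)) w)\<^sup>2 + 2 * (a 0) ^ 4)"
    unfolding power_Suc[of 2 k] sum_even_odd rad_sum_Suc
    by (intro sum.cong) (auto simp: power2_eq_square power4_eq_xxxx algebra_simps)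
  also have "\<dots> = 2 * (\<Sum>w<2 ^ k. (rad_sum k (\<lambda>i. a (Suc i)) w) ^ 4) +
      12 * (a 0)\<^sup>2 * (2 ^ k * s) + 2 ^ Suc k * (a 0) ^ 4"
    unfolding sum.distrib sum_distrib_left[symmetric] rad_sum_moment2 s_def by simp
  also have "\<dots> \<le> 2 * (3 * 2 ^ k * s\<^sup>2) + 12 * (a 0)\<^sup>2 * (2 ^ k * s) + 2 ^ Suc k * (3 * (a 0) ^ 4)"
    using Suc[of "\<lambda>i. a (Suc i)"] unfolding s_def by (intro add_mono mult_left_mono) auto
  also have "\<dots> = 3 * 2 ^ Suc k * ((a 0)\<^sup>2 + s)\<^sup>2"
    by (simp add: power2_eq_square power4_eq_xxxx algebra_simps)
  also have "(a 0)\<^sup>2 + s = (\<Sum>i<Suc k. (a i)\<^sup>2)"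
    by (simp add: s_def sum.lessThan_Suc_shift del: sum.lessThan_Suc)
  finally show ?case .
qed (simp add: rad_sum_def)

text \<open>The sub-Gaussian bound \<open>cosh x \<le> exp (x^2)\<close> for one random sign, from
  second-order bounds on \<open>exp\<close>; it multiplies over independent signs.\<close>

lemma exp_add_exp_minus_le:
  assumes "\<bar>x\<bar> \<le> (1::real)"
  shows "exp x + exp (- x) \<le> 2 * exp (x\<^sup>2)"
proof -
  have *: "exp x + exp (- x) \<le> 2 * exp (x\<^sup>2)" if x: "0 \<le> x" "x \<le> 1" for x :: real
  proof -
    have "exp x \<le> 1 + x + x\<^sup>2" by (rule exp_bound[OF x])
    moreover have "exp (- x) \<le> 1 - x + x\<^sup>2"
    proof -
      have pos: "0 < 1 + x + x\<^sup>2 / 2" using x by (intro add_pos_nonneg) auto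
      have "exp (- x) = 1 / exp x" by (simp add: exp_minus field_simps)
      also have "\<dots> \<le> 1 / (1 + x + x\<^sup>2 / 2)"
        using exp_lower_Taylor_quadratic[OF x(1)] pos by (intro divide_left_mono) auto
      also have "\<dots> \<le> 1 - x + x\<^sup>2"
      proof -
        have "(1 - x + x\<^sup>2) * (1 + x + x\<^sup>2 / 2) = 1 + (x ^ 2 + x ^ 3 + x ^ 4) / 2"
          by (simp add: power2_eq_square power3_eq_cube power4_eq_xxxx field_simps)
        also have "\<dots> \<ge> 1" using x by simp
        finally show ?thesis using pos by (simp add: divide_le_eq)
      qed
      finally show ?thesis .
    qed
    moreover have "1 + x\<^sup>2 \<le> exp (x\<^sup>2)" by (rule exp_ge_add_one_self)
    ultimately show ?thesis by linarith
  qed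
  show ?thesis
    using *[of x] *[of "- x"] assms by (cases "x \<ge> 0") (auto simp: add.commute)
qed

lemma rad_sum_exp:
  assumes "\<And>i. i < k \<Longrightarrow> \<bar>a i\<bar> \<le> 1"
  shows "(\<Sum>w<2 ^ k. exp (rad_sum k a w)) \<le> 2 ^ k * exp (\<Sum>i<k. (a i)\<^sup>2)"
  using assms
proof (induction k arbitrary: a)
  case (Suc k)
  have "(\<Sum>w<2 ^ Suc k. exp (rad_sum (Suc k) a w))
      = (\<Sum>w<2 ^ k. (exp (a 0) + exp (- a 0)) * exp (rad_sum k (\<lambda>i. a (Suc i)) w))"
    unfolding power_Suc sum_even_odd rad_sum_Suc
    by (intro sum.cong) (auto simp: exp_add exp_diff exp_minus field_simps)
  also have "\<dots> = (exp (a 0) + exp (- a 0)) * (\<Sum>w<2 ^ k. exp (rad_sum k (\<lambda>i. a (Suc i)) w))"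
    by (simp add: sum_distrib_left)
  also have "\<dots> \<le> 2 * exp ((a 0)\<^sup>2) * (2 ^ k * exp (\<Sum>i<k. (a (Suc i))\<^sup>2))"
    using Suc by (intro mult_mono exp_add_exp_minus_le sum_nonneg add_nonneg_nonneg) auto
  also have "\<dots> = 2 ^ Suc k * exp (\<Sum>i<Suc k. (a i)\<^sup>2)"
    by (simp add: sum.lessThan_Suc_shift exp_add del: sum.lessThan_Suc)
  finally show ?case .
qed (simp add: rad_sum_def)

lemma unit_coeff_le_1:
  fixes a :: "nat \<Rightarrow> real"
  assumes "(\<Sum>i<k. (a i)\<^sup>2) = 1" "i < k"
  shows "\<bar>a i\<bar> \<le> 1"
proof -
  have "(a i)\<^sup>2 \<le> (\<Sum>i<k. (a i)\<^sup>2)" using assms(2) by (intro member_le_sum) auto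
  then show ?thesis using assms(1) by (simp add: abs_square_le_1)
qed

text \<open>\<open>exp |y| \<le> exp y + exp (-y)\<close> reduces this to the one-sided bound. The
  mean is at most \<open>2 * exp 1\<close> for every \<open>k\<close>, which is what frees the upper
  constant of the Euclidean copies from the dimension.\<close>

lemma rad_sum_exp_abs:
  assumes "(\<Sum>i<k. (a i)\<^sup>2) = 1"
  shows "(\<Sum>w<2 ^ k. exp \<bar>rad_sum k a w\<bar>) \<le> 2 ^ k * (2 * exp 1)"
proof -
  have neg: "rad_sum k (\<lambda>i. - a i) w = - rad_sum k a w" for w
    by (simp add: rad_sum_def sum_negf)
  have "(\<Sum>w<2 ^ k. exp \<bar>rad_sum k a w\<bar>)
      \<le> (\<Sum>w<2 ^ k. exp (rad_sum k a w) + exp (rad_sum k (\<lambda>i. - a i) w))"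
    unfolding neg by (intro sum_mono) (auto simp: abs_if)
  also have "\<dots> \<le> 2 ^ k * exp 1 + 2 ^ k * exp 1"
    unfolding sum.distrib
    using rad_sum_exp[of k a] rad_sum_exp[of k "\<lambda>i. - a i"] unit_coeff_le_1[OF assms] assms
    by (intro add_mono) auto
  finally show ?thesis by (simp add: mult_ac)
qed

text \<open>A Paley--Zygmund estimate: by AM--GM, \<open>f\<^sup>2 \<le> 1/4 + f\<^sup>4/8 + 2\<close>, and the last summand is
  only needed where \<open>\<bar>f\<bar> \<ge> 1/2\<close>.\<close>

lemma rad_sum_large:
  assumes "(\<Sum>i<k. (a i)\<^sup>2) = 1"
  shows "3 / 16 * 2 ^ k \<le> card {w. w < 2 ^ k \<and> 1 / 2 \<le> \<bar>rad_sum k a w\<bar>}"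
proof -
  define f where "f = rad_sum k a"
  define W where "W = {w. w < 2 ^ k \<and> 1 / 2 \<le> \<bar>f w\<bar>}"
  have pt: "(f w)\<^sup>2 \<le> 1 / 4 + (f w) ^ 4 / 8 + (if w \<in> W then 2 else 0)" if "w < 2 ^ k" for w
  proof (cases "w \<in> W")
    case True
    have "0 \<le> ((f w)\<^sup>2 - 4)\<^sup>2" by simp
    also have "((f w)\<^sup>2 - 4)\<^sup>2 = (f w) ^ 4 - 8 * (f w)\<^sup>2 + 16"
      unfolding power2_diff by simp
    finally have "8 * (f w)\<^sup>2 \<le> (f w) ^ 4 + 16" by linarith
    then show ?thesis using True by simp
  next
    case False
    then have "\<bar>f w\<bar> \<le> 1 / 2" using that by (simp add: W_def)
    then have "(f w)\<^sup>2 \<le> (1 / 2)\<^sup>2" by (metis abs_ge_zero power2_abs power_mono)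
    moreover have "0 \<le> (f w) ^ 4" by simp
    moreover have "(1 / 2 :: real)\<^sup>2 = 1 / 4" by (simp add: power2_eq_square)
    ultimately have "(f w)\<^sup>2 \<le> 1 / 4 + (f w) ^ 4 / 8" by linarith
    then show ?thesis using False by simp
  qed
  have "2 ^ k = (\<Sum>w<2 ^ k. (f w)\<^sup>2)" using rad_sum_moment2[of k a] assms by (simp add: f_def)
  also have "\<dots> \<le> (\<Sum>w<2 ^ k. 1 / 4 + (f w) ^ 4 / 8 + (if w \<in> W then 2 else 0))"
    by (intro sum_mono pt) auto
  also have "\<dots> = 2 ^ k / 4 + (\<Sum>w<2 ^ k. (f w) ^ 4) / 8 + (\<Sum>w<2 ^ k. if w \<in> W then 2 else 0)"
    by (simp add: sum.distrib sum_divide_distrib)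
  also have "(\<Sum>w<2 ^ k. if w \<in> W then 2 else 0) = (2 * card W :: real)"
    by (subst sum.inter_filter[symmetric]) (auto simp: W_def conj_commute)
  also have "(\<Sum>w<2 ^ k. (f w) ^ 4) \<le> 3 * 2 ^ k"
    using rad_sum_moment4[of k a] assms by (simp add: f_def)
  finally show ?thesis unfolding W_def f_def by simp
qed

lemma sum_blocks:
  fixes h :: "nat \<Rightarrow> 'a::comm_monoid_add" and m :: "nat \<Rightarrow> nat"
  assumes "m 0 = 0" "\<And>w. m w \<le> m (Suc w)"
  shows "(\<Sum>j<m K. h j) = (\<Sum>w<K. \<Sum>j\<in>{m w..<m (Suc w)}. h j)"
proof (induction K)
  case (Suc K)
  have "(\<Sum>j<m (Suc K). h j) = (\<Sum>j<m K. h j) + (\<Sum>j\<in>{m K..<m (Suc K)}. h j)"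
    unfolding lessThan_atLeast0 using assms(2) by (intro sum.atLeastLessThan_concat[symmetric]) auto
  then show ?case using Suc by simp
qed (use assms in simp)

lemma sum_restr_blocks_apply:
  fixes h :: "nat \<Rightarrow> nat \<Rightarrow> 'k::comm_monoid_add"
  assumes mono: "\<And>w. m w \<le> m (Suc w)" and "w < K" "j \<in> {m w..<m (Suc w)}"
  shows "(\<Sum>w<K. restr {m w..<m (Suc w)} (h w) j) = h w j"
proof -
  have "j \<notin> {m w'..<m (Suc w')}" if "w' \<noteq> w" for w'
  proof (cases "w' < w")
    case True
    then have "m (Suc w') \<le> m w" using lift_Suc_mono_le[of m "Suc w'" w] mono by auto
    then show ?thesis using assms(3) by auto
  next
    case False
    then have "m (Suc w) \<le> m w'" using lift_Suc_mono_le[of m "Suc w" w'] mono that by auto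
    then show ?thesis using assms(3) by auto
  qed
  then have "(\<Sum>w'<K. restr {m w'..<m (Suc w')} (h w') j) = (\<Sum>w'<K. if w' = w then h w j else 0)"
    using assms(3) by (intro sum.cong) (auto simp: restr_def)
  then show ?thesis using assms(2) by simp
qed

lemma (in orlicz) modular_blocks:
  assumes m: "m 0 = 0" "\<And>w. m w \<le> m (Suc w)" and s: "s > 0"
  shows "modular_le M s r (\<Sum>w<K. restr {m w..<m (Suc w)} (h w)) \<longleftrightarrow>
    (\<Sum>w<K. \<Sum>j\<in>{m w..<m (Suc w)}. M (norm (h w j) / s)) \<le> r"
proof -
  define V where "V = (\<Sum>w<K. restr {m w..<m (Suc w)} (h w))"
  have V: "V j = h w j" if "w < K" "j \<in> {m w..<m (Suc w)}" for w j
    unfolding V_def sum_fun_apply by (rule sum_restr_blocks_apply[OF m(2) that])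
  have V0: "V j = 0" if "j \<ge> m K" for j
  proof -
    have "j \<notin> {m w..<m (Suc w)}" if "w < K" for w
      using lift_Suc_mono_le[of m "Suc w" K] m(2) that \<open>j \<ge> m K\<close> by auto
    then show ?thesis unfolding V_def sum_fun_apply restr_def by (intro sum.neutral) auto
  qed
  have sum: "(\<Sum>j<m K. M (norm (V j) / s)) = (\<Sum>w<K. \<Sum>j\<in>{m w..<m (Suc w)}. M (norm (h w j) / s))"
    unfolding sum_blocks[of m, OF m] by (intro sum.cong refl) (auto simp: V)
  have le: "(\<Sum>j<n. M (norm (V j) / s)) \<le> (\<Sum>j<m K. M (norm (V j) / s))" for n
  proof -
    have "M (norm (V j) / s) = 0" if "j \<notin> {..<m K}" for j using V0[of j] that by simp
    then have "(\<Sum>j<n. M (norm (V j) / s)) = (\<Sum>j\<in>{..<n} \<inter> {..<m K}. M (norm (V j) / s))"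
      by (intro sum.mono_neutral_right) blast+
    also have "\<dots> \<le> (\<Sum>j<m K. M (norm (V j) / s))"
      using s by (intro sum_mono2 M_nonneg) auto
    finally show ?thesis .
  qed
  show ?thesis
    unfolding V_def[symmetric] modular_le_def sum[symmetric] using le order_trans by blast
qed

section \<open>Tails and modulars under the doubling condition\<close>

context orlicz_delta2
begin

text \<open>Doubling is available only on \<open>[0, b]\<close>. While the sum is at most 1, each of
  its terms is, so all arguments are still at most \<open>b\<close>; the condition
  \<open>r * D ^ i \<le> 1\<close> keeps this true up to the last doubling.\<close>

lemma sum_doubling:
  assumes "finite A" "\<And>j. j \<in> A \<Longrightarrow> 0 \<le> c j" "(\<Sum>j\<in>A. M (c j)) \<le> r" "r * D ^ i \<le> 1"
  shows "(\<Sum>j\<in>A. M (2 ^ i * c j)) \<le> D ^ i * r"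
  using assms(4)
proof (induction i)
  case (Suc i)
  have r: "r \<ge> 0" using assms sum_nonneg[of A "\<lambda>j. M (c j)"] M_nonneg by force
  have "r * D ^ i \<le> r * D ^ Suc i"
    using r D_ge_1 by (intro mult_left_mono power_increasing) auto
  then have rD: "r * D ^ i \<le> 1" using Suc.prems by linarith
  have IH: "(\<Sum>j\<in>A. M (2 ^ i * c j)) \<le> D ^ i * r" by (rule Suc.IH[OF rD])
  have "M (2 ^ Suc i * c j) \<le> D * M (2 ^ i * c j)" if j: "j \<in> A" for j
  proof -
    have "M (2 ^ i * c j) \<le> (\<Sum>j\<in>A. M (2 ^ i * c j))"
      using assms(1,2) j by (intro member_le_sum M_nonneg) auto
    also have "\<dots> \<le> 1" using IH rD by (simp add: mult.commute)
    finally have "M (2 * (2 ^ i * c j)) \<le> D * M (2 ^ i * c j)"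
      using assms(2)[OF j] by (intro doubling le_b) auto
    then show ?thesis by (simp add: mult.assoc)
  qed
  then have "(\<Sum>j\<in>A. M (2 ^ Suc i * c j)) \<le> (\<Sum>j\<in>A. D * M (2 ^ i * c j))"
    by (intro sum_mono) auto
  also have "\<dots> = D * (\<Sum>j\<in>A. M (2 ^ i * c j))" by (simp add: sum_distrib_left)
  also have "\<dots> \<le> D * (D ^ i * r)" using IH D_ge_1 by (intro mult_left_mono) auto
  finally show ?case by simp
qed (use assms in simp)

lemma modular_le_doubling:
  assumes "modular_le M s r x" "s > 0" "r * D ^ i \<le> 1"
  shows "modular_le M (s / 2 ^ i) (D ^ i * r) x"
  unfolding modular_le_def
proof
  fix n
  have "(\<Sum>j<n. M (2 ^ i * (norm (x j) / s))) \<le> D ^ i * r"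
    using assms by (intro sum_doubling) (auto simp: modular_le_def)
  then show "(\<Sum>j<n. M (norm (x j) / (s / 2 ^ i))) \<le> D ^ i * r"
    by (simp add: mult_ac)
qed

text \<open>The modular of the tails at one fixed scale tends to 0 by summability. Once it is below
  \<open>1 / D ^ i\<close>, doubling lowers the scale by \<open>2 ^ i\<close>, and smallness in
  modular becomes smallness in norm.\<close>

lemma orlicz_tail:
  assumes "x \<in> orlicz_space M" "\<eta> > 0"
  shows "\<exists>n0. \<forall>n\<ge>n0. orlicz_norm M (restr {n..} x) \<le> \<eta>"
proof -
  obtain s where s: "s > 0" "modular_le M s 1 x" using assms(1) unfolding orlicz_space_iff by auto
  obtain i where i: "2 ^ i > s / \<eta>" using unbounded_power2 by blast
  define G where "G j = M (norm (x j) / s)" for j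
  have G: "0 \<le> G j" for j using s by (auto simp: G_def intro!: M_nonneg)
  have "summable G" using s modular_le_suminf[of s 1 x] unfolding G_def by blast
  then have "Cauchy (\<lambda>n. \<Sum>j<n. G j)" by (simp add: summable_iff_convergent Cauchy_convergent_iff)
  moreover have "0 < 1 / D ^ i" using D_ge_1 by simp
  ultimately obtain n0 where n0: "\<And>m n. m \<ge> n0 \<Longrightarrow> n \<ge> n0 \<Longrightarrow> dist (\<Sum>j<m. G j) (\<Sum>j<n. G j) < 1 / D ^ i"
    unfolding Cauchy_def by meson
  have "orlicz_norm M (restr {n..} x) \<le> \<eta>" if "n \<ge> n0" for n
  proof -
    have "modular_le M s (1 / D ^ i) (restr {n..} x)"
      unfolding modular_le_def
    proof
      fix k
      have "(\<Sum>j<k. M (norm (restr {n..} x j) / s)) \<le> (\<Sum>j<max n k. M (norm (restr {n..} x j) / s))"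
        using s by (intro sum_mono2 M_nonneg) auto
      also have "\<dots> = (\<Sum>j\<in>{n..<max n k}. G j)"
        by (intro sum.mono_neutral_cong_right) (auto simp: restr_def G_def)
      also have "\<dots> = (\<Sum>j<max n k. G j) - (\<Sum>j<n. G j)"
        using sum.atLeastLessThan_concat[of 0 n "max n k" G] by (simp add: lessThan_atLeast0)
      also have "\<dots> \<le> 1 / D ^ i"
        using n0[of "max n k" n] that unfolding dist_real_def by (simp add: le_max_iff_disj)
      finally show "(\<Sum>j<k. M (norm (restr {n..} x j) / s)) \<le> 1 / D ^ i" .
    qed
    then have "modular_le M (s / 2 ^ i) (D ^ i * (1 / D ^ i)) (restr {n..} x)"
      using s D_ge_1 by (intro modular_le_doubling) auto
    then have "orlicz_norm M (restr {n..} x) \<le> s / 2 ^ i"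
      using s D_ge_1 by (intro orlicz_norm_le) auto
    also have "\<dots> \<le> \<eta>" using i assms(2) by (simp add: field_simps)
    finally show ?thesis .
  qed
  then show ?thesis by blast
qed

lemma restr_orlicz:
  assumes "x \<in> orlicz_space M"
  shows "restr A x \<in> orlicz_space M" "orlicz_norm M (restr A x) \<le> orlicz_norm M x"
  using orlicz_space_mono[OF assms, of "restr A x"] orlicz_norm_mono[OF assms, of "restr A x"]
  by (auto simp: restr_def)

text \<open>The contrapositive of iterated doubling: a lower bound on the norm forces one on the
  modular, already visible on a finite section.\<close>

lemma modular_large:
  assumes "x \<in> orlicz_space M" "s > 0" "s / 2 ^ i < orlicz_norm M x"
  shows "\<exists>n. 1 / D ^ i < (\<Sum>j<n. M (norm (x j) / s))"
proof (rule ccontr)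
  assume "\<not> ?thesis"
  then have "modular_le M s (1 / D ^ i) x" by (auto simp: modular_le_def not_less)
  then have "modular_le M (s / 2 ^ i) (D ^ i * (1 / D ^ i)) x"
    using assms D_ge_1 by (intro modular_le_doubling) auto
  then have "orlicz_norm M x \<le> s / 2 ^ i"
    using assms D_ge_1 by (intro orlicz_norm_le) auto
  then show False using assms by simp
qed

text \<open>A normalised vector of \<open>Y\<close> is halved until its modular drops to
  \<open>r\<close>. The last halving divides the modular by at most \<open>D\<close>, so it cannot
  fall below \<open>r / D\<close>.\<close>

lemma ex_tail_vector:
  fixes Y :: "(nat \<Rightarrow> 'k::real_normed_field) set"
  assumes Y: "Y \<subseteq> orlicz_space M" "seq.subspace Y" "infinite_dimensional Y"
    and r: "0 < r" "r \<le> 1" and \<eta>: "\<eta> > 0"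
  shows "\<exists>u n. u \<in> Y \<and> m \<le> n \<and> (\<forall>j<m. u j = 0) \<and> r / D \<le> (\<Sum>j<n. M (norm (u j))) \<and>
    (\<Sum>j<n. M (norm (u j))) \<le> r \<and> orlicz_norm M (restr {n..} u) \<le> \<eta>"
proof -
  obtain y where y: "y \<in> Y" "y \<noteq> 0" "\<forall>j<m. y j = 0"
    using nth_subset_vanishing[OF Y(2,3)] by blast
  have yX: "y \<in> orlicz_space M" using y Y by blast
  then have ny: "orlicz_norm M y > 0"
    using y(2) norm_on_orlicz unfolding norm_on_def by (metis less_eq_real_def)
  define x where "x = scale_seq (of_real (1 / orlicz_norm M y)) y"
  have x: "x \<in> Y" "x \<in> orlicz_space M"
    unfolding x_def by (rule seq.subspace_scale[OF Y(2) y(1)], rule orlicz_space_scale[OF yX])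
  have "norm (of_real (1 / orlicz_norm M y) :: 'k) = 1 / orlicz_norm M y"
    unfolding norm_of_real using ny by simp
  then have x_norm: "orlicz_norm M x = 1" and x_zero: "\<And>j. j < m \<Longrightarrow> x j = 0"
    unfolding x_def orlicz_norm_scale[OF yX] using y(3) ny by (auto simp: scale_seq_def)
  have x1: "modular_le M 1 1 x" using x x_norm by (intro modular_le_norm) auto
  have "\<exists>i. modular_le M (2 ^ i) r x"
  proof -
    obtain i where i: "2 ^ i > 1 / r" using unbounded_power2 by blast
    have "modular_le M (2 ^ i * 1) (1 / 2 ^ i) x"
      by (rule modular_le_shrink[OF x1]) auto
    then have "modular_le M (2 ^ i) r x"
      using i r by (auto intro: modular_le_weaken simp: field_simps)
    then show ?thesis by blast
  qed
  then obtain i where i: "modular_le M (2 ^ i) r x" "\<And>i'. i' < i \<Longrightarrow> \<not> modular_le M (2 ^ i') r x"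
    using LeastI_ex[of "\<lambda>i. modular_le M (2 ^ i) r x"] not_less_Least by blast
  define u where "u = scale_seq (of_real (1 / 2 ^ i)) x"
  have nu: "norm (u j) = norm (x j) / 2 ^ i" for j
    by (simp add: u_def scale_seq_def norm_mult norm_divide norm_power)
  have uY: "u \<in> Y" unfolding u_def by (intro seq.subspace_scale Y x)
  have le: "(\<Sum>j<n. M (norm (u j))) \<le> r" for n
    using i(1) unfolding modular_le_def nu by blast
  have "\<exists>n. r / D \<le> (\<Sum>j<n. M (norm (u j)))"
  proof (cases i)
    case 0
    \<comment> \<open>When no halving took place, norm 1 exceeds 1/2, and this gives modular above
      \<open>1 / D\<close>.\<close>
    obtain n where "1 / D ^ 1 < (\<Sum>j<n. M (norm (x j) / 1))"
      using modular_large[of x 1 1] x x_norm by auto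
    moreover have "r / D \<le> 1 / D" using r D_ge_1 by (intro divide_right_mono) auto
    ultimately show ?thesis using 0 unfolding nu by (intro exI[of _ n]) auto
  next
    case (Suc i')
    then obtain n where n: "r < (\<Sum>j<n. M (norm (x j) / 2 ^ i'))"
      using i(2)[of i'] by (auto simp: modular_le_def not_le)
    have "(\<Sum>j<n. M (norm (x j) / 2 ^ i')) \<le> (\<Sum>j<n. D * M (norm (u j)))"
    proof (rule sum_mono)
      fix j
      have "M (norm (u j)) \<le> (\<Sum>j<Suc j. M (norm (u j)))"
        by (intro member_le_sum M_nonneg) auto
      then have "M (norm (u j)) \<le> 1" using le[of "Suc j"] r by linarith
      then have "M (2 * norm (u j)) \<le> D * M (norm (u j))" by (intro doubling le_b) auto
      then show "M (norm (x j) / 2 ^ i') \<le> D * M (norm (u j))" by (simp add: nu Suc)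
    qed
    then have "r \<le> D * (\<Sum>j<n. M (norm (u j)))" using n by (simp add: sum_distrib_left)
    then show ?thesis using D_ge_1 by (intro exI[of _ n]) (simp add: field_simps)
  qed
  then obtain n where n: "r / D \<le> (\<Sum>j<n. M (norm (u j)))" by blast
  obtain n0 where n0: "\<And>n. n \<ge> n0 \<Longrightarrow> orlicz_norm M (restr {n..} u) \<le> \<eta>"
    using orlicz_tail[OF _ \<eta>, of u] uY Y by blast
  define n' where "n' = max m (max n n0)"
  have "(\<Sum>j<n. M (norm (u j))) \<le> (\<Sum>j<n'. M (norm (u j)))"
    by (intro sum_mono2 M_nonneg) (auto simp: n'_def)
  then show ?thesis
    using uY n n0[of n'] le[of n'] x_zero
    by (intro exI[of _ u] exI[of _ n']) (auto simp: n'_def u_def scale_seq_def)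
qed

end

section \<open>Uniformly Euclidean subspaces\<close>

text \<open>\<open>D ^ i\<close> is bounded by a fixed power of \<open>2 ^ i\<close>, so an
  exponential of \<open>2 ^ i\<close> wins. The rate 1/4 is taken with \<open>exp (1/4) < 2\<close>
  in view: exponentials of \<open>k / 4\<close> must stay below the number \<open>2 ^ k\<close> of
  blocks.\<close>

lemma power_le_exp_dyadic:
  fixes D :: real
  assumes "1 \<le> D"
  shows "\<exists>C\<ge>1. \<forall>i. D ^ Suc i \<le> C * exp (2 ^ i / 4)"
proof -
  obtain r where r: "2 ^ r > D" using unbounded_power2 by blast
  define q where "q = Suc r"
  have "(2::real) ^ r \<le> 2 ^ q" by (intro power_increasing) (auto simp: q_def)
  then have D: "D \<le> 2 ^ q" using r by linarith
  have pow: "x ^ q \<le> real q ^ q * exp x" if "0 \<le> x" for x :: real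
  proof -
    have "(x / q) ^ q \<le> (1 + x / q) ^ q" using that by (intro power_mono) (auto simp: q_def)
    also have "\<dots> \<le> exp x" using that by (intro exp_ge_one_plus_x_over_n_power_n) (auto simp: q_def)
    finally have "x ^ q / real q ^ q \<le> exp x" by (simp add: power_divide)
    moreover have "0 < real q ^ q" by (simp add: q_def)
    ultimately show ?thesis by (simp only: pos_divide_le_eq mult.commute)
  qed
  have "D ^ Suc i \<le> (8 ^ q * real q ^ q) * exp (2 ^ i / 4)" for i
  proof -
    have "D ^ Suc i \<le> (2 ^ q) ^ Suc i" using D assms by (intro power_mono) auto
    also have "\<dots> = (2 ^ Suc i) ^ q" by (metis power_mult mult.commute)
    also have "\<dots> = (8 * (2 ^ i / 4)) ^ q" by simp
    also have "\<dots> = 8 ^ q * (2 ^ i / 4) ^ q" by (rule power_mult_distrib)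
    also have "\<dots> \<le> 8 ^ q * (real q ^ q * exp (2 ^ i / 4))"
      by (intro mult_left_mono pow) auto
    finally show ?thesis by simp
  qed
  moreover have "1 \<le> 8 ^ q * real q ^ q"
  proof -
    have "1 \<le> (8::real) ^ q" "1 \<le> real q ^ q" by (auto intro!: one_le_power simp: q_def simp del: power_Suc)
    then show ?thesis using mult_mono[of 1 "8 ^ q" 1 "real q ^ q"] by simp
  qed
  ultimately show ?thesis by blast
qed

lemma exp_quarter_eventually_le_power2:
  "\<exists>k0. \<forall>k\<ge>k0. C * exp (real k / 4) \<le> 2 ^ k"
proof -
  have e: "exp (1 / 4 :: real) < 2" using exp_bound[of "1 / 4"] by (simp add: power2_eq_square)
  then obtain k0 where k0: "C < (2 / exp (1 / 4)) ^ k0"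
    using real_arch_pow[of "2 / exp (1 / 4)" C] by auto
  have "C * exp (real k / 4) \<le> 2 ^ k" if "k \<ge> k0" for k
  proof -
    have "(2 / exp (1 / 4)) ^ k0 \<le> (2 / exp (1 / 4) :: real) ^ k"
      using e that by (intro power_increasing) auto
    then have "C \<le> (2 / exp (1 / 4)) ^ k" using k0 by linarith
    then have "C * exp (1 / 4) ^ k \<le> 2 ^ k" by (simp add: power_divide field_simps)
    then show ?thesis by (simp add: exp_of_nat_mult[symmetric])
  qed
  then show ?thesis by blast
qed

context orlicz
begin

lemma orlicz_norm_sum:
  assumes "\<And>i. i \<in> A \<Longrightarrow> x i \<in> orlicz_space M" "finite A"
  shows "orlicz_norm M (\<Sum>i\<in>A. x i) \<le> (\<Sum>i\<in>A. orlicz_norm M (x i))"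
  using assms(2,1)
proof (induction A rule: finite_induct)
  case empty
  have "orlicz_norm M (0 :: nat \<Rightarrow> 'b) = 0"
    using norm_on_orlicz zero_in_orlicz unfolding norm_on_def by blast
  then show ?case by (simp only: sum.empty order_refl)
next
  case (insert i A)
  have "orlicz_norm M (x i + (\<Sum>i\<in>A. x i)) \<le> orlicz_norm M (x i) + orlicz_norm M (\<Sum>i\<in>A. x i)"
    using insert.prems by (intro orlicz_norm_triangle seq.subspace_sum[OF subspace_orlicz]) auto
  moreover have "orlicz_norm M (\<Sum>i\<in>A. x i) \<le> (\<Sum>i\<in>A. orlicz_norm M (x i))"
    using insert by blast
  ultimately show ?case unfolding sum.insert[OF insert.hyps] by linarith
qed

end

context orlicz_delta2
begin

text \<open>Doubling gives polynomial growth of the modular in \<open>s\<close>. An exponential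
  majorant is stated because exponential moments of Rademacher sums are at hand.\<close>

lemma block_modular_growth:
  assumes B: "finite B" "\<And>j. j \<in> B \<Longrightarrow> 0 \<le> c j" and sum: "(\<Sum>j\<in>B. M (c j)) \<le> r" and r: "0 \<le> r"
    and C: "1 \<le> C" "\<And>i. D ^ Suc i \<le> C * exp (2 ^ i / 4)" and rC: "r * (C * exp (K / 4)) \<le> 1"
    and s: "0 \<le> s" "s \<le> K"
  shows "(\<Sum>j\<in>B. M (s * c j)) \<le> C * exp s * r"
proof (cases "s \<le> 1")
  case True
  have "(\<Sum>j\<in>B. M (s * c j)) \<le> (\<Sum>j\<in>B. M (c j))"
    using B s True by (intro sum_mono M_mono mult_left_le_one_le) auto
  also have "\<dots> \<le> 1 * r" using sum by simp
  also have "1 * r \<le> C * exp s * r"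
    using C(1) s r mult_mono[of 1 C 1 "exp s"] by (intro mult_right_mono) auto
  finally show ?thesis .
next
  case False
  then have "0 < 1 / s" "1 / s \<le> 1" by auto
  from dyadic_scale[OF this] obtain i where i: "1 / 2 ^ Suc i < 1 / s" "1 / s \<le> 1 / 2 ^ i" by blast
  have s2: "s \<le> 2 ^ Suc i" "2 ^ i \<le> s" using i False by (simp_all add: field_simps)
  \<comment> \<open>The bound of \<open>D ^ Suc i\<close> by \<open>C * exp (2 ^ i / 4)\<close>
    serves twice: here, with \<open>2 ^ i \<le> K\<close>, it makes the doublings admissible; below,
    weakened to \<open>exp s\<close>, it is the estimate itself.\<close>
  have "r * D ^ Suc i \<le> r * (C * exp (K / 4))"
    using r s s2 C(1) by (intro mult_left_mono order_trans[OF C(2)]) auto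
  then have "r * D ^ Suc i \<le> 1" using rC by linarith
  then have "(\<Sum>j\<in>B. M (2 ^ Suc i * c j)) \<le> D ^ Suc i * r"
    using B sum by (intro sum_doubling) auto
  moreover have "(\<Sum>j\<in>B. M (s * c j)) \<le> (\<Sum>j\<in>B. M (2 ^ Suc i * c j))"
    using s2 s B by (intro sum_mono M_mono mult_right_mono mult_nonneg_nonneg) auto
  moreover have "D ^ Suc i * r \<le> C * exp s * r"
  proof (intro mult_right_mono r)
    have "exp (2 ^ i / 4) \<le> exp s" using s2 by simp
    then show "D ^ Suc i \<le> C * exp s" using C(1) by (intro order_trans[OF C(2)] mult_left_mono) auto
  qed
  ultimately show ?thesis by linarith
qed

lemma ex_tail_blocks:
  fixes Y :: "(nat \<Rightarrow> 'k::real_normed_field) set"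
  assumes Y: "Y \<subseteq> orlicz_space M" "seq.subspace Y" "infinite_dimensional Y"
    and r: "0 < r" "r \<le> 1" and \<eta>: "\<eta> > 0"
  obtains m u where "m 0 = 0" "\<And>w. m w \<le> m (Suc w)" "\<And>w. u w \<in> Y" "\<And>w j. j < m w \<Longrightarrow> u w j = 0"
    "\<And>w. r / D \<le> (\<Sum>j\<in>{m w..<m (Suc w)}. M (norm (u w j)))"
    "\<And>w. (\<Sum>j\<in>{m w..<m (Suc w)}. M (norm (u w j))) \<le> r"
    "\<And>w. orlicz_norm M (restr {m (Suc w)..} (u w)) \<le> \<eta>"
proof -
  obtain U N where UN: "\<And>m. U m \<in> Y" "\<And>m. m \<le> N m" "\<And>m j. j < m \<Longrightarrow> U m j = 0"
    "\<And>m. r / D \<le> (\<Sum>j<N m. M (norm (U m j)))" "\<And>m. (\<Sum>j<N m. M (norm (U m j))) \<le> r"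
    "\<And>m. orlicz_norm M (restr {N m..} (U m)) \<le> \<eta>"
    using ex_tail_vector[OF Y r \<eta>] by metis
  define m where "m w = (N ^^ w) 0" for w
  have m: "m (Suc w) = N (m w)" for w by (simp add: m_def)
  have "(\<Sum>j<N k. M (norm (U k j))) = (\<Sum>j\<in>{k..<N k}. M (norm (U k j)))" for k
    using UN(3) by (intro sum.mono_neutral_right) (auto simp: not_le)
  then show thesis
    using UN m by (intro that[of m "\<lambda>w. U (m w)"]) (simp_all add: m_def)
qed

lemma restr_split:
  assumes "\<And>j. j < m \<Longrightarrow> x j = (0 :: 'a::monoid_add)"
  shows "x = restr {m..<n} x + restr {max m n..} x"
  using assms by (auto simp: fun_eq_iff restr_def)

text \<open>The vectors are disjoint only up to tails of norm \<eta>. Cutting each down to its own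
  block costs at most \<open>n * G * \<eta>\<close>, and \<eta> can be fixed once \<open>n\<close>
  and \<open>G\<close> are known.\<close>

lemma block_decomposition:
  fixes n :: nat and g :: "nat \<Rightarrow> real" and \<eta> :: real
  assumes m: "\<And>l. m l \<le> m (Suc l)" and u: "\<And>l. u l \<in> orlicz_space M" "\<And>l j. j < m l \<Longrightarrow> u l j = 0"
    "\<And>l. orlicz_norm M (restr {m (Suc l)..} (u l)) \<le> \<eta>" and g: "\<And>l. \<bar>g l\<bar> \<le> G"
  defines "U \<equiv> \<Sum>l<n. scale_seq (of_real (g l)) (u l)"
    and "V \<equiv> \<Sum>l<n. restr {m l..<m (Suc l)} (scale_seq (of_real (g l)) (u l))"
  shows "V \<in> orlicz_space M" "orlicz_norm M U \<le> orlicz_norm M V + n * (G * \<eta>)"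
    "orlicz_norm M V \<le> orlicz_norm M U + n * (G * \<eta>)"
proof -
  define E where "E = (\<Sum>l<n. scale_seq (of_real (g l)) (restr {m (Suc l)..} (u l)))"
  show VX: "V \<in> orlicz_space M" unfolding V_def
    by (intro seq.subspace_sum[OF subspace_orlicz] restr_orlicz orlicz_space_scale u)
  have EX: "E \<in> orlicz_space M" unfolding E_def
    by (intro seq.subspace_sum[OF subspace_orlicz] restr_orlicz orlicz_space_scale u)
  have "U = (\<Sum>l<n. restr {m l..<m (Suc l)} (scale_seq (of_real (g l)) (u l)) +
      scale_seq (of_real (g l)) (restr {m (Suc l)..} (u l)))"
    unfolding U_def
  proof (rule sum.cong[OF refl])
    fix l
    have "u l = restr {m l..<m (Suc l)} (u l) + restr {m (Suc l)..} (u l)"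
      using restr_split[of "m l" "u l" "m (Suc l)"] u(2) m[of l] by (simp add: max_def)
    then show "scale_seq (of_real (g l)) (u l) = restr {m l..<m (Suc l)} (scale_seq (of_real (g l)) (u l)) +
      scale_seq (of_real (g l)) (restr {m (Suc l)..} (u l))"
      unfolding restr_scale by (metis seq.scale_right_distrib)
  qed
  also have "\<dots> = V + E" by (simp only: V_def E_def sum.distrib)
  finally have U: "U = V + E" .
  have E: "orlicz_norm M E \<le> n * (G * \<eta>)"
  proof -
    have "orlicz_norm M E \<le> (\<Sum>l<n. orlicz_norm M (scale_seq (of_real (g l)) (restr {m (Suc l)..} (u l))))"
      unfolding E_def by (intro orlicz_norm_sum orlicz_space_scale restr_orlicz u) auto
    also have "\<dots> = (\<Sum>l<n. \<bar>g l\<bar> * orlicz_norm M (restr {m (Suc l)..} (u l)))"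
      by (intro sum.cong refl) (simp add: orlicz_norm_scale[OF restr_orlicz(1)[OF u(1)]])
    also have "\<dots> \<le> (\<Sum>l<n. G * \<eta>)"
      using u(3) orlicz_norm_nonneg[OF restr_orlicz(1)[OF u(1)]]
      by (intro sum_mono mult_mono g) (auto intro: order_trans[OF abs_ge_zero g])
    finally show ?thesis by simp
  qed
  show "orlicz_norm M U \<le> orlicz_norm M V + n * (G * \<eta>)"
    using orlicz_norm_triangle[OF VX EX] E unfolding U by linarith
  have "orlicz_norm M (U + scale_seq (- 1) E) \<le> orlicz_norm M U + orlicz_norm M (scale_seq (- 1) E)"
    unfolding U by (intro orlicz_norm_triangle orlicz_space_add orlicz_space_scale VX EX)
  moreover have "U + scale_seq (- 1) E = V" by (simp add: U fun_eq_iff scale_seq_def)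
  moreover have "orlicz_norm M (scale_seq (- 1) E) = orlicz_norm M E"
    unfolding orlicz_norm_scale[OF EX] norm_minus_cancel by simp
  ultimately show "orlicz_norm M V \<le> orlicz_norm M U + n * (G * \<eta>)" using E by simp
qed

text \<open>\<open>2 ^ k\<close> almost disjoint vectors of modular about \<open>2 ^ -k\<close>
  imitate a probability space, and the \<open>x i\<close> are the Rademacher functions on it. A
  combination puts the value of its Rademacher sum on each block; its modular is bounded above by
  the exponential moment and below by the Paley-Zygmund estimate, both uniformly in
  \<open>k\<close>.\<close>

lemma euclidean_subspaces:
  fixes Y :: "(nat \<Rightarrow> 'k::real_normed_field) set"
  assumes Y: "Y \<subseteq> orlicz_space M" "seq.subspace Y" "infinite_dimensional Y"
  shows "\<exists>c>0. \<exists>C. \<exists>k0::nat. \<forall>k\<ge>k0. \<exists>x. (\<forall>i. x i \<in> Y) \<and>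
    (\<forall>a. (\<Sum>i<k. (a i)\<^sup>2) = 1 \<longrightarrow>
      c \<le> orlicz_norm M (\<Sum>i<k. scale_seq (of_real (a i)) (x i)) \<and>
      orlicz_norm M (\<Sum>i<k. scale_seq (of_real (a i)) (x i)) \<le> C)"
proof -
  obtain C where C: "1 \<le> C" "\<And>i. D ^ Suc i \<le> C * exp (2 ^ i / 4)"
    using power_le_exp_dyadic[OF D_ge_1] by blast
  obtain k0 where k0: "\<And>k. k \<ge> k0 \<Longrightarrow> C * exp (real k / 4) \<le> 2 ^ k"
    using exp_quarter_eventually_le_power2 by blast
  \<comment> \<open>On at least 3/16 of the blocks the coefficient has modulus at least 1/2, and
    there the modular is at least \<open>r / D^2\<close>: one \<open>D\<close> from the choice of
    the vectors, one from the halving.\<close>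
  define c where "c = 3 / (16 * D\<^sup>2)"
  have "1 \<le> D\<^sup>2" using D_ge_1 by (rule one_le_power)
  then have c: "0 < c" "c < 1" by (auto simp: c_def divide_less_eq)
  define H where "H = C * (2 * exp 1)"
  have H: "H \<ge> 1" using C(1) mult_mono[of 1 C 1 "2 * exp 1"] one_le_exp_iff[of "1::real"] unfolding H_def by linarith
  define good where "good k c C x \<longleftrightarrow> (\<forall>i. x i \<in> Y) \<and> (\<forall>a. (\<Sum>i<k. (a i)\<^sup>2) = 1 \<longrightarrow>
      c \<le> orlicz_norm M (\<Sum>i<k. scale_seq (of_real (a i)) (x i)) \<and>
      orlicz_norm M (\<Sum>i<k. scale_seq (of_real (a i)) (x i)) \<le> C)" for k c C and x :: "nat \<Rightarrow> nat \<Rightarrow> 'k"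
  have "\<exists>x. (\<forall>i. x i \<in> Y) \<and> (\<forall>a. (\<Sum>i<k. (a i)\<^sup>2) = 1 \<longrightarrow>
      c / 2 \<le> orlicz_norm M (\<Sum>i<k. scale_seq (of_real (a i)) (x i)) \<and>
      orlicz_norm M (\<Sum>i<k. scale_seq (of_real (a i)) (x i)) \<le> H + c / 2)" if "k \<ge> k0" for k
  proof -
    define r :: real where "r = 1 / 2 ^ k"
    \<comment> \<open>With \<open>2 ^ k\<close> blocks and coefficients of modulus at most
      \<open>k\<close>, this keeps the total tail error below \<open>c / 2\<close>;
      \<open>k + 1\<close> in place of \<open>k\<close> avoids a division by 0.\<close>
    define \<eta> where "\<eta> = c / (2 * 2 ^ k * (real k + 1))"
    have r: "0 < r" "r \<le> 1" by (auto simp: r_def)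
    have \<eta>: "\<eta> > 0" using c unfolding \<eta>_def by (intro divide_pos_pos mult_pos_pos) auto
    obtain m and u :: "nat \<Rightarrow> nat \<Rightarrow> 'k" where m: "m 0 = 0" "\<And>w. m w \<le> m (Suc w)"
      and u: "\<And>w. u w \<in> Y" "\<And>w j. j < m w \<Longrightarrow> u w j = 0"
      "\<And>w. r / D \<le> (\<Sum>j\<in>{m w..<m (Suc w)}. M (norm (u w j)))"
      "\<And>w. (\<Sum>j\<in>{m w..<m (Suc w)}. M (norm (u w j))) \<le> r"
      "\<And>w. orlicz_norm M (restr {m (Suc w)..} (u w)) \<le> \<eta>"
      using ex_tail_blocks[OF Y r \<eta>] by blast
    define x where "x i = (\<Sum>w<2 ^ k. scale_seq (of_real (rademacher i w)) (u w))" for i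
    have xY: "x i \<in> Y" for i
      unfolding x_def by (intro seq.subspace_sum[OF Y(2)] seq.subspace_scale[OF Y(2)] u)
    have uX: "u w \<in> orlicz_space M" for w using u(1) Y by blast
    have main: "c / 2 \<le> orlicz_norm M (\<Sum>i<k. scale_seq (of_real (a i)) (x i)) \<and>
      orlicz_norm M (\<Sum>i<k. scale_seq (of_real (a i)) (x i)) \<le> H + c / 2"
      if a: "(\<Sum>i<k. (a i)\<^sup>2) = 1" for a
    proof -
      define g where "g = rad_sum k a"
      have g_le: "\<bar>g w\<bar> \<le> k" for w
      proof -
        have "\<bar>g w\<bar> \<le> (\<Sum>i<k. \<bar>a i * rademacher i w\<bar>)" unfolding g_def rad_sum_def by (rule sum_abs)
        also have "\<dots> \<le> (\<Sum>i<k. 1)"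
          using unit_coeff_le_1[OF a] by (intro sum_mono) (auto simp: rademacher_def abs_mult)
        finally show ?thesis by simp
      qed
      define z where "z = (\<Sum>i<k. scale_seq (of_real (a i)) (x i))"
      define V where "V = (\<Sum>w<2 ^ k. restr {m w..<m (Suc w)} (scale_seq (of_real (g w)) (u w)))"
      have z: "z = (\<Sum>w<2 ^ k. scale_seq (of_real (g w)) (u w))"
      proof -
        have "z = (\<Sum>w<2 ^ k. \<Sum>i<k. scale_seq (of_real (a i) * of_real (rademacher i w)) (u w))"
          unfolding z_def x_def seq.scale_sum_right seq.scale_scale by (rule sum.swap)
        then show ?thesis
          by (simp add: g_def rad_sum_def seq.scale_sum_left)
      qed
      note appr = block_decomposition[where n = "2 ^ k" and m = m and u = u and g = g, OF m(2) uX u(2,5) g_le, folded V_def z]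
      note VX = appr(1)
      have E: "real (2 ^ k) * (k * \<eta>) \<le> c / 2"
      proof -
        have "real k + 1 \<noteq> 0" by linarith
        then have "2 ^ k * ((real k + 1) * \<eta>) = c / 2"
          unfolding \<eta>_def by (simp del: distrib_left distrib_right)
        moreover have "real (2 ^ k) * (k * \<eta>) \<le> 2 ^ k * ((real k + 1) * \<eta>)" using \<eta> by simp
        ultimately show ?thesis by linarith
      qed
      have modV: "modular_le M 1 q V \<longleftrightarrow>
          (\<Sum>w<2 ^ k. \<Sum>j\<in>{m w..<m (Suc w)}. M (\<bar>g w\<bar> * norm (u w j))) \<le> q" for q
        unfolding V_def using modular_blocks[where m = m and s = 1 and r = q and K = "2 ^ k"
            and h = "\<lambda>w. scale_seq (of_real (g w)) (u w)"] m
        by (simp add: scale_seq_def norm_mult)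
      have V_up: "orlicz_norm M V \<le> H"
      proof -
        have "(\<Sum>w<2 ^ k. \<Sum>j\<in>{m w..<m (Suc w)}. M (\<bar>g w\<bar> * norm (u w j)))
            \<le> (\<Sum>w<(2::nat) ^ k. C * exp \<bar>g w\<bar> * r)"
        proof (rule sum_mono)
          fix w
          have "r * (C * exp (real k / 4)) \<le> r * 2 ^ k"
            using k0[OF \<open>k \<ge> k0\<close>] r by (intro mult_left_mono) auto
          then have "r * (C * exp (real k / 4)) \<le> 1" by (simp add: r_def)
          then show "(\<Sum>j\<in>{m w..<m (Suc w)}. M (\<bar>g w\<bar> * norm (u w j))) \<le> C * exp \<bar>g w\<bar> * r"
            using u(4) r C g_le by (intro block_modular_growth[where K = k]) auto
        qed
        also have "\<dots> = C * r * (\<Sum>w<2 ^ k. exp \<bar>g w\<bar>)" by (simp add: sum_distrib_left mult_ac)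
        also have "\<dots> \<le> C * r * (2 ^ k * (2 * exp 1))"
          using rad_sum_exp_abs[OF a] C(1) r unfolding g_def by (intro mult_left_mono) auto
        also have "\<dots> = H" by (simp add: H_def r_def)
        finally have "modular_le M 1 H V" unfolding modV .
        from modular_le_shrink[OF this _ H] H have "modular_le M H 1 V" by simp
        then show ?thesis using H by (intro orlicz_norm_le) auto
      qed
      have V_low: "c \<le> orlicz_norm M V"
      proof (rule ccontr)
        assume "\<not> ?thesis"
        then obtain s where s: "orlicz_norm M V < s" "s < c" using dense not_le by blast
        have s0: "0 < s" using s orlicz_norm_nonneg[OF VX] by simp
        have "modular_le M s 1 V" using s VX by (intro orlicz_norm_less)
        \<comment> \<open>As \<open>s < 1\<close>, convexity turns modular at most 1 at scale
          \<open>s\<close> into modular at most \<open>s\<close> at scale 1.\<close>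
        from modular_le_shrink[OF this s0, of "1 / s"] s0 s c
        have "modular_le M 1 s V" by simp
        then have "(\<Sum>w<2 ^ k. \<Sum>j\<in>{m w..<m (Suc w)}. M (\<bar>g w\<bar> * norm (u w j))) \<le> s"
          unfolding modV .
        moreover define W where "W = {w. w < 2 ^ k \<and> 1 / 2 \<le> \<bar>rad_sum k a w\<bar>}"
        have "(\<Sum>w\<in>W. r / D\<^sup>2) \<le> (\<Sum>w\<in>W. \<Sum>j\<in>{m w..<m (Suc w)}. M (\<bar>g w\<bar> * norm (u w j)))"
        proof (rule sum_mono)
          fix w assume w: "w \<in> W"
          have "r / D \<le> (\<Sum>j\<in>{m w..<m (Suc w)}. M (norm (u w j)))" by (rule u)
          also have "\<dots> \<le> (\<Sum>j\<in>{m w..<m (Suc w)}. D * M (\<bar>g w\<bar> * norm (u w j)))"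
          proof (rule sum_mono)
            fix j assume j: "j \<in> {m w..<m (Suc w)}"
            have "M (norm (u w j)) \<le> (\<Sum>j\<in>{m w..<m (Suc w)}. M (norm (u w j)))"
              using j by (intro member_le_sum M_nonneg) auto
            also have "\<dots> \<le> 1" using u(4)[of w] r by simp
            finally have "norm (u w j) / 2 \<le> b" using le_b[of "norm (u w j)"] b_pos norm_ge_zero[of "u w j"] by linarith
            then have "M (2 * (norm (u w j) / 2)) \<le> D * M (norm (u w j) / 2)"
              by (intro doubling) auto
            moreover have "norm (u w j) / 2 \<le> \<bar>g w\<bar> * norm (u w j)"
              using w mult_right_mono[of "1 / 2" "\<bar>g w\<bar>" "norm (u w j)"] by (simp add: W_def g_def)
            then have "D * M (norm (u w j) / 2) \<le> D * M (\<bar>g w\<bar> * norm (u w j))"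
              using D_ge_1 by (intro mult_left_mono M_mono) auto
            ultimately show "M (norm (u w j)) \<le> D * M (\<bar>g w\<bar> * norm (u w j))" by simp
          qed
          also have "\<dots> = D * (\<Sum>j\<in>{m w..<m (Suc w)}. M (\<bar>g w\<bar> * norm (u w j)))"
            by (simp add: sum_distrib_left)
          finally show "r / D\<^sup>2 \<le> (\<Sum>j\<in>{m w..<m (Suc w)}. M (\<bar>g w\<bar> * norm (u w j)))"
            using D_ge_1 by (simp add: power2_eq_square field_simps)
        qed
        moreover have "\<dots> \<le> (\<Sum>w<2 ^ k. \<Sum>j\<in>{m w..<m (Suc w)}. M (\<bar>g w\<bar> * norm (u w j)))"
          by (intro sum_mono2 sum_nonneg M_nonneg) (auto simp: W_def)
        moreover have "c \<le> (\<Sum>w\<in>W. r / D\<^sup>2)"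
        proof -
          have "c = (3 / 16 * 2 ^ k) * (r / D\<^sup>2)" by (simp add: c_def r_def)
          also have "\<dots> \<le> card W * (r / D\<^sup>2)"
            using rad_sum_large[OF a] r unfolding W_def by (intro mult_right_mono) auto
          finally show ?thesis by simp
        qed
        ultimately show False using s by linarith
      qed
      have "orlicz_norm M z \<le> H + c / 2" using appr(2) V_up E by linarith
      moreover have "c / 2 \<le> orlicz_norm M z" using appr(3) V_low E by linarith
      ultimately show ?thesis unfolding z_def by blast
    qed
    show ?thesis using xY main by blast
  qed
  then have "\<forall>k\<ge>k0. \<exists>x. good k (c / 2) (H + c / 2) x" unfolding good_def by blast
  moreover have "0 < c / 2" using c by simp
  ultimately have "\<exists>c>0. \<exists>C. \<exists>k0. \<forall>k\<ge>k0. \<exists>x. good k c C x" by blast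
  then show ?thesis unfolding good_def .
qed

end

section \<open>Almost transitive norms\<close>

text \<open>Coefficients are real even over the complex field: the Rademacher estimates concern real
  sums, and one argument then serves both fields, with \<open>DIM('k)\<close> real equations for
  each coordinate to be annihilated.\<close>

definition comb :: "nat \<Rightarrow> (nat \<Rightarrow> nat \<Rightarrow> 'k::real_normed_field) \<Rightarrow> (nat \<Rightarrow> real) \<Rightarrow> nat \<Rightarrow> 'k" where
  "comb k x a = (\<Sum>i<k. scale_seq (of_real (a i)) (x i))"

lemma comb_add: "comb k x (\<lambda>i. a i + d i) = comb k x a + comb k x d"
  by (simp only: comb_def of_real_add seq.scale_left_distrib sum.distrib)

lemma comb_scale: "comb k x (\<lambda>i. s * a i) = scale_seq (of_real s) (comb k x a)"
  by (simp only: comb_def of_real_mult seq.scale_scale[symmetric] seq.scale_sum_right)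

locale almost_transitive_space =
  fixes Y :: "(nat \<Rightarrow> 'k::{real_normed_field,euclidean_space}) set" and N
  assumes subspace: "seq.subspace Y" and norm: "norm_on Y N" and transitive: "almost_transitive Y N"
begin

lemma N_nonneg: "x \<in> Y \<Longrightarrow> 0 \<le> N x"
  and N_zero_iff: "x \<in> Y \<Longrightarrow> N x = 0 \<longleftrightarrow> x = 0"
  and N_scale: "x \<in> Y \<Longrightarrow> N (scale_seq c x) = norm c * N x"
  and N_triangle: "x \<in> Y \<Longrightarrow> y \<in> Y \<Longrightarrow> N (x + y) \<le> N x + N y"
  using norm unfolding norm_on_def by blast+

lemma Y_closed: "0 \<in> Y" "x \<in> Y \<Longrightarrow> y \<in> Y \<Longrightarrow> x + y \<in> Y" "x \<in> Y \<Longrightarrow> y \<in> Y \<Longrightarrow> x - y \<in> Y"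
  "x \<in> Y \<Longrightarrow> scale_seq c x \<in> Y" "(\<And>i. i \<in> A \<Longrightarrow> f i \<in> Y) \<Longrightarrow> sum f A \<in> Y"
  using subspace by (auto intro: seq.subspace_0 seq.subspace_add seq.subspace_diff
      seq.subspace_scale seq.subspace_sum)

lemma N_pos: "x \<in> Y \<Longrightarrow> x \<noteq> 0 \<Longrightarrow> 0 < N x"
  using N_nonneg N_zero_iff less_eq_real_def by metis

lemma N_close:
  assumes "x \<in> Y" "y \<in> Y" "w \<in> Y" "N (x - y) \<le> e"
  shows "\<bar>N (x + w) - N (y + w)\<bar> \<le> e"
proof -
  have "scale_seq (- 1) (x - y) = y - x" by (simp add: scale_seq_def fun_eq_iff)
  then have sym: "N (y - x) = N (x - y)"
    using N_scale[OF Y_closed(3)[OF assms(1,2)], of "- 1"] by (simp only: norm_minus_cancel norm_one mult_1)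
  have "N ((x - y) + (y + w)) \<le> N (x - y) + N (y + w)"
    "N ((y - x) + (x + w)) \<le> N (y - x) + N (x + w)"
    by (rule N_triangle; intro Y_closed assms)+
  moreover have "(x - y) + (y + w) = x + w" "(y - x) + (x + w) = y + w"
    by (simp_all add: fun_eq_iff)
  ultimately show ?thesis using sym assms(4) by simp
qed

lemma near_orbit:
  assumes "x \<in> Y" "N x = 1" "y \<in> Y" "N y = 1" "\<epsilon> > 0"
  obtains T where "T \<in> surj_lin_isometries Y N" "N (x - T y) < \<epsilon>"
proof -
  interpret Metric_space Y "norm_dist Y N" by (rule Metric_space_norm_dist[OF subspace norm])
  have "x \<in> mtopology closure_of {T y | T. T \<in> surj_lin_isometries Y N}"
    using transitive assms unfolding almost_transitive_def unit_sphere_def norm_topology_def by auto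
  then obtain v where v: "v \<in> {T y | T. T \<in> surj_lin_isometries Y N}" "v \<in> mball x \<epsilon>"
    using assms(5) unfolding metric_closure_of by blast
  then obtain T where T: "T \<in> surj_lin_isometries Y N" "v = T y" by blast
  have "N (x - T y) < \<epsilon>" using v(2) unfolding in_mball norm_dist_def T(2) by (auto split: if_splits)
  then show thesis using that T by blast
qed

lemma comb_in: "(\<And>i. x i \<in> Y) \<Longrightarrow> comb k x a \<in> Y"
  unfolding comb_def by (intro Y_closed)

text \<open>The isometry that moves the chosen Euclidean direction next to \<open>u\<close> carries the whole Euclidean
  subspace along; since its dimension exceeds the number of real equations, some vector of the image
  vanishes on the first \<open>m\<close> coordinates.\<close>

lemma move_euclidean:
  assumes x: "\<And>i. x i \<in> Y" and k: "m * DIM('k) < k"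
    and inj: "\<forall>a. (\<exists>i<k. a i \<noteq> 0) \<longrightarrow> N (comb k x a) \<noteq> 0"
    and e: "N (comb k x e) = 1" and u: "u \<in> Y" "N u = 1" and \<epsilon>: "\<epsilon> > 0"
  shows "\<exists>z \<zeta>. \<zeta> \<in> Y \<and> N \<zeta> = 1 \<and> (\<forall>j<m. \<zeta> j = 0) \<and> N (comb k x z) = 1 \<and>
    (\<forall>s. \<bar>N (u + scale_seq (of_real s) \<zeta>) - N (comb k x (\<lambda>i. e i + s * z i))\<bar> \<le> \<epsilon>)"
proof -
  have cY: "comb k x a \<in> Y" for a by (rule comb_in) (rule x)
  obtain T where T: "T \<in> surj_lin_isometries Y N" "N (u - T (comb k x e)) < \<epsilon>"
    using near_orbit[OF u cY e \<epsilon>] by blast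
  then have lin: "lin_on Y T" and TY: "\<And>y. y \<in> Y \<Longrightarrow> T y \<in> Y" and TN: "\<And>y. y \<in> Y \<Longrightarrow> N (T y) = N y"
    unfolding surj_lin_isometries_def by auto
  have Tcomb: "T (comb k x a) = comb k (\<lambda>i. T (x i)) a" for a
    unfolding comb_def by (rule lin_on_sum[OF subspace lin x])
  have "\<exists>z0. (\<exists>i\<in>{..<k}. z0 i \<noteq> 0) \<and>
    (\<forall>p\<in>{..<m} \<times> (Basis :: 'k set). (\<Sum>i<k. z0 i * (T (x i) (fst p) \<bullet> snd p)) = 0)"
    by (rule nontrivial_solution) (use k in auto)
  then obtain z0 where z0: "\<exists>i\<in>{..<k}. z0 i \<noteq> 0"
    "\<And>p. p \<in> {..<m} \<times> (Basis :: 'k set) \<Longrightarrow> (\<Sum>i<k. z0 i * (T (x i) (fst p) \<bullet> snd p)) = 0"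
    by blast
  define q where "q = N (comb k x z0)"
  have q: "q > 0"
  proof -
    have "N (comb k x z0) \<noteq> 0" using z0(1) by (intro inj[rule_format]) auto
    moreover have "0 \<le> N (comb k x z0)" by (intro N_nonneg cY)
    ultimately show ?thesis by (simp add: q_def)
  qed
  define z where "z i = (1 / q) * z0 i" for i
  define \<zeta> where "\<zeta> = T (comb k x z)"
  have Nz: "N (comb k x z) = 1"
    unfolding z_def comb_scale using q N_scale[OF cY[of z0], of "of_real (1 / q)"]
    by (simp add: q_def norm_divide)
  have "T (comb k x z0) j = 0" if "j < m" for j
  proof (rule euclidean_eqI)
    fix b :: 'k assume b: "b \<in> Basis"
    have "T (comb k x z0) j = (\<Sum>i<k. z0 i *\<^sub>R T (x i) j)"
      unfolding Tcomb unfolding comb_def sum_fun_apply scale_seq_def scaleR_conv_of_real ..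
    then have "T (comb k x z0) j \<bullet> b = (\<Sum>i<k. z0 i * (T (x i) j \<bullet> b))"
      by (simp add: inner_sum_left)
    also have "\<dots> = 0" using z0(2)[of "(j, b)"] b that by simp
    finally show "T (comb k x z0) j \<bullet> b = 0 \<bullet> b" by simp
  qed
  moreover have "\<zeta> = scale_seq (of_real (1 / q)) (T (comb k x z0))"
    unfolding \<zeta>_def z_def comb_scale using lin cY unfolding lin_on_def by blast
  ultimately have \<zeta>0: "\<zeta> j = 0" if "j < m" for j using that by (simp add: scale_seq_def)
  have \<zeta>: "\<zeta> \<in> Y" "N \<zeta> = 1" using TY TN cY Nz unfolding \<zeta>_def by auto
  \<comment> \<open>Only the base point is approximated; the step is the exact isometric image of
    its counterpart in the copy. Hence the error does not depend on \<open>s\<close>.\<close>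
  have "\<bar>N (u + scale_seq (of_real s) \<zeta>) - N (comb k x (\<lambda>i. e i + s * z i))\<bar> \<le> \<epsilon>" for s
  proof -
    have "\<bar>N (u + scale_seq (of_real s) \<zeta>) - N (T (comb k x e) + scale_seq (of_real s) \<zeta>)\<bar> \<le> \<epsilon>"
      using T(2) by (intro N_close u TY cY Y_closed(4) \<zeta>) auto
    moreover have "T (comb k x e) + scale_seq (of_real s) \<zeta> = T (comb k x (\<lambda>i. e i + s * z i))"
    proof -
      have "T (comb k x e + scale_seq (of_real s) (comb k x z)) = T (comb k x e) + scale_seq (of_real s) \<zeta>"
        unfolding \<zeta>_def using lin cY Y_closed(4)[OF cY] unfolding lin_on_def by metis
      then show ?thesis by (simp only: comb_add comb_scale)
    qed
    ultimately show ?thesis using TN[OF cY] by simp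
  qed
  then show ?thesis by (intro exI[of _ z] exI[of _ \<zeta>] conjI allI impI \<zeta> \<zeta>0 Nz)
qed

end

lemma sum_square_expand:
  fixes e z :: "nat \<Rightarrow> real"
  shows "(\<Sum>i<k. (e i + s * z i)\<^sup>2) =
    (\<Sum>i<k. (e i)\<^sup>2) + 2 * s * (\<Sum>i<k. e i * z i) + s\<^sup>2 * (\<Sum>i<k. (z i)\<^sup>2)"
  by (simp add: power2_sum sum.distrib sum_distrib_left power_mult_distrib algebra_simps)

section \<open>Extremal directions and quadratic steps\<close>

locale euclidean_transitive_space = almost_transitive_space Y N
  for Y :: "(nat \<Rightarrow> 'k::{real_normed_field,euclidean_space}) set" and N +
  fixes c C :: real and k0 :: nat
  assumes c: "0 < c"
    and euclid: "\<And>k. k \<ge> k0 \<Longrightarrow> \<exists>x. (\<forall>i. x i \<in> Y) \<and>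
      (\<forall>a. (\<Sum>i<k. (a i)\<^sup>2) = 1 \<longrightarrow> c \<le> N (comb k x a) \<and> N (comb k x a) \<le> C)"
    and infinite: "infinite_dimensional Y"
begin

text \<open>The last clause is homogeneity, written so that extremal values on the Euclidean unit
  sphere control \<open>N\<close> on all combinations. It covers zero coefficients as well, where
  both sides are 0.\<close>

definition euclidean_system :: "nat \<Rightarrow> (nat \<Rightarrow> nat \<Rightarrow> 'k) \<Rightarrow> bool" where
  "euclidean_system k x \<longleftrightarrow> (\<forall>i. x i \<in> Y) \<and>
    (\<forall>a. c * sqrt (\<Sum>i<k. (a i)\<^sup>2) \<le> N (comb k x a)) \<and>
    (\<forall>a. N (comb k x a) \<le> C * sqrt (\<Sum>i<k. (a i)\<^sup>2)) \<and>
    (\<forall>a. N (comb k x a) = sqrt (\<Sum>i<k. (a i)\<^sup>2) * N (comb k x (\<lambda>i. a i / sqrt (\<Sum>i<k. (a i)\<^sup>2))))"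

lemma unit_coefficients:
  fixes a :: "nat \<Rightarrow> real"
  assumes "(\<Sum>i<k. (a i)\<^sup>2) \<noteq> 0"
  shows "(\<Sum>i<k. (a i / sqrt (\<Sum>i<k. (a i)\<^sup>2))\<^sup>2) = 1"
  using assms by (simp add: power_divide sum_nonneg flip: sum_divide_distrib)

lemma ex_euclidean_system: "\<exists>k x. m < k \<and> euclidean_system k x"
proof -
  define k where "k = max k0 (Suc m)"
  obtain x where x: "\<And>i. x i \<in> Y"
    "\<And>a. (\<Sum>i<k. (a i)\<^sup>2) = 1 \<Longrightarrow> c \<le> N (comb k x a) \<and> N (comb k x a) \<le> C"
    using euclid[of k] by (auto simp: k_def)
  note unit = unit_coefficients
  have cY: "comb k x a \<in> Y" for a by (rule comb_in) (rule x(1))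
  have hom: "N (comb k x a) = sqrt (\<Sum>i<k. (a i)\<^sup>2) * N (comb k x (\<lambda>i. a i / sqrt (\<Sum>i<k. (a i)\<^sup>2)))" for a
  proof (cases "(\<Sum>i<k. (a i)\<^sup>2) = 0")
    case True
    then have "comb k x a = 0" unfolding comb_def by (auto simp: sum_nonneg_eq_0_iff intro!: sum.neutral)
    then show ?thesis using True N_zero_iff[OF Y_closed(1)] by simp
  next
    case False
    define r where "r = sqrt (\<Sum>i<k. (a i)\<^sup>2)"
    have r: "r > 0" using False sum_nonneg[of "{..<k}" "\<lambda>i. (a i)\<^sup>2"] by (simp add: r_def)
    have "comb k x a = comb k x (\<lambda>i. r * (a i / r))" using r by simp
    also have "\<dots> = scale_seq (of_real r) (comb k x (\<lambda>i. a i / r))" by (rule comb_scale)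
    finally show ?thesis using r N_scale[OF cY] unfolding r_def[symmetric] by simp
  qed
  have "c * sqrt (\<Sum>i<k. (a i)\<^sup>2) \<le> N (comb k x a) \<and> N (comb k x a) \<le> C * sqrt (\<Sum>i<k. (a i)\<^sup>2)" for a
  proof (cases "(\<Sum>i<k. (a i)\<^sup>2) = 0")
    case False
    define r where "r = sqrt (\<Sum>i<k. (a i)\<^sup>2)"
    have r: "0 \<le> r" by (simp add: r_def sum_nonneg)
    show ?thesis
      using x(2)[OF unit[OF False]] hom[of a] r unfolding r_def[symmetric]
      by (simp add: mult_left_mono mult.commute[of _ r])
  qed (use hom[of a] in simp)
  then have "euclidean_system k x" unfolding euclidean_system_def using x(1) hom by blast
  moreover have "m < k" by (auto simp: k_def)
  ultimately show ?thesis by blast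
qed

lemma c_le_C: "c \<le> C"
proof -
  obtain k x where kx: "0 < k" "\<And>a. c * sqrt (\<Sum>i<k. (a i)\<^sup>2) \<le> N (comb k x a)"
    "\<And>a. N (comb k x a) \<le> C * sqrt (\<Sum>i<k. (a i)\<^sup>2)"
    using ex_euclidean_system[of 0] unfolding euclidean_system_def by blast
  have "(\<Sum>i<k. (if i = 0 then 1 else 0 :: real)\<^sup>2) = 1"
    using kx(1) by (simp add: if_distrib[of "\<lambda>x. x\<^sup>2"] cong: if_cong)
  then show ?thesis using kx(2,3)[of "\<lambda>i. if i = 0 then 1 else 0"] by simp
qed

text \<open>The sign of the step is chosen by \<open>\<sigma>\<close>, so that the cross term of the Euclidean norm can be
  dropped in whichever direction is needed.\<close>

lemma extremal_step:
  assumes sys: "euclidean_system k x" and k: "m * DIM('k) < k" and u: "u \<in> Y" "N u = 1"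
    and t: "0 < t" and \<epsilon>: "0 < \<epsilon>" and a0: "(\<Sum>i<k. (a0 i)\<^sup>2) = 1"
  defines "p \<equiv> N (comb k x a0)"
  shows "\<exists>v\<in>Y. N v = 1 \<and> (\<forall>j<m. v j = 0) \<and> (\<exists>d q. (1 / C)\<^sup>2 \<le> q \<and> q \<le> (1 / c)\<^sup>2 \<and>
    0 \<le> \<sigma> * ((\<Sum>i<k. (d i)\<^sup>2) - (1 / p\<^sup>2 + t\<^sup>2 * q)) \<and>
    \<bar>N (u + scale_seq (of_real t) v) - N (comb k x d)\<bar> \<le> \<epsilon>)"
proof -
  have x: "\<And>i. x i \<in> Y"
    and low: "\<And>a. c * sqrt (\<Sum>i<k. (a i)\<^sup>2) \<le> N (comb k x a)"
    and up: "\<And>a. N (comb k x a) \<le> C * sqrt (\<Sum>i<k. (a i)\<^sup>2)"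
    using sys unfolding euclidean_system_def by blast+
  have cY: "comb k x a \<in> Y" for a by (rule comb_in) (rule x)
  have p: "c \<le> p" using low[of a0] a0 by (simp add: p_def)
  define e where "e i = (1 / p) * a0 i" for i
  have e2: "(\<Sum>i<k. (e i)\<^sup>2) = 1 / p\<^sup>2"
    using a0 by (simp add: e_def power_divide flip: sum_divide_distrib)
  have Ne: "N (comb k x e) = 1"
    unfolding e_def comb_scale using N_scale[OF cY[of a0], of "of_real (1 / p)"] p c
    by (simp add: p_def[symmetric] norm_divide)
  have inj: "\<forall>a. (\<exists>i<k. a i \<noteq> 0) \<longrightarrow> N (comb k x a) \<noteq> 0"
  proof (intro allI impI)
    fix a :: "nat \<Rightarrow> real" assume nz: "\<exists>i<k. a i \<noteq> 0"
    obtain i where "i < k" "a i \<noteq> 0" using nz by blast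
    then have "0 < (\<Sum>i<k. (a i)\<^sup>2)" by (intro sum_pos2[of _ i]) auto
    then have "0 < c * sqrt (\<Sum>i<k. (a i)\<^sup>2)" using c by simp
    then show "N (comb k x a) \<noteq> 0" using low[of a] by linarith
  qed
  from move_euclidean[OF x k inj Ne u \<epsilon>]
  obtain z \<zeta> where *: "\<zeta> \<in> Y \<and> N \<zeta> = 1 \<and> (\<forall>j<m. \<zeta> j = 0) \<and> N (comb k x z) = 1 \<and>
    (\<forall>s. \<bar>N (u + scale_seq (of_real s) \<zeta>) - N (comb k x (\<lambda>i. e i + s * z i))\<bar> \<le> \<epsilon>)"
    by (elim exE) (rule that)
  note \<zeta> = *[THEN conjunct1] *[THEN conjunct2, THEN conjunct1]
    *[THEN conjunct2, THEN conjunct2, THEN conjunct1, rule_format]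
  note z = *[THEN conjunct2, THEN conjunct2, THEN conjunct2, THEN conjunct1]
  note near = *[THEN conjunct2, THEN conjunct2, THEN conjunct2, THEN conjunct2, THEN spec]
  define s where "s = (if 0 \<le> \<sigma> * (\<Sum>i<k. e i * z i) then t else - t)"
  have s: "0 \<le> s * (\<sigma> * (\<Sum>i<k. e i * z i))" "s\<^sup>2 = t\<^sup>2"
    using t by (auto simp: s_def zero_le_mult_iff mult_le_0_iff)
  define q where "q = (\<Sum>i<k. (z i)\<^sup>2)"
  have sq: "(sqrt q)\<^sup>2 = q" by (simp add: q_def sum_nonneg)
  \<comment> \<open>\<open>N\<close> of the combination \<open>z\<close> is 1, so its Euclidean
    length lies between \<open>1 / C\<close> and \<open>1 / c\<close>.\<close>
  have "1 / C \<le> sqrt q" using up[of z] z c c_le_C by (simp add: field_simps q_def)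
  then have "(1 / C)\<^sup>2 \<le> (sqrt q)\<^sup>2" using c c_le_C by (intro power_mono) auto
  moreover have "sqrt q \<le> 1 / c" using low[of z] z c by (simp add: field_simps q_def)
  then have "(sqrt q)\<^sup>2 \<le> (1 / c)\<^sup>2" by (intro power_mono) (auto simp: q_def sum_nonneg)
  moreover have "0 \<le> \<sigma> * ((\<Sum>i<k. (e i + s * z i)\<^sup>2) - (1 / p\<^sup>2 + t\<^sup>2 * q))"
    unfolding sum_square_expand s(2) e2 q_def using s(1) by (simp add: mult_ac)
  moreover define v where "v = scale_seq (of_real (s / t)) \<zeta>"
  have "scale_seq (of_real s) \<zeta> = scale_seq (of_real t) v"
    using t by (simp add: v_def seq.scale_scale)
  then have "\<bar>N (u + scale_seq (of_real t) v) - N (comb k x (\<lambda>i. e i + s * z i))\<bar> \<le> \<epsilon>"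
    using near[of s] by (simp only:)
  moreover have "N v = 1"
    using \<zeta> t unfolding v_def N_scale[OF \<zeta>(1)] norm_of_real by (simp add: s_def)
  moreover have "v \<in> Y" unfolding v_def by (intro Y_closed \<zeta>)
  moreover have "\<forall>j<m. v j = 0" using \<zeta>(3) by (simp add: v_def scale_seq_def)
  ultimately show ?thesis
    unfolding sq by (intro bexI[of _ v] conjI exI[of _ "\<lambda>i. e i + s * z i"] exI[of _ q])
qed

text \<open>Let \<mu> be the infimum of \<open>N\<close> on the Euclidean sphere and
  \<open>a0\<close> nearly optimal. The moved vector has Euclidean length at least
  \<open>sqrt (1 / p^2 + t^2 / C^2)\<close> with \<open>p\<close> close to \<mu>, and
  \<open>N\<close> is at least \<mu> times that; \<open>p \<ge> c\<close> bounds this below by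
  \<open>\<mu> / p\<close> times \<open>R\<close>.\<close>

lemma unit_step_lower:
  assumes u: "u \<in> Y" "N u = 1" and t: "0 < t" and \<rho>: "0 < \<rho>" "\<rho>\<^sup>2 < 1 + (c / C)\<^sup>2 * t\<^sup>2"
  shows "\<exists>z\<in>Y. N z = 1 \<and> (\<forall>j<m. z j = 0) \<and> \<rho> \<le> N (u + scale_seq (of_real t) z)"
proof -
  define R where "R = sqrt (1 + (c / C)\<^sup>2 * t\<^sup>2)"
  have R: "\<rho> < R" unfolding R_def using \<rho> by (intro real_less_rsqrt)
  obtain k x where k: "m * DIM('k) < k" and sys: "euclidean_system k x"
    using ex_euclidean_system by blast
  have low: "\<And>a. c * sqrt (\<Sum>i<k. (a i)\<^sup>2) \<le> N (comb k x a)"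
    and hom: "\<And>a. N (comb k x a) = sqrt (\<Sum>i<k. (a i)\<^sup>2) * N (comb k x (\<lambda>i. a i / sqrt (\<Sum>i<k. (a i)\<^sup>2)))"
    using sys unfolding euclidean_system_def by blast+
  define P where "P = (\<lambda>a. N (comb k x a)) ` {a. (\<Sum>i<k. (a i)\<^sup>2) = 1}"
  define \<mu> where "\<mu> = Inf P"
  have "(\<lambda>i. if i = 0 then 1 else 0) \<in> {a. (\<Sum>i<k. (a i)\<^sup>2) = (1::real)}"
    using k by (simp add: if_distrib[of "\<lambda>x. x\<^sup>2"] cong: if_cong)
  then have "N (comb k x (\<lambda>i. if i = 0 then 1 else 0)) \<in> P" unfolding P_def by (rule imageI)
  then have P0: "P \<noteq> {}" by blast
  have P: "P \<noteq> {}" "\<And>p. p \<in> P \<Longrightarrow> c \<le> p"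
  proof (rule P0)
    show "c \<le> p" if p: "p \<in> P" for p
    proof -
      obtain a where "(\<Sum>i<k. (a i)\<^sup>2) = 1" "p = N (comb k x a)" using p by (auto simp: P_def)
      then show ?thesis using low[of a] by simp
    qed
  qed
  have \<mu>c: "c \<le> \<mu>" unfolding \<mu>_def using P by (intro cInf_greatest)
  have \<mu>: "\<mu> * sqrt (\<Sum>i<k. (a i)\<^sup>2) \<le> N (comb k x a)" for a
  proof (cases "(\<Sum>i<k. (a i)\<^sup>2) = 0")
    case False
    then have "\<mu> \<le> N (comb k x (\<lambda>i. a i / sqrt (\<Sum>i<k. (a i)\<^sup>2)))"
      unfolding \<mu>_def using P(2) unit_coefficients[OF False] by (intro cInf_lower bdd_belowI[of _ c]) (auto simp: P_def)
    then have "sqrt (\<Sum>i<k. (a i)\<^sup>2) * \<mu> \<le> sqrt (\<Sum>i<k. (a i)\<^sup>2) * N (comb k x (\<lambda>i. a i / sqrt (\<Sum>i<k. (a i)\<^sup>2)))"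
      by (intro mult_left_mono) (auto simp: sum_nonneg)
    then show ?thesis unfolding hom[of a, symmetric] by (simp add: mult.commute)
  qed (use low[of a] in simp)
  \<comment> \<open>The gap \<open>R - \<rho>\<close> is shared: missing the infimum by the factor
    \<open>h\<close> leaves \<open>(R + \<rho>) / 2\<close>, and the approximation of
    \<open>u\<close> may cost the remaining \<open>(R - \<rho>) / 2\<close>.\<close>
  define h where "h = 2 * R / (R + \<rho>)"
  have h: "h > 1" using R \<rho> by (simp add: h_def)
  have "\<mu> < \<mu> * h" using \<mu>c c h by simp
  then obtain a0 where a0: "(\<Sum>i<k. (a0 i)\<^sup>2) = 1" "N (comb k x a0) < \<mu> * h"
    using cInf_lessD[OF P(1)] unfolding \<mu>_def P_def by blast
  define p where "p = N (comb k x a0)"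
  have p: "c \<le> p" "p \<le> \<mu> * h" using low[of a0] a0 by (auto simp: p_def)
  have "0 < (R - \<rho>) / 2" using R by simp
  from extremal_step[OF sys k u t this a0(1), of 1, folded p_def]
  obtain v d q where v: "v \<in> Y" "N v = 1" "\<forall>j<m. v j = 0" and q: "(1 / C)\<^sup>2 \<le> q"
    and d: "1 / p\<^sup>2 + t\<^sup>2 * q \<le> (\<Sum>i<k. (d i)\<^sup>2)"
    and near: "\<bar>N (u + scale_seq (of_real t) v) - N (comb k x d)\<bar> \<le> (R - \<rho>) / 2"
    by auto
  have "(R / p)\<^sup>2 = 1 / p\<^sup>2 + (c / C)\<^sup>2 * t\<^sup>2 / p\<^sup>2"
    unfolding R_def power_divide[of _ p] by (simp add: add_divide_distrib add_nonneg_nonneg)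
  also have "\<dots> \<le> 1 / p\<^sup>2 + t\<^sup>2 * (1 / C)\<^sup>2"
  proof -
    have "(c / p)\<^sup>2 \<le> 1" using p c by (simp add: power_le_one_iff)
    then have "t\<^sup>2 * (1 / C)\<^sup>2 * (c / p)\<^sup>2 \<le> t\<^sup>2 * (1 / C)\<^sup>2" by (intro mult_left_le) auto
    then show ?thesis by (simp add: power_divide mult_ac)
  qed
  also have "\<dots> \<le> (\<Sum>i<k. (d i)\<^sup>2)"
    using q by (intro order_trans[OF _ d] add_left_mono mult_left_mono) auto
  finally have "R / p \<le> sqrt (\<Sum>i<k. (d i)\<^sup>2)" by (rule real_le_rsqrt)
  then have "\<mu> * (R / p) \<le> N (comb k x d)"
    using \<mu>c c by (intro order_trans[OF _ \<mu>] mult_left_mono) auto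
  moreover have "(R + \<rho>) / 2 \<le> \<mu> * (R / p)"
  proof -
    have "(R + \<rho>) / 2 * p \<le> (R + \<rho>) / 2 * (\<mu> * h)" using p R \<rho> by (intro mult_left_mono) auto
    also have "\<dots> = \<mu> * R" using R \<rho> by (simp add: h_def field_simps)
    finally show ?thesis using p c by (simp add: field_simps)
  qed
  ultimately have "(R + \<rho>) / 2 \<le> N (comb k x d)" by (rule order_trans[rotated])
  with near have "\<rho> \<le> N (u + scale_seq (of_real t) v)"
    unfolding abs_le_iff diff_divide_distrib add_divide_distrib by linarith
  then show ?thesis using v by blast
qed

text \<open>The mirror image at the supremum \<nu> of \<open>N\<close> on the Euclidean sphere: the
  cross term is now made nonpositive, and \<open>p \<le> C\<close> takes the place of
  \<open>p \<ge> c\<close>.\<close>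

lemma unit_step_upper:
  assumes u: "u \<in> Y" "N u = 1" and t: "0 < t" and \<rho>: "0 < \<rho>" "1 + (C / c)\<^sup>2 * t\<^sup>2 < \<rho>\<^sup>2"
  shows "\<exists>z\<in>Y. N z = 1 \<and> (\<forall>j<m. z j = 0) \<and> N (u + scale_seq (of_real t) z) \<le> \<rho>"
proof -
  define R where "R = sqrt (1 + (C / c)\<^sup>2 * t\<^sup>2)"
  have R: "R < \<rho>" unfolding R_def using \<rho> by (intro real_less_lsqrt) auto
  have R0: "R > 0" unfolding R_def by (simp add: add_pos_nonneg)
  obtain k x where k: "m * DIM('k) < k" and sys: "euclidean_system k x"
    using ex_euclidean_system by blast
  have low: "\<And>a. c * sqrt (\<Sum>i<k. (a i)\<^sup>2) \<le> N (comb k x a)"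
    and up: "\<And>a. N (comb k x a) \<le> C * sqrt (\<Sum>i<k. (a i)\<^sup>2)"
    and hom: "\<And>a. N (comb k x a) = sqrt (\<Sum>i<k. (a i)\<^sup>2) * N (comb k x (\<lambda>i. a i / sqrt (\<Sum>i<k. (a i)\<^sup>2)))"
    using sys unfolding euclidean_system_def by blast+
  define P where "P = (\<lambda>a. N (comb k x a)) ` {a. (\<Sum>i<k. (a i)\<^sup>2) = 1}"
  define \<nu> where "\<nu> = Sup P"
  have "(\<lambda>i. if i = 0 then 1 else 0) \<in> {a. (\<Sum>i<k. (a i)\<^sup>2) = (1::real)}"
    using k by (simp add: if_distrib[of "\<lambda>x. x\<^sup>2"] cong: if_cong)
  then have p0: "N (comb k x (\<lambda>i. if i = 0 then 1 else 0)) \<in> P" unfolding P_def by (rule imageI)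
  have P: "c \<le> p \<and> p \<le> C" if p: "p \<in> P" for p
  proof -
    obtain a where a: "(\<Sum>i<k. (a i)\<^sup>2) = 1" "p = N (comb k x a)" using p by (auto simp: P_def)
    then show ?thesis using low[of a] up[of a] by simp
  qed
  have bdd: "bdd_above P" using P by (intro bdd_aboveI[of _ C]) auto
  have \<nu>c: "c \<le> \<nu>" unfolding \<nu>_def using P[OF p0] cSup_upper[OF p0 bdd] by linarith
  have \<nu>: "N (comb k x a) \<le> \<nu> * sqrt (\<Sum>i<k. (a i)\<^sup>2)" for a
  proof (cases "(\<Sum>i<k. (a i)\<^sup>2) = 0")
    case False
    then have "N (comb k x (\<lambda>i. a i / sqrt (\<Sum>i<k. (a i)\<^sup>2))) \<le> \<nu>"
      unfolding \<nu>_def using unit_coefficients[OF False] bdd by (intro cSup_upper) (auto simp: P_def)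
    then have "sqrt (\<Sum>i<k. (a i)\<^sup>2) * N (comb k x (\<lambda>i. a i / sqrt (\<Sum>i<k. (a i)\<^sup>2))) \<le> sqrt (\<Sum>i<k. (a i)\<^sup>2) * \<nu>"
      by (intro mult_left_mono) (auto simp: sum_nonneg)
    then show ?thesis unfolding hom[of a, symmetric] by (simp add: mult.commute)
  qed (use up[of a] in simp)
  define h where "h = (R + \<rho>) / (2 * R)"
  have h: "h > 1" using R R0 by (simp add: h_def)
  have "\<nu> / h < \<nu>" using \<nu>c c h by (simp add: divide_less_eq)
  then obtain a0 where a0: "(\<Sum>i<k. (a0 i)\<^sup>2) = 1" "\<nu> / h < N (comb k x a0)"
    using less_cSupD[of P] p0 unfolding \<nu>_def P_def by blast
  define p where "p = N (comb k x a0)"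
  have p: "c \<le> p" "\<nu> \<le> p * h" "p \<le> C"
    using low[of a0] up[of a0] a0 h by (auto simp: p_def field_simps)
  have "0 < (\<rho> - R) / 2" using R by simp
  from extremal_step[OF sys k u t this a0(1), of "- 1", folded p_def]
  obtain v d q where v: "v \<in> Y" "N v = 1" "\<forall>j<m. v j = 0" and q: "q \<le> (1 / c)\<^sup>2"
    and d: "(\<Sum>i<k. (d i)\<^sup>2) \<le> 1 / p\<^sup>2 + t\<^sup>2 * q"
    and near: "\<bar>N (u + scale_seq (of_real t) v) - N (comb k x d)\<bar> \<le> (\<rho> - R) / 2"
    by auto
  have "(\<Sum>i<k. (d i)\<^sup>2) \<le> 1 / p\<^sup>2 + t\<^sup>2 * (1 / c)\<^sup>2"
    using q by (intro order_trans[OF d] add_left_mono mult_left_mono) auto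
  also have "\<dots> \<le> 1 / p\<^sup>2 + (C / c)\<^sup>2 * t\<^sup>2 / p\<^sup>2"
  proof -
    have "1 \<le> (C / p)\<^sup>2" using p c by (intro one_le_power) simp
    then have "t\<^sup>2 * (1 / c)\<^sup>2 * 1 \<le> t\<^sup>2 * (1 / c)\<^sup>2 * (C / p)\<^sup>2" by (intro mult_left_mono) auto
    then show ?thesis by (simp add: power_divide mult_ac)
  qed
  also have "\<dots> = (R / p)\<^sup>2"
    unfolding R_def power_divide[of _ p] by (simp add: add_divide_distrib add_nonneg_nonneg)
  finally have "sqrt (\<Sum>i<k. (d i)\<^sup>2) \<le> R / p" using R0 p c by (intro real_le_lsqrt) auto
  then have "N (comb k x d) \<le> \<nu> * (R / p)"
    using \<nu>c c by (intro order_trans[OF \<nu>] mult_left_mono) auto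
  moreover have "\<nu> * (R / p) \<le> (R + \<rho>) / 2"
  proof -
    have "\<nu> * R \<le> p * h * R" using p R0 by (intro mult_right_mono) auto
    also have "\<dots> = p * ((R + \<rho>) / 2)" using R0 by (simp add: h_def field_simps)
    finally show ?thesis using p c by (simp add: field_simps)
  qed
  ultimately have "N (comb k x d) \<le> (R + \<rho>) / 2" by (rule order_trans)
  with near have "N (u + scale_seq (of_real t) v) \<le> \<rho>"
    unfolding abs_le_iff diff_divide_distrib add_divide_distrib by linarith
  then show ?thesis using v by blast
qed

end

context euclidean_transitive_space
begin

lemma ex_unit_vanishing: "\<exists>z\<in>Y. N z = 1 \<and> (\<forall>j<m. z j = 0)"
proof -
  obtain y where y: "y \<in> Y" "y \<noteq> 0" "\<forall>j<m. y j = 0"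
    using nth_subset_vanishing[OF subspace infinite] by blast
  define z where "z = scale_seq (of_real (1 / N y)) y"
  have "N z = 1"
    unfolding z_def N_scale[OF y(1)] norm_of_real using N_pos[OF y(1,2)] by simp
  moreover have "z \<in> Y" unfolding z_def by (intro Y_closed y)
  moreover have "\<forall>j<m. z j = 0" using y(3) by (simp add: z_def scale_seq_def)
  ultimately show ?thesis by blast
qed

lemma rescale_step:
  assumes u: "u \<in> Y" "u \<noteq> 0" and z: "z \<in> Y"
  shows "N (u + scale_seq (of_real t) z) =
    N u * N (scale_seq (of_real (1 / N u)) u + scale_seq (of_real (t / N u)) z)"
proof -
  have Nu: "N u > 0" by (rule N_pos[OF u])
  have eq: "u + scale_seq (of_real t) z =
      scale_seq (of_real (N u)) (scale_seq (of_real (1 / N u)) u + scale_seq (of_real (t / N u)) z)"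
    using Nu by (simp add: fun_eq_iff scale_seq_def field_simps)
  have "N (u + scale_seq (of_real t) z) = N (scale_seq (of_real (N u))
      (scale_seq (of_real (1 / N u)) u + scale_seq (of_real (t / N u)) z))"
    by (rule arg_cong[where f = N, OF eq])
  also have "\<dots> = norm (of_real (N u) :: 'k) *
      N (scale_seq (of_real (1 / N u)) u + scale_seq (of_real (t / N u)) z)"
    by (intro N_scale Y_closed u z)
  finally show ?thesis using Nu by simp
qed

text \<open>Rescaling to the sphere replaces \<open>t\<close> by \<open>t / N u\<close>, and
  squaring makes the gain \<kappa>\<open>t^2\<close> independent of \<open>u\<close>, so that gains
  add up along an iteration. Half of \<open>(c / C)^2\<close> is given away for the strict
  inequality of the unit case.\<close>

lemma step_lower:
  assumes u: "u \<in> Y" and t: "0 < t"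
  shows "\<exists>z\<in>Y. N z = 1 \<and> (\<forall>j<m. z j = 0) \<and>
    (N u)\<^sup>2 + (c / C)\<^sup>2 / 2 * t\<^sup>2 \<le> (N (u + scale_seq (of_real t) z))\<^sup>2"
proof (cases "u = 0")
  case True
  \<comment> \<open>The iteration starts at 0, where there is nothing to normalise; any unit vector
    far out gains the full \<open>t^2\<close>.\<close>
  obtain z where z: "z \<in> Y" "N z = 1" "\<forall>j<m. z j = 0" using ex_unit_vanishing by blast
  have "N (u + scale_seq (of_real t) z) = t"
    using True N_scale[OF z(1), of "of_real t"] z(2) t by simp
  moreover have "(c / C)\<^sup>2 \<le> 1" using c c_le_C by (intro power_le_one) auto
  then have "(c / C)\<^sup>2 / 2 * t\<^sup>2 \<le> 1 * t\<^sup>2" by (intro mult_right_mono) auto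
  moreover have "N u = 0" using True u N_zero_iff by blast
  ultimately show ?thesis using z by (intro bexI[of _ z]) auto
next
  case False
  define \<kappa> where "\<kappa> = (c / C)\<^sup>2 / 2"
  have \<kappa>: "0 < \<kappa>" "(c / C)\<^sup>2 = 2 * \<kappa>" using c c_le_C by (auto simp: \<kappa>_def)
  have Nu: "N u > 0" by (rule N_pos[OF u False])
  define v where "v = scale_seq (of_real (1 / N u)) u"
  define \<tau> where "\<tau> = t / N u"
  have \<tau>: "0 < \<tau>" using t Nu by (simp add: \<tau>_def)
  have v: "v \<in> Y" unfolding v_def by (intro Y_closed u)
  have Nv: "N v = 1" unfolding v_def N_scale[OF u] norm_of_real using Nu by simp
  have pos: "0 < \<kappa> * \<tau>\<^sup>2" using \<kappa> \<tau> by simp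
  define \<rho> where "\<rho> = sqrt (1 + \<kappa> * \<tau>\<^sup>2)"
  have \<rho>: "0 < \<rho>" "\<rho>\<^sup>2 = 1 + \<kappa> * \<tau>\<^sup>2" using pos by (auto simp: \<rho>_def)
  have "\<rho>\<^sup>2 < 1 + (c / C)\<^sup>2 * \<tau>\<^sup>2" unfolding \<rho>(2) \<kappa>(2) using pos by simp
  from unit_step_lower[OF v Nv \<tau> \<rho>(1) this] obtain z where
    z: "z \<in> Y" "N z = 1" "\<forall>j<m. z j = 0" "\<rho> \<le> N (v + scale_seq (of_real \<tau>) z)" by blast
  have "(N u)\<^sup>2 + \<kappa> * t\<^sup>2 = (N u * \<rho>)\<^sup>2"
    unfolding power_mult_distrib \<rho>(2) \<tau>_def using Nu by (simp add: field_simps)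
  also have "\<dots> \<le> (N u * N (v + scale_seq (of_real \<tau>) z))\<^sup>2"
    using z(4) Nu \<rho>(1) by (intro power_mono mult_left_mono) auto
  also have "\<dots> = (N (u + scale_seq (of_real t) z))\<^sup>2"
    unfolding rescale_step[OF u False z(1)] v_def \<tau>_def ..
  finally show ?thesis using z unfolding \<kappa>_def by blast
qed

lemma step_upper:
  assumes u: "u \<in> Y" and t: "0 < t"
  shows "\<exists>z\<in>Y. N z = 1 \<and> (\<forall>j<m. z j = 0) \<and>
    (N (u + scale_seq (of_real t) z))\<^sup>2 \<le> (N u)\<^sup>2 + 2 * (C / c)\<^sup>2 * t\<^sup>2"
proof (cases "u = 0")
  case True
  obtain z where z: "z \<in> Y" "N z = 1" "\<forall>j<m. z j = 0" using ex_unit_vanishing by blast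
  have "N (u + scale_seq (of_real t) z) = t"
    using True N_scale[OF z(1), of "of_real t"] z(2) t by simp
  moreover have "1 \<le> (C / c)\<^sup>2" using c c_le_C by (intro one_le_power) auto
  then have "1 * t\<^sup>2 \<le> 2 * (C / c)\<^sup>2 * t\<^sup>2" by (intro mult_right_mono) auto
  moreover have "N u = 0" using True u N_zero_iff by blast
  ultimately show ?thesis using z by (intro bexI[of _ z]) auto
next
  case False
  define \<kappa> where "\<kappa> = (C / c)\<^sup>2"
  have \<kappa>: "0 < \<kappa>" using c c_le_C by (auto simp: \<kappa>_def)
  have Nu: "N u > 0" by (rule N_pos[OF u False])
  define v where "v = scale_seq (of_real (1 / N u)) u"
  define \<tau> where "\<tau> = t / N u"
  have \<tau>: "0 < \<tau>" using t Nu by (simp add: \<tau>_def)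
  have v: "v \<in> Y" unfolding v_def by (intro Y_closed u)
  have Nv: "N v = 1" unfolding v_def N_scale[OF u] norm_of_real using Nu by simp
  have pos: "0 < \<kappa> * \<tau>\<^sup>2" using \<kappa> \<tau> by simp
  define \<rho> where "\<rho> = sqrt (1 + 2 * \<kappa> * \<tau>\<^sup>2)"
  have \<rho>: "0 < \<rho>" "\<rho>\<^sup>2 = 1 + 2 * \<kappa> * \<tau>\<^sup>2" using pos by (auto simp: \<rho>_def)
  have "1 + (C / c)\<^sup>2 * \<tau>\<^sup>2 < \<rho>\<^sup>2" unfolding \<rho>(2) \<kappa>_def[symmetric] using pos by simp
  from unit_step_upper[OF v Nv \<tau> \<rho>(1) this] obtain z where
    z: "z \<in> Y" "N z = 1" "\<forall>j<m. z j = 0" "N (v + scale_seq (of_real \<tau>) z) \<le> \<rho>" by blast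
  have "(N (u + scale_seq (of_real t) z))\<^sup>2 = (N u * N (v + scale_seq (of_real \<tau>) z))\<^sup>2"
    unfolding rescale_step[OF u False z(1)] v_def \<tau>_def ..
  also have "\<dots> \<le> (N u * \<rho>)\<^sup>2"
    using z(4) Nu by (intro power_mono mult_left_mono mult_nonneg_nonneg N_nonneg Y_closed v z u; simp)
  also have "\<dots> = (N u)\<^sup>2 + 2 * \<kappa> * t\<^sup>2"
    unfolding power_mult_distrib \<rho>(2) \<tau>_def using Nu by (simp add: field_simps)
  finally show ?thesis using z unfolding \<kappa>_def by blast
qed

end

section \<open>Iterated steps and the behaviour of \<open>M\<close> near 0\<close>

locale renormed_subspace = orlicz_delta2 M D + euclidean_transitive_space Y N c C k0
  for M D and Y :: "(nat \<Rightarrow> 'k::{real_normed_field,euclidean_space}) set" and N c C k0 +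
  fixes c1 C1 :: real
  assumes Y_subset: "Y \<subseteq> orlicz_space M" and c1: "0 < c1" and C1: "0 < C1"
    and equiv_low: "\<And>x. x \<in> Y \<Longrightarrow> c1 * orlicz_norm M x \<le> N x"
    and equiv_up: "\<And>x. x \<in> Y \<Longrightarrow> N x \<le> C1 * orlicz_norm M x"
begin

text \<open>\<open>R\<close> stands for either of the two quadratic step estimates. Each new vector
  starts after the current cut-off, and the next cut-off is put where its tail is small; so almost
  disjointness and the growth of \<open>N\<close> are secured together.\<close>

lemma iterate:
  assumes \<eta>: "\<eta> > 0"
    and step: "\<And>u m. u \<in> Y \<Longrightarrow> \<exists>z\<in>Y. N z = 1 \<and> (\<forall>j<m. z j = 0) \<and> R (N u) (N (u + scale_seq (of_real t) z))"
  obtains m z where "m 0 = 0" "\<And>l. m l \<le> m (Suc l)" "\<And>l. z l \<in> Y" "\<And>l. N (z l) = 1"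
    "\<And>l j. j < m l \<Longrightarrow> z l j = 0" "\<And>l. orlicz_norm M (restr {m (Suc l)..} (z l)) \<le> \<eta>"
    "\<And>l. R (N (\<Sum>i<l. scale_seq (of_real t) (z i))) (N (\<Sum>i<Suc l. scale_seq (of_real t) (z i)))"
proof -
  have "\<forall>u m. \<exists>z. u \<in> Y \<longrightarrow> z \<in> Y \<and> N z = 1 \<and> (\<forall>j<m. z j = 0) \<and> R (N u) (N (u + scale_seq (of_real t) z))"
    using step by meson
  then obtain Z where Z: "\<And>u m. u \<in> Y \<Longrightarrow> Z u m \<in> Y \<and> N (Z u m) = 1 \<and> (\<forall>j<m. Z u m j = 0) \<and>
      R (N u) (N (u + scale_seq (of_real t) (Z u m)))"
    by metis
  have "\<forall>z m. \<exists>n\<ge>m. z \<in> Y \<longrightarrow> orlicz_norm M (restr {n..} z) \<le> \<eta>"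
    using orlicz_tail[OF _ \<eta>] Y_subset by (meson max.cobounded1 max.cobounded2 subsetD)
  then obtain L where L: "\<And>z m. m \<le> L z m" "\<And>z m. z \<in> Y \<Longrightarrow> orlicz_norm M (restr {L z m..} z) \<le> \<eta>"
    by metis
  \<comment> \<open>The state consists of the current partial sum and the current cut-off, since the
    choice of the next vector depends on both.\<close>
  define st where "st l = ((\<lambda>p. (fst p + scale_seq (of_real t) (Z (fst p) (snd p)), L (Z (fst p) (snd p)) (snd p))) ^^ l) (0, 0)" for l
  define U where "U l = fst (st l)" for l
  define m where "m l = snd (st l)" for l
  define z where "z l = Z (U l) (m l)" for l
  have rec: "U 0 = 0" "m 0 = 0" "U (Suc l) = U l + scale_seq (of_real t) (z l)" "m (Suc l) = L (z l) (m l)" for l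
    by (simp_all add: U_def m_def z_def st_def)
  have UY: "U l \<in> Y" for l
  proof (induction l)
    case (Suc l)
    then have "z l \<in> Y" using Z unfolding z_def by blast
    then show ?case unfolding rec using Suc by (intro Y_closed)
  qed (simp only: rec Y_closed)
  have U: "U l = (\<Sum>i<l. scale_seq (of_real t) (z i))" for l
  proof (induction l)
    case (Suc l)
    show ?case unfolding rec sum.lessThan_Suc Suc ..
  qed (simp only: rec lessThan_0 sum.empty)
  show thesis
  proof (rule that[of m z])
    show "m 0 = 0" by (rule rec)
    fix l
    have zl: "z l \<in> Y \<and> N (z l) = 1 \<and> (\<forall>j<m l. z l j = 0) \<and> R (N (U l)) (N (U l + scale_seq (of_real t) (z l)))"
      using Z[OF UY] unfolding z_def .
    show "m l \<le> m (Suc l)" unfolding rec by (rule L)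
    show "z l \<in> Y" "N (z l) = 1" using zl by blast+
    show "z l j = 0" if "j < m l" for j using zl that by blast
    show "orlicz_norm M (restr {m (Suc l)..} (z l)) \<le> \<eta>" unfolding rec using zl L by blast
    show "R (N (\<Sum>i<l. scale_seq (of_real t) (z i))) (N (\<Sum>i<Suc l. scale_seq (of_real t) (z i)))"
      using zl unfolding U[symmetric] rec by blast
  qed
qed

lemma norm_block_approx:
  fixes n :: nat and t \<eta> :: real
  assumes m: "m 0 = 0" "\<And>l. m l \<le> m (Suc l)" and z: "\<And>l. z l \<in> Y" "\<And>l j. j < m l \<Longrightarrow> z l j = 0"
    "\<And>l. orlicz_norm M (restr {m (Suc l)..} (z l)) \<le> \<eta>" and t: "0 \<le> t"
  defines "U \<equiv> \<Sum>l<n. scale_seq (of_real t) (z l)"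
    and "V \<equiv> \<Sum>l<n. restr {m l..<m (Suc l)} (scale_seq (of_real t) (z l))"
  shows "U \<in> Y" "V \<in> orlicz_space M" "orlicz_norm M U \<le> orlicz_norm M V + n * t * \<eta>"
    "orlicz_norm M V \<le> orlicz_norm M U + n * t * \<eta>"
proof -
  show "U \<in> Y" unfolding U_def by (intro Y_closed z)
  have zX: "z l \<in> orlicz_space M" for l using z(1) Y_subset by blast
  note appr = block_decomposition[where m = m and u = z and g = "\<lambda>_. t" and G = t and n = n, OF m(2) zX z(2,3),
      folded U_def V_def]
  show "V \<in> orlicz_space M" "orlicz_norm M U \<le> orlicz_norm M V + n * t * \<eta>"
    "orlicz_norm M V \<le> orlicz_norm M U + n * t * \<eta>"
    using appr t by (simp_all add: mult.assoc)
qed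

lemma modular_block_sum:
  fixes z :: "nat \<Rightarrow> nat \<Rightarrow> 'k"
  assumes m: "m 0 = 0" "\<And>l. m l \<le> m (Suc l)" and s: "s > 0"
  shows "modular_le M s q (\<Sum>l<n. restr {m l..<m (Suc l)} (scale_seq (of_real (1 / 2 ^ r)) (z l))) \<longleftrightarrow>
    (\<Sum>l<n. \<Sum>j\<in>{m l..<m (Suc l)}. M (norm (z l j) / s / 2 ^ r)) \<le> q"
  using modular_blocks[where m = m and s = s and r = q and K = n
      and h = "\<lambda>l. scale_seq (of_real (1 / 2 ^ r)) (z l)"] m s
  by (simp add: scale_seq_def norm_mult norm_divide norm_power mult.commute)

text \<open>If \<open>4 ^ r * M (t / 2 ^ r)\<close> were uniformly tiny against \<open>M t\<close>,
  then \<open>4 ^ r\<close> steps of length \<open>2 ^ -r\<close>, along vectors of modular at most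
  1 at scale \<open>1 / c1\<close>, would sum to tiny modular and by doubling to small norm. The
  lower step estimate keeps \<open>N\<close> of this sum at least
  \<open>sqrt \<kappa>\<close>.\<close>

lemma quadratic_lower_bound: "\<exists>\<epsilon>>0. \<forall>r. \<exists>t>0. t \<le> b \<and> \<epsilon> * M t \<le> 4 ^ r * M (t / 2 ^ r)"
proof (rule ccontr)
  assume neg: "\<not> ?thesis"
  define \<kappa> where "\<kappa> = (c / C)\<^sup>2 / 2"
  have \<kappa>: "0 < \<kappa>" using c c_le_C by (auto simp: \<kappa>_def)
  define s where "s = 1 / c1"
  have s: "s > 0" using c1 by (simp add: s_def)
  \<comment> \<open>Makes the norm bound \<open>s / 2 ^ i\<close> contribute less than a quarter of
    \<open>sqrt \<kappa>\<close>; another quarter is left to the tails through the choice of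
    \<eta>.\<close>
  obtain i where i: "2 ^ i > 4 * C1 * s / sqrt \<kappa>" using unbounded_power2 by blast
  have "0 < 1 / D ^ i" using D_ge_1 by simp
  with neg obtain r where r: "\<And>t. 0 < t \<Longrightarrow> t \<le> b \<Longrightarrow> 4 ^ r * M (t / 2 ^ r) < 1 / D ^ i * M t"
    by (meson not_le)
  define \<theta> :: real where "\<theta> = 1 / 2 ^ r"
  have \<theta>: "0 < \<theta>" "\<theta>\<^sup>2 = 1 / 4 ^ r" unfolding \<theta>_def dyadic_square by (auto simp: power_one_over)
  define n :: nat where "n = 4 ^ r"
  define \<eta> where "\<eta> = sqrt \<kappa> / (4 * C1 * (n * \<theta>))"
  have n\<theta>: "0 < n * \<theta>" using \<theta> by (simp add: n_def)
  have \<eta>: "0 < \<eta>" unfolding \<eta>_def using \<kappa> C1 \<theta> by (intro divide_pos_pos mult_pos_pos) (auto simp: n_def)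
  obtain m z where m: "m 0 = 0" "\<And>l. m l \<le> m (Suc l)" and z: "\<And>l. z l \<in> Y" "\<And>l. N (z l) = 1"
    "\<And>l j. j < m l \<Longrightarrow> z l j = 0" "\<And>l. orlicz_norm M (restr {m (Suc l)..} (z l)) \<le> \<eta>"
    and grow: "\<And>l. (N (\<Sum>i<l. scale_seq (of_real \<theta>) (z i)))\<^sup>2 + \<kappa> * \<theta>\<^sup>2 \<le>
      (N (\<Sum>i<Suc l. scale_seq (of_real \<theta>) (z i)))\<^sup>2"
    using iterate[OF \<eta>, of "\<lambda>p q. p\<^sup>2 + \<kappa> * \<theta>\<^sup>2 \<le> q\<^sup>2" \<theta>] step_lower[OF _ \<theta>(1)] unfolding \<kappa>_def by blast
  define U where "U l = (\<Sum>i<l. scale_seq (of_real \<theta>) (z i))" for l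
  define V where "V = (\<Sum>l<n. restr {m l..<m (Suc l)} (scale_seq (of_real \<theta>) (z l)))"
  have "l * (\<kappa> * \<theta>\<^sup>2) \<le> (N (U l))\<^sup>2" for l
  proof (induction l)
    case (Suc l)
    then show ?case using grow[of l] unfolding U_def[symmetric] by (simp add: algebra_simps)
  qed simp
  from this[of n] have "\<kappa> \<le> (N (U n))\<^sup>2" by (simp add: n_def \<theta>(2))
  then have low: "sqrt \<kappa> \<le> N (U n)"
    using norm_block_approx(1)[OF m z(1,3,4) less_imp_le[OF \<theta>(1)], of n] N_nonneg
    unfolding U_def[symmetric] by (simp add: real_le_lsqrt)
  have zX: "z l \<in> orlicz_space M" for l using z(1) Y_subset by blast
  have z1: "modular_le M s 1 (z l)" for l
    using equiv_low[OF z(1)[of l]] z(2)[of l] c1 s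
    by (intro modular_le_norm zX) (auto simp: s_def field_simps)
  have "modular_le M s (1 / D ^ i) V"
    unfolding V_def \<theta>_def modular_block_sum[OF m s]
  proof -
    have "(\<Sum>l<n. \<Sum>j\<in>{m l..<m (Suc l)}. M (norm (z l j) / s / 2 ^ r))
        \<le> (\<Sum>l<n. \<Sum>j\<in>{m l..<m (Suc l)}. 1 / D ^ i / 4 ^ r * M (norm (z l j) / s))"
    proof (intro sum_mono)
      fix l j
      show "M (norm (z l j) / s / 2 ^ r) \<le> 1 / D ^ i / 4 ^ r * M (norm (z l j) / s)"
      proof (cases "z l j = 0")
        case False
        then have "4 ^ r * M (norm (z l j) / s / 2 ^ r) < 1 / D ^ i * M (norm (z l j) / s)"
          using s modular_le_coord[OF z1 s] by (intro r) auto
        then show ?thesis using D_ge_1 by (simp add: field_simps)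
      qed simp
    qed
    also have "\<dots> = 1 / D ^ i / 4 ^ r * (\<Sum>l<n. \<Sum>j\<in>{m l..<m (Suc l)}. M (norm (z l j) / s))"
      by (simp add: sum_distrib_left)
    also have "\<dots> \<le> 1 / D ^ i / 4 ^ r * (\<Sum>l<n. 1)"
      using D_ge_1 by (intro mult_left_mono sum_mono modular_le_finite[OF z1 s]) auto
    also have "\<dots> = 1 / D ^ i" by (simp add: n_def)
    finally show "(\<Sum>l<n. \<Sum>j\<in>{m l..<m (Suc l)}. M (norm (z l j) / s / 2 ^ r)) \<le> 1 / D ^ i" .
  qed
  then have "modular_le M (s / 2 ^ i) (D ^ i * (1 / D ^ i)) V"
    using s D_ge_1 by (intro modular_le_doubling) auto
  then have V: "orlicz_norm M V \<le> s / 2 ^ i"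
    using s D_ge_1 by (intro orlicz_norm_le) auto
  note appr = norm_block_approx[OF m z(1,3,4) less_imp_le[OF \<theta>(1)], of n, folded V_def, folded U_def]
  have "sqrt \<kappa> \<le> C1 * orlicz_norm M (U n)" using low equiv_up[OF appr(1)] by linarith
  also have "\<dots> \<le> C1 * (s / 2 ^ i + n * \<theta> * \<eta>)" using appr(3) V C1 by (intro mult_left_mono) auto
  also have "\<dots> = C1 * s / 2 ^ i + sqrt \<kappa> / 4"
    using \<theta>(1) C1 unfolding distrib_left by (simp add: \<eta>_def field_simps n_def)
  also have "C1 * s / 2 ^ i < sqrt \<kappa> / 4" using i \<kappa> by (simp add: field_simps)
  finally show False using \<kappa> real_sqrt_gt_zero[of \<kappa>] by linarith
qed

text \<open>The upper step estimate bounds the norm of the sum by a constant \<open>R\<close>, so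
  its modular at scale \<open>R\<close> is at most 1. Each of the \<open>4 ^ r\<close> unscaled
  blocks has modular at least \<open>1 / D ^ i\<close> at that scale, and uniform growth with
  constant \<open>2 * D ^ i\<close> would push the total to 2.\<close>

lemma quadratic_upper_bound: "\<exists>K. \<forall>r. \<exists>t>0. t \<le> b \<and> 4 ^ r * M (t / 2 ^ r) \<le> K * M t"
proof (rule ccontr)
  assume neg: "\<not> ?thesis"
  define \<kappa> where "\<kappa> = 2 * (C / c)\<^sup>2"
  have \<kappa>: "0 < \<kappa>" using c c_le_C by (auto simp: \<kappa>_def)
  \<comment> \<open>The first entry bounds the norm of the sum, with 1 allowed for the tails. The
    second bounds the norms of the single vectors, so that their coordinates divided by
    \<open>R\<close> stay below \<open>b\<close>, where the negated claim applies.\<close>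
  define R where "R = max (sqrt \<kappa> / c1 + 1) (1 / c1)"
  have R: "R > 0" "sqrt \<kappa> / c1 + 1 \<le> R" "1 / c1 \<le> R" using c1 by (auto simp: R_def less_max_iff_disj)
  \<comment> \<open>Restriction to its block leaves each vector at least half of its norm
    \<open>1 / C1\<close>; this \<open>i\<close> puts \<open>R / 2 ^ i\<close> below that
    half.\<close>
  obtain i where i: "2 ^ i > 2 * C1 * R" using unbounded_power2 by blast
  obtain r where r: "\<And>t. 0 < t \<Longrightarrow> t \<le> b \<Longrightarrow> (2 * D ^ i) * M t < 4 ^ r * M (t / 2 ^ r)"
    using neg by (meson not_le)
  define \<theta> :: real where "\<theta> = 1 / 2 ^ r"
  have \<theta>: "0 < \<theta>" "\<theta>\<^sup>2 = 1 / 4 ^ r" unfolding \<theta>_def dyadic_square by (auto simp: power_one_over)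
  define n :: nat where "n = 4 ^ r"
  define \<eta> where "\<eta> = min (1 / (n * \<theta>)) (1 / (2 * C1))"
  have n\<theta>: "0 < n * \<theta>" using \<theta> by (simp add: n_def)
  have "0 < 1 / (n * \<theta>)" using n\<theta> by (intro divide_pos_pos) auto
  then have \<eta>: "0 < \<eta>" unfolding \<eta>_def using C1 by simp
  have "n * \<theta> * \<eta> \<le> n * \<theta> * (1 / (n * \<theta>))" using n\<theta> unfolding \<eta>_def by (intro mult_left_mono) auto
  then have n\<theta>\<eta>: "n * \<theta> * \<eta> \<le> 1" by (auto split: if_splits)
  obtain m z where m: "m 0 = 0" "\<And>l. m l \<le> m (Suc l)" and z: "\<And>l. z l \<in> Y" "\<And>l. N (z l) = 1"
    "\<And>l j. j < m l \<Longrightarrow> z l j = 0" "\<And>l. orlicz_norm M (restr {m (Suc l)..} (z l)) \<le> \<eta>"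
    and grow: "\<And>l. (N (\<Sum>i<Suc l. scale_seq (of_real \<theta>) (z i)))\<^sup>2 \<le>
      (N (\<Sum>i<l. scale_seq (of_real \<theta>) (z i)))\<^sup>2 + \<kappa> * \<theta>\<^sup>2"
    using iterate[OF \<eta>, of "\<lambda>p q. q\<^sup>2 \<le> p\<^sup>2 + \<kappa> * \<theta>\<^sup>2" \<theta>] step_upper[OF _ \<theta>(1)] unfolding \<kappa>_def by blast
  define U where "U l = (\<Sum>i<l. scale_seq (of_real \<theta>) (z i))" for l
  define V where "V = (\<Sum>l<n. restr {m l..<m (Suc l)} (scale_seq (of_real \<theta>) (z l)))"
  have N0: "N (U 0) = 0"
    using N_zero_iff[OF Y_closed(1)] unfolding U_def lessThan_0 sum.empty by blast
  have "(N (U l))\<^sup>2 \<le> l * (\<kappa> * \<theta>\<^sup>2)" for l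
  proof (induction l)
    case (Suc l)
    then show ?case using grow[of l] unfolding U_def[symmetric] by (simp add: algebra_simps)
  qed (simp add: N0)
  from this[of n] have "(N (U n))\<^sup>2 \<le> \<kappa>" by (simp add: n_def \<theta>(2))
  then have up: "N (U n) \<le> sqrt \<kappa>" by (rule real_le_rsqrt)
  note appr = norm_block_approx[OF m z(1,3,4) less_imp_le[OF \<theta>(1)], of n, folded V_def, folded U_def]
  have "c1 * orlicz_norm M (U n) \<le> sqrt \<kappa>" using up equiv_low[OF appr(1)] by linarith
  then have "orlicz_norm M (U n) \<le> sqrt \<kappa> / c1" using c1 by (simp add: field_simps)
  then have "orlicz_norm M V \<le> R" using appr(4) n\<theta>\<eta> R(2) by linarith
  then have "modular_le M R 1 V" using appr(2) R by (intro modular_le_norm)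
  then have sum: "(\<Sum>l<n. \<Sum>j\<in>{m l..<m (Suc l)}. M (norm (z l j) / R / 2 ^ r)) \<le> 1"
    unfolding V_def \<theta>_def modular_block_sum[OF m R(1)] .
  have zX: "z l \<in> orlicz_space M" for l using z(1) Y_subset by blast
  have zR: "modular_le M R 1 (z l)" for l
  proof (intro modular_le_norm zX R)
    have "orlicz_norm M (z l) \<le> 1 / c1"
      using equiv_low[OF z(1)[of l]] z(2)[of l] c1 by (simp add: field_simps)
    then show "orlicz_norm M (z l) \<le> R" using R by linarith
  qed
  have block: "1 / D ^ i \<le> (\<Sum>j\<in>{m l..<m (Suc l)}. M (norm (z l j) / R))" for l
  proof -
    define z' where "z' = restr {m l..<m (Suc l)} (z l)"
    have z'X: "z' \<in> orlicz_space M" unfolding z'_def by (rule restr_orlicz[OF zX])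
    have "z l = z' + restr {m (Suc l)..} (z l)"
      using restr_split[of "m l" "z l" "m (Suc l)"] z(3) m(2)[of l] by (simp add: max_def z'_def)
    then have "orlicz_norm M (z l) \<le> orlicz_norm M z' + orlicz_norm M (restr {m (Suc l)..} (z l))"
      using orlicz_norm_triangle[OF z'X restr_orlicz(1)[OF zX], of "{m (Suc l)..}" l] by simp
    moreover have "1 / C1 \<le> orlicz_norm M (z l)"
      using equiv_up[OF z(1)[of l]] z(2)[of l] C1 by (simp add: field_simps)
    moreover have "orlicz_norm M (restr {m (Suc l)..} (z l)) \<le> 1 / (2 * C1)"
      using z(4)[of l] by (simp add: \<eta>_def)
    moreover have "1 / C1 = 1 / (2 * C1) + 1 / (2 * C1)" using C1 by (simp add: field_simps)
    ultimately have "1 / (2 * C1) \<le> orlicz_norm M z'" by linarith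
    moreover have "R / 2 ^ i < 1 / (2 * C1)" using i C1 by (simp add: field_simps)
    ultimately have "R / 2 ^ i < orlicz_norm M z'" by linarith
    from modular_large[OF z'X R(1) this]
    obtain k where k: "1 / D ^ i < (\<Sum>j<k. M (norm (z' j) / R))" by blast
    have "(\<Sum>j<k. M (norm (z' j) / R)) \<le> (\<Sum>j<max k (m (Suc l)). M (norm (z' j) / R))"
      using R by (intro sum_mono2 M_nonneg) auto
    also have "\<dots> = (\<Sum>j\<in>{m l..<m (Suc l)}. M (norm (z l j) / R))"
      by (intro sum.mono_neutral_cong_right) (auto simp: z'_def restr_def)
    finally show ?thesis using k by simp
  qed
  have "2 = (\<Sum>l<n. 2 * D ^ i / 4 ^ r * (1 / D ^ i))" using D_ge_1 by (simp add: n_def)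
  also have "\<dots> \<le> (\<Sum>l<n. 2 * D ^ i / 4 ^ r * (\<Sum>j\<in>{m l..<m (Suc l)}. M (norm (z l j) / R)))"
    using block D_ge_1 by (intro sum_mono mult_left_mono) auto
  also have "\<dots> \<le> (\<Sum>l<n. \<Sum>j\<in>{m l..<m (Suc l)}. M (norm (z l j) / R / 2 ^ r))"
    unfolding sum_distrib_left
  proof (intro sum_mono)
    fix l j
    show "2 * D ^ i / 4 ^ r * M (norm (z l j) / R) \<le> M (norm (z l j) / R / 2 ^ r)"
    proof (cases "z l j = 0")
      case False
      then have "2 * D ^ i * M (norm (z l j) / R) < 4 ^ r * M (norm (z l j) / R / 2 ^ r)"
        using R(1) modular_le_coord[OF zR R(1)] by (intro r) auto
      then show ?thesis by (simp add: field_simps)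
    qed simp
  qed
  also have "\<dots> \<le> 1" by (rule sum)
  finally show False by simp
qed

lemma contains_ell2: "contains_ell2 TYPE('k) M"
proof -
  obtain \<epsilon> where \<epsilon>: "\<epsilon> > 0" "\<And>r. \<exists>t>0. t \<le> b \<and> \<epsilon> * M t \<le> 4 ^ r * M (t / 2 ^ r)"
    using quadratic_lower_bound by blast
  obtain K where K: "\<And>r. \<exists>t>0. t \<le> b \<and> 4 ^ r * M (t / 2 ^ r) \<le> K * M t"
    using quadratic_upper_bound by blast
  show ?thesis by (rule contains_ell2_criterion[OF \<epsilon> K])
qed

end

context orlicz_delta2
begin

text \<open>The Euclidean copies are found in the Orlicz norm; equivalence transfers them to
  \<open>N\<close> with constants multiplied by \<open>c1\<close> and \<open>C1\<close>, still
  independent of the dimension.\<close>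

lemma almost_transitive_contains_ell2:
  fixes Y :: "(nat \<Rightarrow> 'k::{real_normed_field,euclidean_space}) set"
  assumes Y: "Y \<subseteq> orlicz_space M" "seq.subspace Y" "infinite_dimensional Y"
    and N: "norm_on Y N" "equivalent_norms_on Y (orlicz_norm M) N" "almost_transitive Y N"
  shows "contains_ell2 TYPE('k) M"
proof -
  interpret almost_transitive_space Y N by unfold_locales (use Y N in auto)
  obtain c1 C1 where eq: "0 < c1" "0 < C1" "\<And>x. x \<in> Y \<Longrightarrow> c1 * orlicz_norm M x \<le> N x"
    "\<And>x. x \<in> Y \<Longrightarrow> N x \<le> C1 * orlicz_norm M x"
    using N(2) unfolding equivalent_norms_on_def by blast
  obtain c C and k0 :: nat where c: "0 < c" and sys: "\<forall>k\<ge>k0. \<exists>x. (\<forall>i. x i \<in> Y) \<and>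
    (\<forall>a. (\<Sum>i<k. (a i)\<^sup>2) = 1 \<longrightarrow> c \<le> orlicz_norm M (comb k x a) \<and> orlicz_norm M (comb k x a) \<le> C)"
    using euclidean_subspaces[OF Y] unfolding comb_def by blast
  interpret renormed_subspace M D Y N "c1 * c" "C1 * C" k0 c1 C1
  proof unfold_locales
    show "0 < c1 * c" using eq c by simp
    fix k assume "k0 \<le> k"
    with sys obtain x where x: "\<And>i. x i \<in> Y" "\<And>a. (\<Sum>i<k. (a i)\<^sup>2) = 1 \<Longrightarrow>
      c \<le> orlicz_norm M (comb k x a) \<and> orlicz_norm M (comb k x a) \<le> C" by blast
    have "c1 * c \<le> N (comb k x a) \<and> N (comb k x a) \<le> C1 * C" if "(\<Sum>i<k. (a i)\<^sup>2) = 1" for a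
    proof -
      have cY: "comb k x a \<in> Y" by (rule comb_in) (rule x)
      have "c1 * c \<le> c1 * orlicz_norm M (comb k x a)" "C1 * orlicz_norm M (comb k x a) \<le> C1 * C"
        using x(2)[OF that] eq(1,2) by (auto intro: mult_left_mono)
      then show ?thesis using eq(3)[OF cY] eq(4)[OF cY] by linarith
    qed
    then show "\<exists>x. (\<forall>i. x i \<in> Y) \<and> (\<forall>a. (\<Sum>i<k. (a i)\<^sup>2) = 1 \<longrightarrow>
        c1 * c \<le> N (comb k x a) \<and> N (comb k x a) \<le> C1 * C)" using x(1) by blast
  qed (use Y eq in auto)
  show ?thesis by (rule contains_ell2)
qed

end

section \<open>Transitivity of the Euclidean norm\<close>

text \<open>Abstracts the identity on the reals and conjugation on the complex numbers, so that one
  inner product serves both scalar fields.\<close>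

locale conjugation =
  fixes cj :: "'k::{real_normed_field,euclidean_space} \<Rightarrow> 'k"
  assumes linear: "bounded_linear cj" and cj_mult: "cj (x * y) = cj x * cj y"
    and cj_cj: "cj (cj x) = x" and cj_norm: "norm (cj x) = norm x"
    and mult_cj: "x * cj x = of_real ((norm x)\<^sup>2)"
begin

lemma cj_add: "cj (x + y) = cj x + cj y" and cj_diff: "cj (x - y) = cj x - cj y" and cj_0: "cj 0 = 0"
  using linear by (auto simp: linear_simps)

definition ip :: "(nat \<Rightarrow> 'k) \<Rightarrow> (nat \<Rightarrow> 'k) \<Rightarrow> 'k" where
  "ip x y = (\<Sum>j. x j * cj (y j))"

lemma ip_summable:
  assumes "x \<in> ell2" "y \<in> ell2"
  shows "summable (\<lambda>j. x j * cj (y j))"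
proof (rule summable_comparison_test)
  have "norm (x j * cj (y j)) \<le> (norm (x j))\<^sup>2 + (norm (y j))\<^sup>2" for j
  proof -
    have "norm (x j * cj (y j)) = norm (x j) * norm (y j)" by (simp add: norm_mult cj_norm)
    also have "\<dots> \<le> (norm (x j))\<^sup>2 + (norm (y j))\<^sup>2"
      using sum_squares_bound[of "norm (x j)" "norm (y j)"]
        mult_nonneg_nonneg[OF norm_ge_zero[of "x j"] norm_ge_zero[of "y j"]] by linarith
    finally show ?thesis .
  qed
  then show "\<exists>N. \<forall>j\<ge>N. norm (x j * cj (y j)) \<le> (norm (x j))\<^sup>2 + (norm (y j))\<^sup>2" by blast
  show "summable (\<lambda>j. (norm (x j))\<^sup>2 + (norm (y j))\<^sup>2)"
    using assms by (intro summable_add) (auto simp: ell2_def)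
qed

lemma ip_diff_left: "x \<in> ell2 \<Longrightarrow> y \<in> ell2 \<Longrightarrow> z \<in> ell2 \<Longrightarrow> ip (x - y) z = ip x z - ip y z"
  unfolding ip_def by (subst suminf_diff[OF ip_summable ip_summable]) (auto simp: left_diff_distrib)

lemma ip_add_left: "x \<in> ell2 \<Longrightarrow> y \<in> ell2 \<Longrightarrow> z \<in> ell2 \<Longrightarrow> ip (x + y) z = ip x z + ip y z"
  unfolding ip_def by (subst suminf_add[OF ip_summable ip_summable]) (auto simp: distrib_right)

lemma ip_scale_left: "x \<in> ell2 \<Longrightarrow> z \<in> ell2 \<Longrightarrow> ip (scale_seq c x) z = c * ip x z"
  unfolding ip_def scale_seq_def using suminf_mult[OF ip_summable, of x z c] by (simp add: mult.assoc)

lemma ip_commute: "x \<in> ell2 \<Longrightarrow> y \<in> ell2 \<Longrightarrow> ip y x = cj (ip x y)"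
  unfolding ip_def using bounded_linear.suminf[OF linear ip_summable, of x y]
  by (simp add: cj_mult cj_cj mult.commute)

lemma ip_self: "x \<in> ell2 \<Longrightarrow> ip x x = of_real ((ell2_norm x)\<^sup>2)"
  unfolding ip_def mult_cj ell2_norm_power2 by (rule suminf_of_real[symmetric]) (simp add: ell2_def)

text \<open>For unit vectors \<open>x \<noteq> y\<close> and \<open>w = x - y\<close>, the map \<open>z \<mapsto> z - (\<langle>z,w\<rangle>/\<langle>x,w\<rangle>) w\<close> sends \<open>x\<close> to \<open>y\<close>;
  it is unitary because \<open>\<langle>x,w\<rangle> + \<langle>w,x\<rangle> = \<langle>w,w\<rangle>\<close>. Unlike a reflection it needs no assumption that
  \<open>\<langle>x,y\<rangle>\<close> is real.\<close>

lemma ell2_transitive: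
  fixes x y :: "nat \<Rightarrow> 'k"
  assumes x: "x \<in> ell2" "ell2_norm x = 1" and y: "y \<in> ell2" "ell2_norm y = 1"
  shows "\<exists>U. lin_on ell2 U \<and> U ` ell2 = ell2 \<and> (\<forall>z\<in>ell2. ell2_norm (U z) = ell2_norm z) \<and> U x = y"
proof (cases "x = y")
  case True
  then show ?thesis by (intro exI[of _ "\<lambda>z. z"]) (auto simp: lin_on_def)
next
  case False
  define w where "w = x - y"
  have w: "w \<in> ell2" unfolding w_def by (rule seq.subspace_diff[OF subspace_ell2 x(1) y(1)])
  define \<beta> where "\<beta> = ip x w"
  define \<omega> where "\<omega> = ip w w"
  have ip1: "ip x x = 1" "ip y y = 1" using ip_self[OF x(1)] ip_self[OF y(1)] x y by auto
  have \<omega>: "\<omega> = \<beta> + cj \<beta>"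
  proof -
    have "cj \<beta> = ip x x - ip y x"
      unfolding \<beta>_def ip_commute[OF x(1) w, symmetric] unfolding w_def by (rule ip_diff_left[OF x(1) y(1) x(1)])
    moreover have "ip y w = cj (ip w y)" by (rule ip_commute[OF w y(1)])
    moreover have "ip w y = ip x y - ip y y" unfolding w_def by (rule ip_diff_left[OF x(1) y(1) y(1)])
    moreover have "cj (ip x y) = ip y x" "cj (ip y y) = ip y y"
      by (rule ip_commute[symmetric, OF x(1) y(1)], rule ip_commute[symmetric, OF y(1) y(1)])
    moreover have "\<omega> = \<beta> - ip y w"
      unfolding \<omega>_def \<beta>_def using ip_diff_left[OF x(1) y(1) w] by (simp only: w_def[symmetric])
    ultimately show ?thesis by (simp add: cj_diff ip1)
  qed
  have "w \<noteq> 0" using False by (simp add: w_def)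
  then have "ell2_norm w \<noteq> 0" using norm_on_ell2 w unfolding norm_on_def by blast
  then have "\<omega> \<noteq> 0" unfolding \<omega>_def ip_self[OF w] by simp
  then have \<beta>: "\<beta> \<noteq> 0" using \<omega> by (auto simp: cj_0)
  then have cj\<beta>: "cj \<beta> \<noteq> 0" using cj_norm[of \<beta>] by auto
  define rank1 where "rank1 \<gamma> z = z - scale_seq (ip z w / \<gamma>) w" for \<gamma> z
  have rank1_in: "rank1 \<gamma> z \<in> ell2" if "z \<in> ell2" for \<gamma> z
    unfolding rank1_def by (intro seq.subspace_diff[OF subspace_ell2] that ell2_scale w)
  have ip_rank1: "ip (rank1 \<gamma> z) v = ip z v - ip z w / \<gamma> * ip w v" if "z \<in> ell2" "v \<in> ell2" for \<gamma> z v
    unfolding rank1_def using that w by (simp only: ip_diff_left ip_scale_left ell2_scale)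
  define U where "U = rank1 \<beta>"
  have lin: "lin_on ell2 U"
    unfolding lin_on_def
  proof (intro conjI ballI allI)
    fix u v :: "nat \<Rightarrow> 'k" assume uv: "u \<in> ell2" "v \<in> ell2"
    show "U (u + v) = U u + U v"
      unfolding U_def rank1_def ip_add_left[OF uv w]
      by (simp add: fun_eq_iff scale_seq_def add_divide_distrib algebra_simps)
  next
    fix d and u :: "nat \<Rightarrow> 'k" assume u: "u \<in> ell2"
    show "U (scale_seq d u) = scale_seq d (U u)"
      unfolding U_def rank1_def ip_scale_left[OF u w]
      by (simp add: fun_eq_iff scale_seq_def algebra_simps)
  qed
  have norm: "ell2_norm (U z) = ell2_norm z" if z: "z \<in> ell2" for z
  proof -
    define \<alpha> where "\<alpha> = ip z w / \<beta>"
    have zw: "ip z w = \<alpha> * \<beta>" using \<beta> by (simp add: \<alpha>_def)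
    have Uz: "U z \<in> ell2" unfolding U_def by (rule rank1_in[OF z])
    have "ip z (U z) = cj (ip (U z) z)" by (rule ip_commute[OF Uz z])
    also have "ip (U z) z = ip z z - \<alpha> * ip w z" unfolding U_def ip_rank1[OF z z] \<alpha>_def ..
    also have "ip w z = cj (\<alpha> * \<beta>)" unfolding ip_commute[OF z w] zw ..
    finally have 1: "ip z (U z) = cj (ip z z) - cj \<alpha> * (\<alpha> * \<beta>)" by (simp only: cj_diff cj_mult cj_cj)
    have "ip w (U z) = cj (ip (U z) w)" by (rule ip_commute[OF Uz w])
    also have "ip (U z) w = \<alpha> * \<beta> - \<alpha> * \<omega>" unfolding U_def ip_rank1[OF z w] \<alpha>_def[symmetric] \<omega>_def[symmetric] unfolding zw ..
    finally have 2: "ip w (U z) = cj \<alpha> * cj \<beta> - cj \<alpha> * cj \<omega>" by (simp only: cj_diff cj_mult)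
    have c\<omega>: "cj \<omega> = \<omega>" unfolding \<omega> by (simp add: cj_add cj_cj)
    have "ip (U z) (U z) = ip z (U z) - \<alpha> * ip w (U z)"
      using ip_rank1[OF z Uz, of \<beta>] by (simp only: U_def[symmetric] \<alpha>_def)
    also have "\<dots> = cj (ip z z)"
      unfolding 1 2 unfolding c\<omega> unfolding \<omega> by (simp add: algebra_simps)
    also have "\<dots> = ip z z" by (rule ip_commute[OF z z, symmetric])
    finally have "(ell2_norm (U z))\<^sup>2 = (ell2_norm z)\<^sup>2"
      unfolding ip_self[OF Uz] ip_self[OF z] of_real_eq_iff .
    then show ?thesis using ell2_norm_nonneg[OF Uz] ell2_norm_nonneg[OF z] by simp
  qed
  have surj: "U ` ell2 = ell2"
  proof
    show "U ` ell2 \<subseteq> ell2" unfolding U_def using rank1_in by blast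
    show "ell2 \<subseteq> U ` ell2"
    proof
      fix z :: "nat \<Rightarrow> 'k" assume z: "z \<in> ell2"
      \<comment> \<open>The inverse of \<open>U\<close> has the same form with \<beta> replaced by
        its conjugate; that the two corrections cancel is again \<omega> = \<beta> +
        \<open>cj \<beta>\<close>.\<close>
      define v where "v = rank1 (cj \<beta>) z"
      have v: "v \<in> ell2" unfolding v_def by (rule rank1_in[OF z])
      have "ip v w = ip z w - ip z w / cj \<beta> * \<omega>" unfolding v_def ip_rank1[OF z w] \<omega>_def ..
      then have "ip z w / cj \<beta> + ip v w / \<beta> = 0"
        using \<beta> cj\<beta> by (simp add: \<omega> field_simps)
      moreover have "U v j = z j - (ip z w / cj \<beta> + ip v w / \<beta>) * w j" for j
      proof -
        have "v j = z j - ip z w / cj \<beta> * w j" by (simp add: v_def rank1_def scale_seq_def)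
        moreover have "U v j = v j - ip v w / \<beta> * w j" by (simp add: U_def rank1_def scale_seq_def)
        ultimately show ?thesis by (simp only: distrib_right diff_diff_eq)
      qed
      ultimately have "U v = z" by (simp add: fun_eq_iff)
      then show "z \<in> U ` ell2" using v by blast
    qed
  qed
  have "U x = y" unfolding U_def rank1_def \<beta>_def[symmetric] using \<beta> by (simp add: w_def)
  then show ?thesis using lin norm surj by blast
qed

text \<open>The norm of \<open>ell2\<close> is pulled back along \<open>T\<close>, and surjective
  isometries of \<open>ell2\<close> are conjugated by \<open>T\<close>. Orbits already fill the
  whole sphere, which is then contained in their closures.\<close>

lemma isomorphic_ell2_almost_transitive:
  fixes Y :: "(nat \<Rightarrow> 'k) set"
  assumes Y: "seq.subspace Y" and iso: "isomorphic_spaces Y N0 ell2 ell2_norm"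
  shows "\<exists>N. norm_on Y N \<and> equivalent_norms_on Y N0 N \<and> almost_transitive Y N"
proof -
  obtain T where T: "lin_on Y T" "bij_betw T Y ell2" "equivalent_norms_on Y N0 (ell2_norm \<circ> T)"
    using iso unfolding isomorphic_spaces_def by blast
  define N where "N = ell2_norm \<circ> T"
  define S where "S = inv_into Y T"
  have TY: "T x \<in> ell2" if "x \<in> Y" for x using T(2) that by (auto simp: bij_betw_def)
  have S: "S a \<in> Y" "T (S a) = a" if "a \<in> ell2" for a
    using T(2) that by (auto simp: S_def bij_betw_def inv_into_into f_inv_into_f)
  have ST: "S (T x) = x" if "x \<in> Y" for x
    using T(2) that by (auto simp: S_def bij_betw_def)
  have T_add: "T (x + y) = T x + T y" and T_scale: "T (scale_seq d x) = scale_seq d (T x)"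
    if "x \<in> Y" "y \<in> Y" for x y d using T(1) that unfolding lin_on_def by blast+
  have Y_add: "x + y \<in> Y" and Y_scale: "scale_seq d x \<in> Y" if "x \<in> Y" "y \<in> Y" for x y d
    using that seq.subspace_add[OF Y] seq.subspace_scale[OF Y] by auto
  have T_zero: "T x = 0 \<longleftrightarrow> x = 0" if "x \<in> Y" for x
    using ST[OF that] ST[OF seq.subspace_0[OF Y]] lin_on_zero[OF Y T(1)] by metis
  have norm: "norm_on Y N"
    unfolding norm_on_def N_def o_def
  proof (intro conjI ballI allI)
    fix x y assume xy: "x \<in> Y" "y \<in> Y"
    show "ell2_norm (T (x + y)) \<le> ell2_norm (T x) + ell2_norm (T y)"
      unfolding T_add[OF xy] by (intro ell2_add TY xy)
  next
    fix x assume x: "x \<in> Y"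
    show "0 \<le> ell2_norm (T x)" by (intro ell2_norm_nonneg TY x)
    show "ell2_norm (T x) = 0 \<longleftrightarrow> x = 0"
      using norm_on_ell2 TY[OF x] T_zero[OF x] unfolding norm_on_def by blast
  next
    fix d x assume x: "x \<in> Y"
    show "ell2_norm (T (scale_seq d x)) = norm d * ell2_norm (T x)"
      unfolding T_scale[OF x x] by (intro ell2_scale TY x)
  qed
  interpret Metric_space Y "norm_dist Y N" by (rule Metric_space_norm_dist[OF Y norm])
  have "almost_transitive Y N"
    unfolding almost_transitive_def norm_topology_def
  proof
    fix y assume "y \<in> unit_sphere Y N"
    then have y: "y \<in> Y" "ell2_norm (T y) = 1" by (auto simp: unit_sphere_def N_def)
    have "unit_sphere Y N \<subseteq> {V y | V. V \<in> surj_lin_isometries Y N}"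
    proof
      fix x assume "x \<in> unit_sphere Y N"
      then have x: "x \<in> Y" "ell2_norm (T x) = 1" by (auto simp: unit_sphere_def N_def)
      obtain U where U: "lin_on ell2 U" "U ` ell2 = ell2" "\<And>z. z \<in> ell2 \<Longrightarrow> ell2_norm (U z) = ell2_norm z"
        "U (T y) = T x"
        using ell2_transitive[OF TY[OF y(1)] y(2) TY[OF x(1)] x(2)] by blast
      define V where "V v = S (U (T v))" for v
      have UT: "U (T v) \<in> ell2" if "v \<in> Y" for v using U(2) TY[OF that] by blast
      have VY: "V v \<in> Y" and TV: "T (V v) = U (T v)" if "v \<in> Y" for v
        unfolding V_def using S UT[OF that] by auto
      have V_eqI: "V v = u" if "v \<in> Y" "u \<in> Y" "T u = U (T v)" for u v
        unfolding V_def that(3)[symmetric] by (rule ST[OF that(2)])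
      have "lin_on Y V"
        unfolding lin_on_def
      proof (intro conjI ballI allI)
        fix u v assume uv: "u \<in> Y" "v \<in> Y"
        show "V (u + v) = V u + V v"
          using U(1) TY uv VY by (intro V_eqI) (auto simp: T_add TV lin_on_def intro!: Y_add)
      next
        fix d u assume u: "u \<in> Y"
        have "T (scale_seq d (V u)) = scale_seq d (U (T u))"
          using T_scale[OF VY[OF u] VY[OF u]] TV[OF u] by simp
        also have "\<dots> = U (scale_seq d (T u))" using U(1) TY[OF u] unfolding lin_on_def by metis
        also have "scale_seq d (T u) = T (scale_seq d u)" using T_scale[OF u u] by simp
        finally show "V (scale_seq d u) = scale_seq d (V u)"
          using u VY[OF u] by (intro V_eqI Y_scale[OF _ u])
      qed
      moreover have "V ` Y = Y"
      proof
        show "V ` Y \<subseteq> Y" using VY by blast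
        show "Y \<subseteq> V ` Y"
        proof
          fix u assume u: "u \<in> Y"
          then obtain z where z: "z \<in> ell2" "T u = U z" using TY U(2) by (metis imageE)
          then have "V (S z) = u" using S u by (intro V_eqI) auto
          then show "u \<in> V ` Y" using S(1)[OF z(1)] by blast
        qed
      qed
      moreover have "N (V v) = N v" if "v \<in> Y" for v using TV[OF that] U(3)[OF TY[OF that]] by (simp add: N_def)
      ultimately have "V \<in> surj_lin_isometries Y N" unfolding surj_lin_isometries_def by blast
      moreover have "V y = x" using V_eqI[OF y(1) x(1)] U(4) by simp
      ultimately show "x \<in> {V y | V. V \<in> surj_lin_isometries Y N}" by blast
    qed
    moreover have "{V y | V. V \<in> surj_lin_isometries Y N} \<subseteq> topspace mtopology"
      using y(1) by (auto simp: surj_lin_isometries_def)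
    ultimately show "unit_sphere Y N \<subseteq> mtopology closure_of {V y | V. V \<in> surj_lin_isometries Y N}"
      using closure_of_subset by blast
  qed
  then show ?thesis using norm T(3) N_def by blast
qed

text \<open>For the forward direction: without doubling the copy of \<open>ell2\<close> comes from
  bounded sequences, with doubling it is extracted from the almost transitive norm. The converse
  keeps the subspace and changes only its norm.\<close>

lemma almost_transitive_iff_contains_ell2:
  assumes M: "orlicz_function M"
  shows "(\<exists>Y. banach_subspace Y (orlicz_space M :: (nat \<Rightarrow> 'k) set) (orlicz_norm M) \<and>
             (\<exists>N. norm_on Y N \<and> equivalent_norms_on Y (orlicz_norm M) N \<and> almost_transitive Y N)) \<longleftrightarrow>
         contains_ell2 TYPE('k) M" (is "?L \<longleftrightarrow> ?R")
proof
  interpret orlicz M by unfold_locales (rule M)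
  assume ?L
  then obtain Y and N :: "(nat \<Rightarrow> 'k) \<Rightarrow> real" where Y: "Y \<subseteq> orlicz_space M" "seq.subspace Y" "infinite_dimensional Y"
    and N: "norm_on Y N" "equivalent_norms_on Y (orlicz_norm M) N" "almost_transitive Y N"
    unfolding banach_subspace_def by blast
  show ?R
  proof (cases delta2)
    case True
    then obtain D where D: "\<And>t. 0 < t \<Longrightarrow> t \<le> b \<Longrightarrow> M (2 * t) \<le> D * M t"
      unfolding delta2_def by blast
    interpret orlicz_delta2 M "max 1 D"
    proof unfold_locales
      fix t assume t: "0 \<le> t" "t \<le> b"
      show "M (2 * t) \<le> max 1 D * M t"
      proof (cases "t = 0")
        case False
        then have "M (2 * t) \<le> D * M t" using t D by simp
        also have "\<dots> \<le> max 1 D * M t" using t by (intro mult_right_mono M_nonneg) auto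
        finally show ?thesis .
      qed simp
    qed simp
    show ?thesis by (rule almost_transitive_contains_ell2[OF Y N])
  next
    case False
    then show ?thesis by (rule not_delta2_contains_ell2)
  qed
next
  assume ?R
  then show ?L using isomorphic_ell2_almost_transitive unfolding banach_subspace_def by blast
qed

end

interpretation real_conjugation: conjugation "\<lambda>x::real. x"
proof (rule conjugation.intro)
  show "bounded_linear (\<lambda>x::real. x)" by (rule bounded_linear_ident)
qed (auto simp: power2_eq_square)

interpretation complex_conjugation: conjugation cnj
proof (rule conjugation.intro)
  show "bounded_linear cnj" by (rule bounded_linear_cnj)
  show "x * cnj x = of_real ((norm x)\<^sup>2)" for x by (rule complex_norm_square[symmetric])
qed auto

theorem theorem2p17:
  fixes M :: "real \<Rightarrow> real"
  assumes "orlicz_function M"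
  shows "((\<exists>Y. banach_subspace Y (orlicz_space M :: (nat \<Rightarrow> real) set) (orlicz_norm M) \<and>
             (\<exists>N. norm_on Y N \<and> equivalent_norms_on Y (orlicz_norm M) N \<and> almost_transitive Y N)) \<longleftrightarrow>
          (\<exists>Y. banach_subspace Y (orlicz_space M :: (nat \<Rightarrow> real) set) (orlicz_norm M) \<and>
             isomorphic_spaces Y (orlicz_norm M) ell2 ell2_norm)) \<and>
         ((\<exists>Y. banach_subspace Y (orlicz_space M :: (nat \<Rightarrow> complex) set) (orlicz_norm M) \<and>
             (\<exists>N. norm_on Y N \<and> equivalent_norms_on Y (orlicz_norm M) N \<and> almost_transitive Y N)) \<longleftrightarrow>
          (\<exists>Y. banach_subspace Y (orlicz_space M :: (nat \<Rightarrow> complex) set) (orlicz_norm M) \<and>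
             isomorphic_spaces Y (orlicz_norm M) ell2 ell2_norm))"
  using real_conjugation.almost_transitive_iff_contains_ell2[OF assms]
    complex_conjugation.almost_transitive_iff_contains_ell2[OF assms] by blast

end
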